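(* Let $(M,J)$ be a compact complex surface (complex dimension $2$) with a pluriclosed metric $\omega$ (i.e. $\omega$ is the fundamental form of a Hermitian metric and $\partial\bar\partial\omega=0$). (a) If $\rho^{1,1}(\omega)$ is non-negative definite, then either $\omega$ is Kähler or the Dolbeault cohomology $H^{p,0}_{\bar\partial}(M;\mathbb{C})$ is trivial for $1\le p\le 2$. (b) If the Bismut scalar curvature $r=\operatorname{tr}_\omega\rho^{1,1}(\omega)$ is non-negative, then either $\omega$ is Kähler or $H^{2,0}_{\bar\partial}(M;\mathbb{C})$ is trivial.
   Context: For a Hermitian metric $g$, $\omega(\cdot,\cdot)=g(J\cdot,\cdot)$, locally $\omega=\sqrt{-1}\,g_{i\bar j}\,dz^i\wedge d\bar z^j$. $\rho^{1,1}(\omega)=-\partial\partial^*\omega-\bar\partial\bar\partial^*\omega-\sqrt{-1}\,\partial\bar\partial\log\det g$ is the $(1,1)$-part of the Ricci form of the Bismut connection (the unique connection preserving $g$ and $J$ with totally skew-symmetric torsion); $\partial^*,\bar\partial^*$ are formal $L^2$-adjoints. Writing $\rho^{1,1}=\sqrt{-1}\,P_{i\bar j}\,dz^i\wedge d\bar z^j$, non-negativity of $\rho^{1,1}$ means that the Hermitian matrix $(P_{i\bar j})$ is positive semidefinite at every point, and $\operatorname{tr}_\omega\rho^{1,1}=g^{\bar j i}P_{i\bar j}$, where $(g^{\bar j i})$ is the inverse matrix of $(g_{i\bar j})$. *)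

theory Defs
  imports "HOL-Analysis.Analysis"
begin

section \<open>Calculus on open subsets of complex coordinate space\<close>

primrec ck_on :: "nat \<Rightarrow> (complex ^ 'n) set \<Rightarrow> (complex ^ 'n \<Rightarrow> complex) \<Rightarrow> bool" where
  "ck_on 0 U f \<longleftrightarrow> continuous_on U f"
| "ck_on (Suc k) U f \<longleftrightarrow> (\<forall>z\<in>U. f differentiable (at z)) \<and>
     (\<forall>v. ck_on k U (\<lambda>z. frechet_derivative f (at z) v))"

definition smooth_on :: "(complex ^ 'n) set \<Rightarrow> (complex ^ 'n \<Rightarrow> complex) \<Rightarrow> bool" where
  "smooth_on U f \<longleftrightarrow> (\<forall>k. ck_on k U f)"

definition holomorphic_map_on ::
  "(complex ^ 'n) set \<Rightarrow> (complex ^ 'n \<Rightarrow> complex ^ 'm) \<Rightarrow> bool" where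
  "holomorphic_map_on U f \<longleftrightarrow>
     (\<forall>z\<in>U. \<exists>D. (f has_derivative D) (at z) \<and> (\<forall>c v. D (c *s v) = c *s D v))"

text \<open>The Wirtinger derivatives \<open>\<partial>f/\<partial>z\<^sup>k\<close> and
  \<open>\<partial>f/\<partial>zbar\<^sup>k\<close>; the real directions
  \<open>\<partial>/\<partial>x\<^sup>k\<close> and \<open>\<partial>/\<partial>y\<^sup>k\<close> are
  \<open>axis k 1\<close> and \<open>axis k \<i>\<close>.\<close>

definition wirt :: "'n \<Rightarrow> (complex ^ 'n \<Rightarrow> complex) \<Rightarrow> complex ^ 'n \<Rightarrow> complex" where
  "wirt k f z = (frechet_derivative f (at z) (axis k 1)
                 - \<i> * frechet_derivative f (at z) (axis k \<i>)) / 2"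

definition wirt_bar :: "'n \<Rightarrow> (complex ^ 'n \<Rightarrow> complex) \<Rightarrow> complex ^ 'n \<Rightarrow> complex" where
  "wirt_bar k f z = (frechet_derivative f (at z) (axis k 1)
                     + \<i> * frechet_derivative f (at z) (axis k \<i>)) / 2"

section \<open>Forms of type (p,q) in coordinates\<close>

text \<open>A \<open>(p,q)\<close>-form on an open set is given by its components \<open>\<alpha> I J\<close>
  (\<open>length I = p\<close>, \<open>length J = q\<close>), antisymmetric in \<open>I\<close> and in \<open>J\<close>, standing for
  \<open>1/(p! q!) \<Sum> \<alpha> I J dz\<^sup>I\<^sup>1 \<and> \<dots> \<and> dz\<^sup>I\<^sup>p \<and> d zbar\<^sup>J\<^sup>1 \<and> \<dots> \<and> d zbar\<^sup>J\<^sup>q\<close>.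
  Components at lists of other lengths, and values outside the open set, are irrelevant.\<close>

type_synonym 'n comps = "'n list \<Rightarrow> 'n list \<Rightarrow> complex ^ 'n \<Rightarrow> complex"

definition local_form :: "(complex ^ 'n) set \<Rightarrow> nat \<Rightarrow> nat \<Rightarrow> 'n comps \<Rightarrow> bool" where
  "local_form U p q \<alpha> \<longleftrightarrow> (\<forall>I J. length I = p \<longrightarrow> length J = q \<longrightarrow>
     smooth_on U (\<alpha> I J) \<and>
     (\<forall>a<p. \<forall>b<p. a \<noteq> b \<longrightarrow> (\<forall>z\<in>U. \<alpha> (I[a := I ! b, b := I ! a]) J z = - \<alpha> I J z)) \<and>
     (\<forall>a<q. \<forall>b<q. a \<noteq> b \<longrightarrow> (\<forall>z\<in>U. \<alpha> I (J[a := J ! b, b := J ! a]) z = - \<alpha> I J z)))"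

definition vanishes_on :: "(complex ^ 'n) set \<Rightarrow> nat \<Rightarrow> nat \<Rightarrow> 'n comps \<Rightarrow> bool" where
  "vanishes_on U p q \<alpha> \<longleftrightarrow>
     (\<forall>I J. length I = p \<longrightarrow> length J = q \<longrightarrow> (\<forall>z\<in>U. \<alpha> I J z = 0))"

definition omit :: "nat \<Rightarrow> 'n list \<Rightarrow> 'n list" where
  "omit a I = take a I @ drop (Suc a) I"

definition del :: "'n::finite comps \<Rightarrow> 'n comps" where
  "del \<alpha> I J z = (\<Sum>a<length I. (- 1) ^ a * wirt (I ! a) (\<alpha> (omit a I) J) z)"

text \<open>The sign \<open>(- 1) ^ length I\<close> comes from moving \<open>d zbar\<^sup>k\<close> past
  \<open>dz\<^sup>I\<close>.\<close>

definition delbar :: "'n::finite comps \<Rightarrow> 'n comps" where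
  "delbar \<alpha> I J z =
     (- 1) ^ length I * (\<Sum>b<length J. (- 1) ^ b * wirt_bar (J ! b) (\<alpha> I (omit b J)) z)"

section \<open>Hermitian metrics in coordinates and formal adjoints\<close>

text \<open>\<open>G z $ i $ j\<close> is \<open>g_{i jbar}\<close>, so that
  \<open>matrix_inv (G z) $ j $ i\<close> is the entry of the inverse matrix usually written with upper
  indices \<open>jbar i\<close>.\<close>

definition hermitian_matrix :: "complex ^ 'n ^ 'n \<Rightarrow> bool" where
  "hermitian_matrix P \<longleftrightarrow> (\<forall>i j. P $ j $ i = cnj (P $ i $ j))"

definition hermitian_pos_def :: "complex ^ 'n ^ 'n \<Rightarrow> bool" where
  "hermitian_pos_def P \<longleftrightarrow> hermitian_matrix P \<and>
     (\<forall>v. v \<noteq> 0 \<longrightarrow> 0 < Re (\<Sum>i\<in>UNIV. \<Sum>j\<in>UNIV. P $ i $ j * v $ i * cnj (v $ j)))"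

definition hermitian_pos_semidef :: "complex ^ 'n ^ 'n \<Rightarrow> bool" where
  "hermitian_pos_semidef P \<longleftrightarrow> hermitian_matrix P \<and>
     (\<forall>v. 0 \<le> Re (\<Sum>i\<in>UNIV. \<Sum>j\<in>UNIV. P $ i $ j * v $ i * cnj (v $ j)))"

definition fund_form :: "(complex ^ 'n \<Rightarrow> complex ^ 'n ^ 'n) \<Rightarrow> 'n comps" where
  "fund_form G I J z = \<i> * G z $ hd I $ hd J"

text \<open>Pointwise Hermitian inner product of \<open>(p,q)\<close>-forms, normalised so that for a unitary
  coframe the forms \<open>dz\<^sup>I \<and> d zbar\<^sup>J\<close> with increasing \<open>I\<close>, \<open>J\<close> are
  orthonormal; the factorials compensate for summing over all index lists.\<close>

definition form_inner ::
  "(complex ^ 'n \<Rightarrow> complex ^ 'n ^ 'n) \<Rightarrow> nat \<Rightarrow> nat \<Rightarrow> 'n comps \<Rightarrow> 'n comps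
     \<Rightarrow> complex ^ 'n \<Rightarrow> complex" where
  "form_inner G p q \<alpha> \<beta> z =
     (\<Sum>I | length I = p. \<Sum>K | length K = p. \<Sum>J | length J = q. \<Sum>L | length L = q.
        \<alpha> I J z * cnj (\<beta> K L z)
        * (\<Prod>a<p. matrix_inv (G z) $ (K ! a) $ (I ! a))
        * (\<Prod>b<q. matrix_inv (G z) $ (J ! b) $ (L ! b))) / (fact p * fact q)"

text \<open>The volume form \<open>\<omega>\<^sup>n / n!\<close> is \<open>2\<^sup>n det g\<close> times Lebesgue measure.\<close>

definition L2_inner ::
  "(complex ^ 'n) set \<Rightarrow> (complex ^ 'n \<Rightarrow> complex ^ 'n ^ 'n) \<Rightarrow> nat \<Rightarrow> nat
     \<Rightarrow> 'n comps \<Rightarrow> 'n comps \<Rightarrow> complex" where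
  "L2_inner U G p q \<alpha> \<beta> =
     set_lebesgue_integral lborel U
       (\<lambda>z. form_inner G p q \<alpha> \<beta> z * (2 ^ CARD('n) * det (G z)))"

definition test_form :: "(complex ^ 'n) set \<Rightarrow> nat \<Rightarrow> nat \<Rightarrow> 'n comps \<Rightarrow> bool" where
  "test_form U p q \<phi> \<longleftrightarrow> local_form U p q \<phi> \<and>
     (\<exists>K. compact K \<and> K \<subseteq> U \<and> vanishes_on (U - K) p q \<phi>)"

text \<open>Formal adjoints are differential operators, hence determined by test forms supported in a
  coordinate domain. The form selected below is unique as far as its values on \<open>U\<close> at
  index lists of the relevant lengths are concerned.\<close>

definition del_star ::
  "(complex ^ 'n) set \<Rightarrow> (complex ^ 'n \<Rightarrow> complex ^ 'n ^ 'n) \<Rightarrow> nat \<Rightarrow> nat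
     \<Rightarrow> 'n comps \<Rightarrow> 'n comps" where
  "del_star U G p q \<alpha> = (SOME \<beta>. local_form U (p - 1) q \<beta> \<and>
     (\<forall>\<phi>. test_form U (p - 1) q \<phi> \<longrightarrow>
        L2_inner U G p q (del \<phi>) \<alpha> = L2_inner U G (p - 1) q \<phi> \<beta>))"

definition delbar_star ::
  "(complex ^ 'n) set \<Rightarrow> (complex ^ 'n \<Rightarrow> complex ^ 'n ^ 'n) \<Rightarrow> nat \<Rightarrow> nat
     \<Rightarrow> 'n comps \<Rightarrow> 'n comps" where
  "delbar_star U G p q \<alpha> = (SOME \<beta>. local_form U p (q - 1) \<beta> \<and>
     (\<forall>\<phi>. test_form U p (q - 1) \<phi> \<longrightarrow>
        L2_inner U G p q (delbar \<phi>) \<alpha> = L2_inner U G p (q - 1) \<phi> \<beta>))"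

text \<open>Here \<open>det (G z)\<close> is a positive real number, so \<open>Ln\<close> is its real logarithm.\<close>

definition log_det :: "(complex ^ 'n \<Rightarrow> complex ^ 'n ^ 'n) \<Rightarrow> 'n comps" where
  "log_det G I J z = Ln (det (G z))"

definition bismut_rho ::
  "(complex ^ 'n) set \<Rightarrow> (complex ^ 'n \<Rightarrow> complex ^ 'n ^ 'n) \<Rightarrow> 'n comps" where
  "bismut_rho U G I J z =
     - del (del_star U G 1 1 (fund_form G)) I J z
     - delbar (delbar_star U G 1 1 (fund_form G)) I J z
     - \<i> * del (delbar (log_det G)) I J z"

text \<open>The matrix \<open>P\<close> in \<open>\<rho> = \<i> P_{i jbar} dz\<^sup>i \<and> d zbar\<^sup>j\<close>.\<close>

definition bismut_ricci_matrix ::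
  "(complex ^ 'n) set \<Rightarrow> (complex ^ 'n \<Rightarrow> complex ^ 'n ^ 'n) \<Rightarrow> complex ^ 'n \<Rightarrow> complex ^ 'n ^ 'n"
  where
  "bismut_ricci_matrix U G z = (\<chi> i j. bismut_rho U G [i] [j] z / \<i>)"

text \<open>The trace is a real number because \<open>g\<close> and \<open>P\<close> are Hermitian;
  \<open>Re\<close> only changes the type.\<close>

definition bismut_scalar ::
  "(complex ^ 'n) set \<Rightarrow> (complex ^ 'n \<Rightarrow> complex ^ 'n ^ 'n) \<Rightarrow> complex ^ 'n \<Rightarrow> real" where
  "bismut_scalar U G z =
     Re (\<Sum>i\<in>UNIV. \<Sum>j\<in>UNIV. matrix_inv (G z) $ j $ i * bismut_ricci_matrix U G z $ i $ j)"

section \<open>Complex manifolds, global forms and metrics\<close>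

type_synonym ('a, 'n) chart = "'a set \<times> ('a \<Rightarrow> complex ^ 'n)"

definition chart_image :: "('a, 'n::finite) chart \<Rightarrow> (complex ^ 'n) set" where
  "chart_image c = snd c ` fst c"

definition transition :: "('a, 'n::finite) chart \<Rightarrow> ('a, 'n) chart \<Rightarrow> complex ^ 'n \<Rightarrow> complex ^ 'n" where
  "transition c d = snd d \<circ> inv_into (fst c) (snd c)"

definition complex_atlas :: "('a::topological_space, 'n::finite) chart set \<Rightarrow> bool" where
  "complex_atlas A \<longleftrightarrow>
     (\<forall>c\<in>A. open (fst c) \<and> open (chart_image c) \<and>
        (\<exists>\<psi>. homeomorphism (fst c) (chart_image c) (snd c) \<psi>)) \<and>
     (\<Union>c\<in>A. fst c) = UNIV \<and>
     (\<forall>c\<in>A. \<forall>d\<in>A. holomorphic_map_on (snd c ` (fst c \<inter> fst d)) (transition c d))"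

text \<open>A global form is a family of local forms, one for each chart of the atlas, related by
  pullback along the (holomorphic) transition maps.\<close>

type_synonym ('a, 'n) dform = "('a, 'n) chart \<Rightarrow> 'n comps"

definition pq_form ::
  "('a, 'n::finite) chart set \<Rightarrow> nat \<Rightarrow> nat \<Rightarrow> ('a, 'n) dform \<Rightarrow> bool" where
  "pq_form A p q \<alpha> \<longleftrightarrow>
     (\<forall>c\<in>A. local_form (chart_image c) p q (\<alpha> c)) \<and>
     (\<forall>c\<in>A. \<forall>d\<in>A. \<forall>x\<in>fst c \<inter> fst d. \<forall>I J. length I = p \<longrightarrow> length J = q \<longrightarrow>
        \<alpha> c I J (snd c x) =
          (\<Sum>K | length K = p. \<Sum>L | length L = q.
             \<alpha> d K L (snd d x)
             * (\<Prod>a<p. wirt (I ! a) (\<lambda>z. transition c d z $ (K ! a)) (snd c x))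
             * (\<Prod>b<q. cnj (wirt (J ! b) (\<lambda>z. transition c d z $ (L ! b)) (snd c x)))))"

definition form_vanishes ::
  "('a, 'n::finite) chart set \<Rightarrow> nat \<Rightarrow> nat \<Rightarrow> ('a, 'n) dform \<Rightarrow> bool" where
  "form_vanishes A p q \<alpha> \<longleftrightarrow> (\<forall>c\<in>A. vanishes_on (chart_image c) p q (\<alpha> c))"

definition delbar_closed_forms ::
  "('a, 'n::finite) chart set \<Rightarrow> nat \<Rightarrow> nat \<Rightarrow> ('a, 'n) dform set" where
  "delbar_closed_forms A p q =
     {\<alpha>. pq_form A p q \<alpha> \<and> form_vanishes A p (Suc q) (\<lambda>c. delbar (\<alpha> c))}"

text \<open>For \<open>q = 0\<close> there are no forms of type \<open>(p, q - 1)\<close>, so only the zero form is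
  exact.\<close>

definition delbar_exact ::
  "('a, 'n::finite) chart set \<Rightarrow> nat \<Rightarrow> nat \<Rightarrow> ('a, 'n) dform \<Rightarrow> bool" where
  "delbar_exact A p q \<alpha> \<longleftrightarrow>
     (case q of
        0 \<Rightarrow> form_vanishes A p 0 \<alpha>
      | Suc q' \<Rightarrow> \<exists>\<gamma>. pq_form A p q' \<gamma> \<and>
          form_vanishes A p q (\<lambda>c I J z. \<alpha> c I J z - delbar (\<gamma> c) I J z))"

definition dolbeault_cohomology ::
  "('a, 'n::finite) chart set \<Rightarrow> nat \<Rightarrow> nat \<Rightarrow> ('a, 'n) dform set set" where
  "dolbeault_cohomology A p q =
     delbar_closed_forms A p q //
       {(\<alpha>, \<beta>). \<alpha> \<in> delbar_closed_forms A p q \<and> \<beta> \<in> delbar_closed_forms A p q \<and>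
          delbar_exact A p q (\<lambda>c I J z. \<alpha> c I J z - \<beta> c I J z)}"

definition dolbeault_trivial :: "('a, 'n::finite) chart set \<Rightarrow> nat \<Rightarrow> nat \<Rightarrow> bool" where
  "dolbeault_trivial A p q \<longleftrightarrow> is_singleton (dolbeault_cohomology A p q)"

type_synonym ('a, 'n) metric = "('a, 'n) chart \<Rightarrow> complex ^ 'n \<Rightarrow> complex ^ 'n ^ 'n"

text \<open>Smoothness and the transformation law of the components \<open>g_{i jbar}\<close> are those of the
  fundamental form.\<close>

definition hermitian_metric ::
  "('a, 'n::finite) chart set \<Rightarrow> ('a, 'n) metric \<Rightarrow> bool" where
  "hermitian_metric A g \<longleftrightarrow> pq_form A 1 1 (\<lambda>c. fund_form (g c)) \<and>
     (\<forall>c\<in>A. \<forall>z\<in>chart_image c. hermitian_pos_def (g c z))"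

definition pluriclosed ::
  "('a, 'n::finite) chart set \<Rightarrow> ('a, 'n) metric \<Rightarrow> bool" where
  "pluriclosed A g \<longleftrightarrow> form_vanishes A 2 2 (\<lambda>c. del (delbar (fund_form (g c))))"

text \<open>\<open>d\<omega> = del \<omega> + delbar \<omega>\<close>, whose two summands have types
  \<open>(2,1)\<close> and \<open>(1,2)\<close>.\<close>

definition kaehler :: "('a, 'n::finite) chart set \<Rightarrow> ('a, 'n) metric \<Rightarrow> bool" where
  "kaehler A g \<longleftrightarrow> form_vanishes A 2 1 (\<lambda>c. del (fund_form (g c))) \<and>
     form_vanishes A 1 2 (\<lambda>c. delbar (fund_form (g c)))"

definition bismut_ricci_nonneg ::
  "('a, 'n::finite) chart set \<Rightarrow> ('a, 'n) metric \<Rightarrow> bool" where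
  "bismut_ricci_nonneg A g \<longleftrightarrow>
     (\<forall>c\<in>A. \<forall>z\<in>chart_image c.
        hermitian_pos_semidef (bismut_ricci_matrix (chart_image c) (g c) z))"

definition bismut_scalar_nonneg ::
  "('a, 'n::finite) chart set \<Rightarrow> ('a, 'n) metric \<Rightarrow> bool" where
  "bismut_scalar_nonneg A g \<longleftrightarrow>
     (\<forall>c\<in>A. \<forall>z\<in>chart_image c. 0 \<le> bismut_scalar (chart_image c) (g c) z)"

end

theory Submission
  imports Defs
begin

text \<open>The Bochner method. Computing the formal adjoints by integration by parts expresses
  \<open>\<rho>\<^sup>1\<^sup>,\<^sup>1\<close> through derivatives of the metric, and for a pluriclosed metric the second order
  terms combine to \<open>P = S - Q\<close>, where \<open>S\<close> is the second Ricci curvature of the Chern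
  connection and \<open>Q \<ge> 0\<close> is quadratic in the torsion. For a holomorphic \<open>(1,0)\<close>-form \<open>\<alpha>\<close>
  with dual vector \<open>v\<close>, the function \<open>u = \<bar>\<alpha>\<bar>\<^sup>2\<close> satisfies
  \<open>\<Delta> u = \<bar>\<nabla>\<alpha>\<bar>\<^sup>2 + P(v, v) + Q(v, v)\<close> for the Chern Laplacian \<open>\<Delta>\<close>; for a holomorphic
  \<open>(2,0)\<close>-form, \<open>\<Delta> u = \<bar>\<nabla>\<alpha>\<bar>\<^sup>2 + (tr P + tr Q) u\<close>. So \<open>u\<close> is subharmonic, hence constant by
  the strong maximum principle, and either \<open>\<alpha> = 0\<close> or the torsion term vanishes
  everywhere. In dimension two the latter forces the torsion itself to vanish: the
  metric is Kaehler.\<close>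

section \<open>Smooth functions and Wirtinger derivatives\<close>

text \<open>One could also integrate \<Delta> u over M, but that calls for integration on a
  manifold. The strong maximum principle works inside one chart at a time, so integrals occur only
  for compactly supported functions on coordinate domains, where the formal adjoints are defined.
  Those adjoints are picked by \<open>SOME\<close>: \<rho> cannot be computed before a concrete
  adjoint of \<omega> is exhibited and shown to be the only one. Integration by parts exhibits it,
  as a multiple of the trace of the torsion, and test forms built from bump functions show that it
  is unique. Positivity is proved throughout by writing the inverse metric as a sum of two rank one
  terms, which turns contractions with it into sums of squares. Dimension two enters at the end
  because antisymmetry leaves the torsion only the index pair (1, 2): contracting it with a vector x
  merely multiplies it by the coordinates of x, so any nonzero x recovers it.\<close>

abbreviation fderiv :: "(complex ^ 'n \<Rightarrow> complex) \<Rightarrow> complex ^ 'n \<Rightarrow> complex ^ 'n \<Rightarrow> complex" where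
  "fderiv f z \<equiv> frechet_derivative f (at z)"

lemma fderivI: "(f has_derivative D) (at z) \<Longrightarrow> fderiv f z = D"
  by (rule frechet_derivative_at [symmetric])

lemma differentiable_cong_open:
  assumes "open U" "z \<in> U" "\<And>w. w \<in> U \<Longrightarrow> f w = g w" "f differentiable (at z)"
  shows "g differentiable (at z)"
  using assms unfolding differentiable_def
  by (metis has_derivative_transform_within_open)

lemma fderiv_cong_open:
  assumes "open U" "z \<in> U" "\<And>w. w \<in> U \<Longrightarrow> f w = g w"
  shows "fderiv f z = fderiv g z"
proof -
  have "(f has_derivative D) (at z) \<longleftrightarrow> (g has_derivative D) (at z)" for D
    using has_derivative_transform_within_open[OF _ assms(1,2), of f D UNIV g]
      has_derivative_transform_within_open[OF _ assms(1,2), of g D UNIV f] assms(3) by auto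
  then show ?thesis unfolding frechet_derivative_def by simp
qed

text \<open>Many differentiation rules hold only at points of \<open>U\<close>. Openness of
  \<open>U\<close> makes an equality on \<open>U\<close> pass to all derivatives, so that such rules
  can rewrite inside the recursion of \<open>ck_on\<close>.\<close>

lemma ck_on_cong:
  assumes "open U" "\<And>w. w \<in> U \<Longrightarrow> f w = g w" "ck_on k U f"
  shows "ck_on k U g"
  using assms(2,3)
proof (induction k arbitrary: f g)
  case 0
  then show ?case using continuous_on_cong[of U U f g] by simp
next
  case (Suc k)
  have "g differentiable (at z)" if "z \<in> U" for z
    using differentiable_cong_open[OF assms(1) that Suc.prems(1)] Suc.prems(2) that by auto
  moreover have "ck_on k U (\<lambda>z. fderiv g z v)" for v
  proof (rule Suc.IH)
    show "ck_on k U (\<lambda>z. fderiv f z v)" using Suc.prems(2) by simp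
    show "fderiv f w v = fderiv g w v" if "w \<in> U" for w
      using fderiv_cong_open[OF assms(1) that Suc.prems(1)] by simp
  qed
  ultimately show ?case by simp
qed

text \<open>Serves the inductions for products and inverses, whose derivatives still contain
  undifferentiated factors.\<close>

lemma ck_on_Suc_D: "ck_on (Suc k) U f \<Longrightarrow> ck_on k U f"
proof (induction k arbitrary: f)
  case 0
  then show ?case
    by (auto intro!: continuous_at_imp_continuous_on differentiable_imp_continuous_within)
next
  case (Suc k)
  then show ?case by simp
qed

lemma ck_on_const: "ck_on k U (\<lambda>z. c)"
  by (induction k arbitrary: c) auto

lemma fderiv_add:
  assumes "f differentiable (at z)" "g differentiable (at z)"
  shows "fderiv (\<lambda>z. f z + g z) z = (\<lambda>v. fderiv f z v + fderiv g z v)"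
  using assms by (intro fderivI has_derivative_add) (simp_all add: frechet_derivative_works)

lemma fderiv_mult:
  assumes "f differentiable (at z)" "g differentiable (at z)"
  shows "fderiv (\<lambda>z. f z * g z) z = (\<lambda>v. f z * fderiv g z v + fderiv f z v * g z)"
  using assms by (intro fderivI has_derivative_mult) (simp_all add: frechet_derivative_works)

lemma fderiv_bounded_linear:
  assumes "bounded_linear T" "f differentiable (at z)"
  shows "fderiv (\<lambda>z. T (f z)) z = (\<lambda>v. T (fderiv f z v))"
  by (intro fderivI bounded_linear.has_derivative[OF assms(1)])
    (use assms(2) in \<open>simp add: frechet_derivative_works\<close>)

lemma fderiv_inverse:
  assumes "f differentiable (at z)" "f z \<noteq> 0"
  shows "fderiv (\<lambda>z. inverse (f z)) z = (\<lambda>v. - (inverse (f z) * fderiv f z v * inverse (f z)))"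
  using assms by (intro fderivI Deriv.has_derivative_inverse) (simp_all add: frechet_derivative_works)

lemma differentiable_bounded_linear:
  assumes "bounded_linear T" "f differentiable (at z)"
  shows "(\<lambda>z. T (f z)) differentiable (at z)"
  using assms(2) bounded_linear.has_derivative[OF assms(1)] unfolding differentiable_def by blast

lemma differentiable_inverse_at:
  fixes f :: "complex ^ 'n \<Rightarrow> complex"
  assumes "f differentiable (at z)" "f z \<noteq> 0"
  shows "(\<lambda>z. inverse (f z)) differentiable (at z)"
  using assms unfolding differentiable_def by (blast intro: Deriv.has_derivative_inverse)

lemma ck_on_add:
  assumes "open U" "ck_on k U f" "ck_on k U g"
  shows "ck_on k U (\<lambda>z. f z + g z)"
  using assms(2,3)
proof (induction k arbitrary: f g)
  case 0
  then show ?case by (auto intro!: continuous_intros)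
next
  case (Suc k)
  have "ck_on k U (\<lambda>z. fderiv (\<lambda>z. f z + g z) z v)" for v
    by (rule ck_on_cong[OF assms(1) _ Suc.IH[of "\<lambda>z. fderiv f z v" "\<lambda>z. fderiv g z v"]])
      (use Suc.prems in \<open>auto simp: fderiv_add\<close>)
  then show ?case using Suc.prems by auto
qed

lemma ck_on_bounded_linear:
  assumes "open U" "bounded_linear T" "ck_on k U f"
  shows "ck_on k U (\<lambda>z. T (f z))"
  using assms(3)
proof (induction k arbitrary: f)
  case 0
  then show ?case using assms(2) by (auto intro: bounded_linear.continuous_on)
next
  case (Suc k)
  have "ck_on k U (\<lambda>z. fderiv (\<lambda>z. T (f z)) z v)" for v
    by (rule ck_on_cong[OF assms(1) _ Suc.IH[of "\<lambda>z. fderiv f z v"]])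
      (use Suc.prems assms(2) in \<open>auto simp: fderiv_bounded_linear\<close>)
  moreover have "(\<lambda>z. T (f z)) differentiable (at z)" if "z \<in> U" for z
    using Suc.prems that assms(2) by (simp add: differentiable_bounded_linear)
  ultimately show ?case by auto
qed

lemma ck_on_mult:
  assumes "open U" "ck_on k U f" "ck_on k U g"
  shows "ck_on k U (\<lambda>z. f z * g z)"
  using assms(2,3)
proof (induction k arbitrary: f g)
  case 0
  then show ?case by (auto intro!: continuous_intros)
next
  case (Suc k)
  have "ck_on k U (\<lambda>z. fderiv (\<lambda>z. f z * g z) z v)" for v
  proof (rule ck_on_cong[OF assms(1)])
    show "ck_on k U (\<lambda>z. f z * fderiv g z v + fderiv f z v * g z)"
      using Suc.prems ck_on_Suc_D[OF Suc.prems(1)] ck_on_Suc_D[OF Suc.prems(2)]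
      by (intro ck_on_add[OF assms(1)] Suc.IH) auto
  qed (use Suc.prems in \<open>auto simp: fderiv_mult\<close>)
  then show ?case using Suc.prems by (simp add: differentiable_mult)
qed

text \<open>In contrast to products, the induction can keep \<open>f\<close> fixed: differentiating
  the reciprocal yields the same reciprocal times a derivative of \<open>f\<close>.\<close>

lemma ck_on_inverse:
  assumes "open U" "ck_on k U f" "\<And>z. z \<in> U \<Longrightarrow> f z \<noteq> 0"
  shows "ck_on k U (\<lambda>z. inverse (f z))"
  using assms(2)
proof (induction k)
  case 0
  then show ?case using assms(3) by (auto intro!: continuous_intros)
next
  case (Suc k)
  have inv: "ck_on k U (\<lambda>z. inverse (f z))"
    using Suc.IH ck_on_Suc_D[OF Suc.prems] by blast
  have "ck_on k U (\<lambda>z. fderiv (\<lambda>z. inverse (f z)) z v)" for v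
  proof (rule ck_on_cong[OF assms(1)])
    show "ck_on k U (\<lambda>z. - 1 * (inverse (f z) * fderiv f z v * inverse (f z)))"
      using Suc.prems inv by (intro ck_on_mult[OF assms(1)] ck_on_const) auto
  qed (use Suc.prems assms(3) in \<open>auto simp: fderiv_inverse\<close>)
  then show ?case using Suc.prems assms(3) by (simp add: differentiable_inverse_at)
qed

lemma smooth_on_cong:
  "open U \<Longrightarrow> (\<And>w. w \<in> U \<Longrightarrow> f w = g w) \<Longrightarrow> smooth_on U f \<Longrightarrow> smooth_on U g"
  unfolding smooth_on_def using ck_on_cong[of U f g] by blast

lemma ck_on_subset: "V \<subseteq> U \<Longrightarrow> ck_on k U f \<Longrightarrow> ck_on k V f"
  by (induction k arbitrary: f) (auto intro: continuous_on_subset)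

lemma smooth_on_subset: "smooth_on U f \<Longrightarrow> V \<subseteq> U \<Longrightarrow> smooth_on V f"
  unfolding smooth_on_def by (simp add: ck_on_subset)

lemma smooth_on_const: "smooth_on U (\<lambda>z. c)"
  unfolding smooth_on_def by (simp add: ck_on_const)

lemma smooth_on_add:
  "open U \<Longrightarrow> smooth_on U f \<Longrightarrow> smooth_on U g \<Longrightarrow> smooth_on U (\<lambda>z. f z + g z)"
  unfolding smooth_on_def by (simp add: ck_on_add)

lemma smooth_on_mult:
  "open U \<Longrightarrow> smooth_on U f \<Longrightarrow> smooth_on U g \<Longrightarrow> smooth_on U (\<lambda>z. f z * g z)"
  unfolding smooth_on_def by (simp add: ck_on_mult)

lemma smooth_on_minus: "open U \<Longrightarrow> smooth_on U f \<Longrightarrow> smooth_on U (\<lambda>z. - f z)"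
  using ck_on_bounded_linear[OF _ bounded_linear_minus[OF bounded_linear_ident]]
  unfolding smooth_on_def by blast

lemma smooth_on_diff:
  "open U \<Longrightarrow> smooth_on U f \<Longrightarrow> smooth_on U g \<Longrightarrow> smooth_on U (\<lambda>z. f z - g z)"
  using smooth_on_add[of U f "\<lambda>z. - g z"] smooth_on_minus[of U g] by simp

lemma smooth_on_cnj: "open U \<Longrightarrow> smooth_on U f \<Longrightarrow> smooth_on U (\<lambda>z. cnj (f z))"
  using ck_on_bounded_linear[OF _ bounded_linear_cnj] unfolding smooth_on_def by blast

lemma smooth_on_of_real_Re: "open U \<Longrightarrow> smooth_on U f \<Longrightarrow> smooth_on U (\<lambda>z. of_real (Re (f z)))"
  using ck_on_bounded_linear[OF _ bounded_linear_compose[OF bounded_linear_of_real bounded_linear_Re]]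
  unfolding smooth_on_def by blast

lemma smooth_on_inverse:
  "open U \<Longrightarrow> smooth_on U f \<Longrightarrow> (\<And>z. z \<in> U \<Longrightarrow> f z \<noteq> 0) \<Longrightarrow> smooth_on U (\<lambda>z. inverse (f z))"
  unfolding smooth_on_def by (simp add: ck_on_inverse)

lemma smooth_on_divide:
  "open U \<Longrightarrow> smooth_on U f \<Longrightarrow> smooth_on U g \<Longrightarrow> (\<And>z. z \<in> U \<Longrightarrow> g z \<noteq> 0) \<Longrightarrow>
    smooth_on U (\<lambda>z. f z / g z)"
  using smooth_on_mult[of U f "\<lambda>z. inverse (g z)"] smooth_on_inverse[of U g]
  by (simp add: divide_inverse)

lemma smooth_on_sum:
  "open U \<Longrightarrow> (\<And>i. i \<in> I \<Longrightarrow> smooth_on U (f i)) \<Longrightarrow> smooth_on U (\<lambda>z. \<Sum>i\<in>I. f i z)"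
  by (induction I rule: infinite_finite_induct) (auto intro: smooth_on_const smooth_on_add)

lemma smooth_on_fderiv: "smooth_on U f \<Longrightarrow> smooth_on U (\<lambda>z. fderiv f z v)"
  unfolding smooth_on_def by (metis ck_on.simps(2))

lemma smooth_on_differentiable: "smooth_on U f \<Longrightarrow> z \<in> U \<Longrightarrow> f differentiable (at z)"
  unfolding smooth_on_def by (metis ck_on.simps(2))

lemma smooth_on_continuous_on: "smooth_on U f \<Longrightarrow> continuous_on U f"
  unfolding smooth_on_def by (metis ck_on.simps(1))

lemma smooth_on_wirt:
  assumes "open U" "smooth_on U f"
  shows "smooth_on U (wirt k f)"
proof -
  have "smooth_on U (\<lambda>z. (1/2) * (fderiv f z (axis k 1) - \<i> * fderiv f z (axis k \<i>)))"
    using assms by (intro smooth_on_mult smooth_on_diff smooth_on_const smooth_on_fderiv)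
  then show ?thesis unfolding wirt_def[abs_def] by simp
qed

lemma smooth_on_wirt_bar:
  assumes "open U" "smooth_on U f"
  shows "smooth_on U (wirt_bar k f)"
proof -
  have "smooth_on U (\<lambda>z. (1/2) * (fderiv f z (axis k 1) + \<i> * fderiv f z (axis k \<i>)))"
    using assms by (intro smooth_on_mult smooth_on_add smooth_on_const smooth_on_fderiv)
  then show ?thesis unfolding wirt_bar_def[abs_def] by simp
qed

lemma smooth_on_coordinate:
  fixes k :: "'n::finite"
  shows "smooth_on UNIV (\<lambda>z. z $ k)"
proof -
  have D: "((\<lambda>z. z $ k) has_derivative (\<lambda>v. v $ k)) (at z)" for z :: "complex ^ 'n"
    by (rule bounded_linear_imp_has_derivative) (rule bounded_linear_vec_nth)
  have "ck_on n UNIV (\<lambda>z. z $ k)" for n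
  proof (cases n)
    case 0
    then show ?thesis by (auto intro!: continuous_intros)
  next
    case (Suc m)
    have "(\<lambda>z. z $ k) differentiable (at z)" for z :: "complex ^ 'n"
      using D unfolding differentiable_def by blast
    moreover have "fderiv (\<lambda>z. z $ k) z v = v $ k" for z v :: "complex ^ 'n"
      using fderivI[OF D] by metis
    ultimately show ?thesis using Suc by (simp add: ck_on_const)
  qed
  then show ?thesis unfolding smooth_on_def by blast
qed

text \<open>Closing the induction needs all derivatives \<open>F n\<close> of the outer function at once.\<close>

lemma smooth_on_compose_real:
  fixes F :: "nat \<Rightarrow> real \<Rightarrow> real"
  assumes "open U" and F: "\<And>n t. (F n has_real_derivative F (Suc n) t) (at t)"
    and q: "smooth_on U q"
  shows "smooth_on U (\<lambda>z. of_real (F n (Re (q z))))"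
proof -
  have D: "((\<lambda>z. of_real (F n (Re (q z)))) has_derivative
      (\<lambda>v. of_real (F (Suc n) (Re (q z))) * of_real (Re (fderiv q z v)))) (at z)" (is "(?f has_derivative _) _")
    if "z \<in> U" for z n
  proof -
    have "(q has_derivative fderiv q z) (at z)"
      using smooth_on_differentiable[OF q that] by (simp add: frechet_derivative_works)
    then have "((\<lambda>z. Re (q z)) has_derivative (\<lambda>v. Re (fderiv q z v))) (at z)"
      by (rule bounded_linear.has_derivative[OF bounded_linear_Re])
    moreover have "(F n has_derivative (\<lambda>h. F (Suc n) (Re (q z)) * h)) (at (Re (q z)))"
      using F[of n "Re (q z)"] by (simp add: has_field_derivative_def)
    ultimately have "((\<lambda>z. F n (Re (q z))) has_derivative
        (\<lambda>v. F (Suc n) (Re (q z)) * Re (fderiv q z v))) (at z)"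
      using has_derivative_compose by fastforce
    then show ?thesis
      using bounded_linear.has_derivative[OF bounded_linear_of_real] by fastforce
  qed
  have "ck_on k U (\<lambda>z. of_real (F n (Re (q z))))" for k
  proof (induction k arbitrary: n)
    case 0
    have "isCont (\<lambda>z. of_real (F n (Re (q z))) :: complex) z" if "z \<in> U" for z
      using has_derivative_continuous[OF D[OF that]] .
    then show ?case unfolding ck_on.simps by (blast intro: continuous_at_imp_continuous_on)
  next
    case (Suc k)
    have "ck_on k U (\<lambda>z. fderiv (\<lambda>z. of_real (F n (Re (q z)))) z v)" for v
    proof (rule ck_on_cong[OF assms(1)])
      show "ck_on k U (\<lambda>z. of_real (F (Suc n) (Re (q z))) * of_real (Re (fderiv q z v)))"
        using smooth_on_of_real_Re[OF assms(1) smooth_on_fderiv[OF q]]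
        by (intro ck_on_mult[OF assms(1)] Suc.IH) (auto simp: smooth_on_def)
      show "of_real (F (Suc n) (Re (q w))) * of_real (Re (fderiv q w v))
          = fderiv (\<lambda>z. of_real (F n (Re (q z)))) w v" if "w \<in> U" for w
        using fderivI[OF D[OF that]] by metis
    qed
    moreover have "(\<lambda>z. of_real (F n (Re (q z))) :: complex) differentiable (at z)" if "z \<in> U" for z
      using D[OF that] unfolding differentiable_def by blast
    ultimately show ?case by simp
  qed
  then show ?thesis unfolding smooth_on_def by blast
qed

section \<open>Rules of the Wirtinger calculus\<close>

lemma wirt_cong_open:
  "open U \<Longrightarrow> z \<in> U \<Longrightarrow> (\<And>w. w \<in> U \<Longrightarrow> f w = g w) \<Longrightarrow> wirt k f z = wirt k g z"
  using fderiv_cong_open[of U z f g] by (simp add: wirt_def)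

lemma wirt_bar_cong_open:
  "open U \<Longrightarrow> z \<in> U \<Longrightarrow> (\<And>w. w \<in> U \<Longrightarrow> f w = g w) \<Longrightarrow> wirt_bar k f z = wirt_bar k g z"
  using fderiv_cong_open[of U z f g] by (simp add: wirt_bar_def)

lemma wirt_const [simp]: "wirt k (\<lambda>z. c) z = 0" "wirt_bar k (\<lambda>z. c) z = 0"
  by (simp_all add: wirt_def wirt_bar_def)

lemma wirt_add:
  assumes "f differentiable (at z)" "g differentiable (at z)"
  shows "wirt k (\<lambda>z. f z + g z) z = wirt k f z + wirt k g z"
    and "wirt_bar k (\<lambda>z. f z + g z) z = wirt_bar k f z + wirt_bar k g z"
  by (simp_all add: wirt_def wirt_bar_def fderiv_add[OF assms] field_simps)

lemma wirt_minus:
  assumes "f differentiable (at z)"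
  shows "wirt k (\<lambda>z. - f z) z = - wirt k f z"
    and "wirt_bar k (\<lambda>z. - f z) z = - wirt_bar k f z"
  unfolding wirt_def wirt_bar_def fderiv_bounded_linear[OF bounded_linear_minus[OF bounded_linear_ident] assms]
  by (simp_all add: field_simps)

lemma wirt_diff:
  assumes "f differentiable (at z)" "g differentiable (at z)"
  shows "wirt k (\<lambda>z. f z - g z) z = wirt k f z - wirt k g z"
    and "wirt_bar k (\<lambda>z. f z - g z) z = wirt_bar k f z - wirt_bar k g z"
  using wirt_add[of f z "\<lambda>z. - g z" k] wirt_minus[of g z k] assms
  by (simp_all add: differentiable_minus)

lemma wirt_mult:
  assumes "f differentiable (at z)" "g differentiable (at z)"
  shows "wirt k (\<lambda>z. f z * g z) z = wirt k f z * g z + f z * wirt k g z"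
    and "wirt_bar k (\<lambda>z. f z * g z) z = wirt_bar k f z * g z + f z * wirt_bar k g z"
  by (simp_all add: wirt_def wirt_bar_def fderiv_mult[OF assms] field_simps)

lemma wirt_cmult:
  assumes "f differentiable (at z)"
  shows "wirt k (\<lambda>z. c * f z) z = c * wirt k f z"
    and "wirt_bar k (\<lambda>z. c * f z) z = c * wirt_bar k f z"
  using wirt_mult[of "\<lambda>z. c" z f k] assms by simp_all

lemma wirt_inverse:
  assumes "f differentiable (at z)" "f z \<noteq> 0"
  shows "wirt k (\<lambda>z. inverse (f z)) z = - wirt k f z / (f z)\<^sup>2"
    and "wirt_bar k (\<lambda>z. inverse (f z)) z = - wirt_bar k f z / (f z)\<^sup>2"
  unfolding wirt_def wirt_bar_def fderiv_inverse[OF assms]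
  using assms(2) by (simp_all add: field_simps power2_eq_square)

lemma wirt_cnj:
  assumes "f differentiable (at z)"
  shows "wirt k (\<lambda>z. cnj (f z)) z = cnj (wirt_bar k f z)"
    and "wirt_bar k (\<lambda>z. cnj (f z)) z = cnj (wirt k f z)"
  using fderiv_bounded_linear[OF bounded_linear_cnj assms]
  by (simp_all add: wirt_def wirt_bar_def)

lemma differentiable_sum':
  fixes f :: "'i \<Rightarrow> complex ^ 'n \<Rightarrow> complex"
  shows "(\<And>i. i \<in> I \<Longrightarrow> f i differentiable (at z)) \<Longrightarrow> (\<lambda>z. \<Sum>i\<in>I. f i z) differentiable (at z)"
  by (induction I rule: infinite_finite_induct) auto

lemma wirt_sum:
  assumes "\<And>i. i \<in> I \<Longrightarrow> f i differentiable (at z)"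
  shows "wirt k (\<lambda>z. \<Sum>i\<in>I. f i z) z = (\<Sum>i\<in>I. wirt k (f i) z)"
    and "wirt_bar k (\<lambda>z. \<Sum>i\<in>I. f i z) z = (\<Sum>i\<in>I. wirt_bar k (f i) z)"
  using assms
  by (induction I rule: infinite_finite_induct) (auto simp: wirt_add differentiable_sum')

text \<open>The mean value theorem, applied twice to the second difference of \<open>f\<close>.\<close>

lemma second_difference:
  fixes f :: "'a::real_normed_vector \<Rightarrow> real"
  assumes "t > 0"
    and f: "\<And>r s. 0 \<le> r \<Longrightarrow> r \<le> t \<Longrightarrow> 0 \<le> s \<Longrightarrow> s \<le> t \<Longrightarrow>
      (f has_derivative D (z + r *\<^sub>R v + s *\<^sub>R w)) (at (z + r *\<^sub>R v + s *\<^sub>R w))"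
    and D: "\<And>r s. 0 \<le> r \<Longrightarrow> r \<le> t \<Longrightarrow> 0 \<le> s \<Longrightarrow> s \<le> t \<Longrightarrow>
      ((\<lambda>x. D x v) has_derivative E (z + r *\<^sub>R v + s *\<^sub>R w)) (at (z + r *\<^sub>R v + s *\<^sub>R w))"
  shows "\<exists>r s. 0 \<le> r \<and> r \<le> t \<and> 0 \<le> s \<and> s \<le> t \<and>
    f (z + t *\<^sub>R v + t *\<^sub>R w) - f (z + t *\<^sub>R v) - (f (z + t *\<^sub>R w) - f z) = t\<^sup>2 * E (z + r *\<^sub>R v + s *\<^sub>R w) w"
proof -
  define g where "g r = f (z + r *\<^sub>R v + t *\<^sub>R w) - f (z + r *\<^sub>R v)" for r
  have line: "((\<lambda>r. z + r *\<^sub>R v + s *\<^sub>R w) has_derivative (\<lambda>h. h *\<^sub>R v)) (at r within S)" for r s S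
    by (auto intro!: derivative_eq_intros)
  have line': "((\<lambda>s. z + r *\<^sub>R v + s *\<^sub>R w) has_derivative (\<lambda>h. h *\<^sub>R w)) (at s within S)" for r s S
    by (auto intro!: derivative_eq_intros)
  have g': "(g has_derivative (\<lambda>h. D (z + r *\<^sub>R v + t *\<^sub>R w) (h *\<^sub>R v) - D (z + r *\<^sub>R v + 0 *\<^sub>R w) (h *\<^sub>R v))) (at r)"
    if "0 \<le> r" "r \<le> t" for r
  proof -
    have "((\<lambda>r. f (z + r *\<^sub>R v + s *\<^sub>R w)) has_derivative (\<lambda>h. D (z + r *\<^sub>R v + s *\<^sub>R w) (h *\<^sub>R v))) (at r)"
      if "0 \<le> s" "s \<le> t" for s
      using has_derivative_compose[OF line f] that \<open>0 \<le> r\<close> \<open>r \<le> t\<close> by simp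
    from has_derivative_diff[OF this[of t] this[of 0]] show ?thesis
      using assms(1) by (simp add: g_def[abs_def])
  qed
  have "\<exists>\<xi>\<in>{0<..<t}. g t - g 0 = D (z + \<xi> *\<^sub>R v + t *\<^sub>R w) ((t - 0) *\<^sub>R v) - D (z + \<xi> *\<^sub>R v + 0 *\<^sub>R w) ((t - 0) *\<^sub>R v)"
    by (rule mvt[where f' = "\<lambda>r h. D (z + r *\<^sub>R v + t *\<^sub>R w) (h *\<^sub>R v) - D (z + r *\<^sub>R v + 0 *\<^sub>R w) (h *\<^sub>R v)"])
      (use assms(1) g' in \<open>auto intro!: continuous_at_imp_continuous_on has_derivative_continuous\<close>)
  then obtain r where r: "0 < r" "r < t"
    and gr: "g t - g 0 = D (z + r *\<^sub>R v + t *\<^sub>R w) (t *\<^sub>R v) - D (z + r *\<^sub>R v + 0 *\<^sub>R w) (t *\<^sub>R v)" by auto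
  have lin: "D (z + r *\<^sub>R v + s *\<^sub>R w) (t *\<^sub>R v) = t * D (z + r *\<^sub>R v + s *\<^sub>R w) v" if "0 \<le> s" "s \<le> t" for s
    using has_derivative_bounded_linear[OF f[of r s]] r that
    by (simp add: linear_cmul bounded_linear.linear)
  define k where "k s = D (z + r *\<^sub>R v + s *\<^sub>R w) v" for s
  have k': "(k has_derivative (\<lambda>h. E (z + r *\<^sub>R v + s *\<^sub>R w) (h *\<^sub>R w))) (at s)" if "0 \<le> s" "s \<le> t" for s
    using has_derivative_compose[OF line' D] r that by (simp add: k_def[abs_def])
  have "\<exists>\<xi>\<in>{0<..<t}. k t - k 0 = E (z + r *\<^sub>R v + \<xi> *\<^sub>R w) ((t - 0) *\<^sub>R w)"
    by (rule mvt[where f' = "\<lambda>s h. E (z + r *\<^sub>R v + s *\<^sub>R w) (h *\<^sub>R w)"])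
      (use assms(1) k' in \<open>auto intro!: continuous_at_imp_continuous_on has_derivative_continuous\<close>)
  then obtain s where s: "0 < s" "s < t" and ks: "k t - k 0 = E (z + r *\<^sub>R v + s *\<^sub>R w) (t *\<^sub>R w)" by auto
  have "E (z + r *\<^sub>R v + s *\<^sub>R w) (t *\<^sub>R w) = t * E (z + r *\<^sub>R v + s *\<^sub>R w) w"
    using has_derivative_bounded_linear[OF D[of r s]] r s
    by (simp add: linear_cmul bounded_linear.linear)
  then have "g t - g 0 = t * (t * E (z + r *\<^sub>R v + s *\<^sub>R w) w)"
    using gr ks lin[of t] lin[of 0] assms(1) by (simp add: k_def algebra_simps)
  then show ?thesis using r s
    by (intro exI[of _ r] exI[of _ s]) (simp add: g_def power2_eq_square mult.assoc)
qed

text \<open>Schwarz's theorem. The second difference of \<open>f\<close> over the parallelogram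
  spanned by \<open>t v\<close> and \<open>t w\<close> is symmetric in \<open>v\<close> and
  \<open>w\<close>. Evaluating it in both orders gives values of \<open>E\<close> and
  \<open>E'\<close> at points near \<open>z\<close> that agree exactly, and continuity carries the
  equality to \<open>z\<close>.\<close>

lemma mixed_derivatives_real:
  fixes f :: "'a::real_normed_vector \<Rightarrow> real"
  assumes "open U" "z \<in> U"
    and f: "\<And>x. x \<in> U \<Longrightarrow> (f has_derivative D x) (at x)"
    and Dv: "\<And>x. x \<in> U \<Longrightarrow> ((\<lambda>x. D x v) has_derivative E x) (at x)"
    and Dw: "\<And>x. x \<in> U \<Longrightarrow> ((\<lambda>x. D x w) has_derivative E' x) (at x)"
    and cont: "continuous_on U (\<lambda>x. E x w)" "continuous_on U (\<lambda>x. E' x v)"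
  shows "E z w = E' z v"
proof (rule ccontr)
  assume ne: "E z w \<noteq> E' z v"
  \<comment> \<open>Half the gap: a value within \<open>e\<close> of \<open>E z w\<close> cannot
    equal a value within \<open>e\<close> of \<open>E' z v\<close>.\<close>
  define e where "e = \<bar>E z w - E' z v\<bar> / 2"
  have e: "e > 0" using ne by (simp add: e_def)
  obtain d0 where d0: "d0 > 0" "ball z d0 \<subseteq> U" using assms(1,2) by (meson open_contains_ball)
  obtain d1 where d1: "d1 > 0" "\<And>x. x \<in> U \<Longrightarrow> dist x z < d1 \<Longrightarrow> dist (E x w) (E z w) < e"
    using cont(1) assms(2) e unfolding continuous_on_iff by metis
  obtain d2 where d2: "d2 > 0" "\<And>x. x \<in> U \<Longrightarrow> dist x z < d2 \<Longrightarrow> dist (E' x v) (E' z v) < e"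
    using cont(2) assms(2) e unfolding continuous_on_iff by metis
  define d where "d = min d0 (min d1 d2)"
  have d: "d > 0" using d0 d1 d2 by (simp add: d_def)
  \<comment> \<open>Keeps the whole parallelogram within \<open>d / 2\<close> of \<open>z\<close>;
    the summand 1 covers the case that \<open>v\<close> and \<open>w\<close> are both zero.\<close>
  define t where "t = d / (2 * (norm v + norm w + 1))"
  have nn: "norm v + norm w + 1 > 0" using norm_ge_zero[of v] norm_ge_zero[of w] by linarith
  have t: "t > 0" using d nn by (simp add: t_def)
  have near: "dist (z + r *\<^sub>R v + s *\<^sub>R w) z < d" if "0 \<le> r" "r \<le> t" "0 \<le> s" "s \<le> t" for r s
  proof -
    have "dist (z + r *\<^sub>R v + s *\<^sub>R w) z = norm (r *\<^sub>R v + s *\<^sub>R w)" by (simp add: dist_norm)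
    also have "\<dots> \<le> r * norm v + s * norm w"
      using norm_triangle_ineq[of "r *\<^sub>R v" "s *\<^sub>R w"] that by simp
    also have "\<dots> \<le> t * norm v + t * norm w" using that by (intro add_mono mult_right_mono) auto
    also have "\<dots> < t * (norm v + norm w + 1)" using t by (simp add: algebra_simps)
    also have "\<dots> = d / 2" using nn unfolding t_def by (subst times_divide_eq_left, subst mult_divide_mult_cancel_right) auto
    also have "\<dots> < d" using d by simp
    finally show ?thesis .
  qed
  have inU: "z + r *\<^sub>R v + s *\<^sub>R w \<in> U" if "0 \<le> r" "r \<le> t" "0 \<le> s" "s \<le> t" for r s
    using near[OF that] d0(2) by (auto simp: d_def dist_commute)
  obtain r s where rs: "0 \<le> r" "r \<le> t" "0 \<le> s" "s \<le> t" and
    1: "f (z + t *\<^sub>R v + t *\<^sub>R w) - f (z + t *\<^sub>R v) - (f (z + t *\<^sub>R w) - f z) = t\<^sup>2 * E (z + r *\<^sub>R v + s *\<^sub>R w) w"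
    using second_difference[OF t, of f D z v w E] f Dv inU by blast
  have inU': "z + r *\<^sub>R w + s *\<^sub>R v \<in> U" if "0 \<le> r" "r \<le> t" "0 \<le> s" "s \<le> t" for r s
    using inU[OF that(3,4,1,2)] by (simp add: algebra_simps)
  obtain r' s' where rs': "0 \<le> r'" "r' \<le> t" "0 \<le> s'" "s' \<le> t" and
    2: "f (z + t *\<^sub>R w + t *\<^sub>R v) - f (z + t *\<^sub>R w) - (f (z + t *\<^sub>R v) - f z) = t\<^sup>2 * E' (z + r' *\<^sub>R w + s' *\<^sub>R v) v"
    using second_difference[OF t, of f D z w v E'] f Dw inU' by blast
  have "t\<^sup>2 * E (z + r *\<^sub>R v + s *\<^sub>R w) w = t\<^sup>2 * E' (z + s' *\<^sub>R v + r' *\<^sub>R w) v"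
    using 1 2 by (simp add: algebra_simps)
  then have "E (z + r *\<^sub>R v + s *\<^sub>R w) w = E' (z + s' *\<^sub>R v + r' *\<^sub>R w) v" using t by simp
  moreover have "\<bar>E (z + r *\<^sub>R v + s *\<^sub>R w) w - E z w\<bar> < e"
    using d1(2)[OF inU[OF rs]] near[OF rs] by (simp add: d_def dist_real_def)
  moreover have "\<bar>E' (z + s' *\<^sub>R v + r' *\<^sub>R w) v - E' z v\<bar> < e"
    using d2(2)[OF inU[OF rs'(3,4,1,2)]] near[OF rs'(3,4,1,2)] by (simp add: d_def dist_real_def)
  ultimately show False unfolding e_def by (auto simp: abs_if field_simps split: if_splits)
qed

lemma fderiv_commute:
  assumes "open U" "smooth_on U f" "z \<in> U"
  shows "fderiv (\<lambda>x. fderiv f x v) z w = fderiv (\<lambda>x. fderiv f x w) z v"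
proof -
  have D: "(h has_derivative fderiv h x) (at x)" if "smooth_on U h" "x \<in> U" for h x
    using smooth_on_differentiable[OF that] by (simp add: frechet_derivative_works)
  \<comment> \<open>The mean value theorem needs real values, so the claim is proved after composing
    with a real functional \<open>T\<close>, to be instantiated by \<open>Re\<close> and
    \<open>Im\<close>.\<close>
  have main: "T (fderiv (\<lambda>x. fderiv f x v) z w) = T (fderiv (\<lambda>x. fderiv f x w) z v)"
    if "bounded_linear T" for T :: "complex \<Rightarrow> real"
  proof (rule mixed_derivatives_real[OF assms(1,3), where f = "\<lambda>x. T (f x)" and D = "\<lambda>x v. T (fderiv f x v)"
        and E = "\<lambda>x w. T (fderiv (\<lambda>x. fderiv f x v) x w)" and E' = "\<lambda>x v. T (fderiv (\<lambda>x. fderiv f x w) x v)"])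
    show "continuous_on U (\<lambda>x. T (fderiv (\<lambda>x. fderiv f x v) x w))"
      "continuous_on U (\<lambda>x. T (fderiv (\<lambda>x. fderiv f x w) x v))"
      by (intro bounded_linear.continuous_on[OF that] smooth_on_continuous_on smooth_on_fderiv assms)+
  qed (use assms in \<open>auto intro!: bounded_linear.has_derivative[OF that] D smooth_on_fderiv\<close>)
  from main[OF bounded_linear_Re] main[OF bounded_linear_Im] show ?thesis by (simp add: complex_eq_iff)
qed

lemma differentiable_fderiv:
  "smooth_on U f \<Longrightarrow> z \<in> U \<Longrightarrow> (\<lambda>x. fderiv f x v) differentiable (at z)"
  by (rule smooth_on_differentiable[OF smooth_on_fderiv])

lemma fderiv_wirt:
  assumes "smooth_on U f" "z \<in> U"
  shows "fderiv (wirt k f) z w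
      = (fderiv (\<lambda>x. fderiv f x (axis k 1)) z w - \<i> * fderiv (\<lambda>x. fderiv f x (axis k \<i>)) z w) / 2"
    and "fderiv (wirt_bar k f) z w
      = (fderiv (\<lambda>x. fderiv f x (axis k 1)) z w + \<i> * fderiv (\<lambda>x. fderiv f x (axis k \<i>)) z w) / 2"
proof -
  have D: "((\<lambda>x. fderiv f x v) has_derivative fderiv (\<lambda>x. fderiv f x v) z) (at z)" for v
    using differentiable_fderiv[OF assms] by (simp add: frechet_derivative_works)
  have "(wirt k f has_derivative (\<lambda>w. (fderiv (\<lambda>x. fderiv f x (axis k 1)) z w
      - \<i> * fderiv (\<lambda>x. fderiv f x (axis k \<i>)) z w) / 2)) (at z)"
    unfolding wirt_def[abs_def] by (auto intro!: derivative_eq_intros D)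
  from fderivI[OF this] show "fderiv (wirt k f) z w
      = (fderiv (\<lambda>x. fderiv f x (axis k 1)) z w - \<i> * fderiv (\<lambda>x. fderiv f x (axis k \<i>)) z w) / 2" by simp
  have "(wirt_bar k f has_derivative (\<lambda>w. (fderiv (\<lambda>x. fderiv f x (axis k 1)) z w
      + \<i> * fderiv (\<lambda>x. fderiv f x (axis k \<i>)) z w) / 2)) (at z)"
    unfolding wirt_bar_def[abs_def] by (auto intro!: derivative_eq_intros D)
  from fderivI[OF this] show "fderiv (wirt_bar k f) z w
      = (fderiv (\<lambda>x. fderiv f x (axis k 1)) z w + \<i> * fderiv (\<lambda>x. fderiv f x (axis k \<i>)) z w) / 2" by simp
qed

lemma wirt_commute:
  assumes "open U" "smooth_on U f" "z \<in> U"
  shows "wirt k (wirt l f) z = wirt l (wirt k f) z"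
    and "wirt k (wirt_bar l f) z = wirt_bar l (wirt k f) z"
    and "wirt_bar k (wirt_bar l f) z = wirt_bar l (wirt_bar k f) z"
  unfolding wirt_def[of _ "wirt _ _"] wirt_def[of _ "wirt_bar _ _"]
    wirt_bar_def[of _ "wirt _ _"] wirt_bar_def[of _ "wirt_bar _ _"] fderiv_wirt[OF assms(2,3)]
  using fderiv_commute[OF assms, of "axis k 1" "axis l 1"] fderiv_commute[OF assms, of "axis k \<i>" "axis l 1"]
    fderiv_commute[OF assms, of "axis k 1" "axis l \<i>"] fderiv_commute[OF assms, of "axis k \<i>" "axis l \<i>"]
  by (simp_all add: field_simps)

section \<open>Bump functions\<close>

lemma poly_over_exp_tendsto_0: "((\<lambda>x::real. poly p x / exp x) \<longlongrightarrow> 0) at_top"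
proof -
  have "((\<lambda>x. \<Sum>i\<le>degree p. coeff p i * (x ^ i / exp x)) \<longlongrightarrow> (\<Sum>i\<le>degree p. coeff p i * 0)) at_top"
    by (intro tendsto_sum tendsto_mult tendsto_const tendsto_power_div_exp_0)
  then show ?thesis by (simp add: poly_altdef sum_divide_distrib)
qed

text \<open>With x = 1 / t, the derivative of p(x) exp (- x) in t is x^2 (p(x) - p'(x)) exp (- x),
  which gives the recursion.\<close>

primrec bump_poly :: "nat \<Rightarrow> real poly" where
  "bump_poly 0 = 1"
| "bump_poly (Suc n) = [:0, 0, 1:] * (bump_poly n - pderiv (bump_poly n))"

text \<open>The derivatives of \<open>exp (- 1 / t)\<close>, extended by \<open>0\<close> to \<open>t \<le> 0\<close>.\<close>

definition bump :: "nat \<Rightarrow> real \<Rightarrow> real" where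
  "bump n t = (if t > 0 then poly (bump_poly n) (1 / t) * exp (- (1 / t)) else 0)"

lemma bump_has_derivative: "(bump n has_real_derivative bump (Suc n) t) (at t)"
proof -
  consider "t < 0" | "t > 0" | "t = 0" by linarith
  then show ?thesis
  proof cases
    case 1
    have "((\<lambda>t. 0) has_real_derivative bump (Suc n) t) (at t)"
      using 1 by (simp add: bump_def)
    then show ?thesis
      by (rule has_field_derivative_transform_within_open[of _ _ _ "{..<0}"]) (use 1 in \<open>auto simp: bump_def\<close>)
  next
    case 2
    have "((\<lambda>t. poly (bump_poly n) (1 / t) * exp (- (1 / t))) has_real_derivative bump (Suc n) t) (at t)"
      using 2 by (auto intro!: derivative_eq_intros simp: bump_def field_simps power2_eq_square)
    then show ?thesis
      by (rule has_field_derivative_transform_within_open[of _ _ _ "{0<..}"]) (use 2 in \<open>auto simp: bump_def\<close>)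
  next
    case 3
    \<comment> \<open>The difference quotient at 0 is \<open>bump n t / t\<close>. For positive t
      and x = 1 / t it equals x p(x) / exp x, whence the factor \<open>[:0, 1:]\<close>.\<close>
    have "((\<lambda>x. poly ([:0, 1:] * bump_poly n) x / exp x) \<longlongrightarrow> 0) at_top"
      by (rule poly_over_exp_tendsto_0)
    then have "((\<lambda>t. poly ([:0, 1:] * bump_poly n) (inverse t) / exp (inverse t)) \<longlongrightarrow> 0) (at_right 0)"
      by (simp add: filterlim_at_right_to_top)
    then have "((\<lambda>t. bump n t / t) \<longlongrightarrow> 0) (at_right 0)"
      by (rule Lim_transform_eventually)
        (auto simp: eventually_at_right_field bump_def divide_simps exp_minus intro!: exI[of _ 1])
    moreover have "((\<lambda>t. bump n t / t) \<longlongrightarrow> 0) (at_left 0)"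
      by (rule Lim_transform_eventually[OF tendsto_const])
        (auto simp: eventually_at_left_field bump_def intro!: exI[of _ "-1"])
    ultimately have "((\<lambda>t. bump n t / t) \<longlongrightarrow> 0) (at 0)"
      by (simp add: filterlim_at_split)
    then show ?thesis using 3 by (simp add: has_field_derivative_iff bump_def)
  qed
qed

lemma bump_pos_iff: "bump 0 t > 0 \<longleftrightarrow> t > 0" and bump_nonneg: "bump 0 t \<ge> 0"
  and bump_eq_0: "t \<le> 0 \<Longrightarrow> bump 0 t = 0"
  by (simp_all add: bump_def)

lemma smooth_on_dist_square:
  fixes a :: "complex ^ 'n::finite"
  shows "smooth_on UNIV (\<lambda>z. of_real ((dist z a)\<^sup>2))"
proof -
  have "smooth_on UNIV (\<lambda>z::complex ^ 'n. \<Sum>k\<in>UNIV. (z $ k - a $ k) * cnj (z $ k - a $ k))"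
    by (intro smooth_on_sum smooth_on_mult smooth_on_cnj smooth_on_diff smooth_on_const
        smooth_on_coordinate open_UNIV)
  moreover have "(\<Sum>k\<in>UNIV. (z $ k - a $ k) * cnj (z $ k - a $ k)) = of_real ((dist z a)\<^sup>2)" for z
    by (simp add: dist_vec_def L2_set_def sum_nonneg dist_norm complex_norm_square del: of_real_power complex_cnj_diff)
  ultimately show ?thesis by simp
qed

lemma exists_bump:
  fixes a :: "complex ^ 'n::finite"
  assumes "r > 0"
  shows "\<exists>\<eta>. smooth_on UNIV (\<lambda>z. of_real (\<eta> z)) \<and> (\<forall>z. \<eta> z \<ge> 0) \<and> \<eta> a > 0 \<and>
    (\<forall>z. z \<notin> cball a r \<longrightarrow> \<eta> z = 0)"
proof (intro exI conjI allI impI)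
  \<comment> \<open>The squared distance is polynomial in the coordinates and their conjugates,
    hence smooth at \<open>a\<close> too, where the distance itself is not.\<close>
  let ?\<eta> = "\<lambda>z. bump 0 (Re (of_real (r\<^sup>2) - of_real ((dist z a)\<^sup>2)))"
  show "smooth_on UNIV (\<lambda>z. of_real (?\<eta> z))"
    by (intro smooth_on_compose_real bump_has_derivative smooth_on_diff smooth_on_const
        smooth_on_dist_square open_UNIV)
  show "?\<eta> z \<ge> 0" for z by (rule bump_nonneg)
  show "?\<eta> a > 0" using assms by (simp add: bump_pos_iff)
  show "?\<eta> z = 0" if "z \<notin> cball a r" for z
    using that assms by (intro bump_eq_0) (simp add: dist_commute power_mono)
qed

section \<open>Integration by parts and the fundamental lemma\<close>

text \<open>Translation invariance of the measure takes the place of iterated integrals: every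
  difference quotient \<open>q n\<close> integrates to zero, and dominated convergence passes this
  on to the derivative.\<close>

lemma integral_directional_derivative:
  fixes f :: "'a::euclidean_space \<Rightarrow> complex"
  assumes der: "\<And>x. (f has_derivative D x) (at x)"
    and cont: "continuous_on UNIV (\<lambda>x. D x v)"
    and K: "compact K" "\<And>x. x \<notin> K \<Longrightarrow> f x = 0"
  shows "integral\<^sup>L lborel (\<lambda>x. D x v) = 0"
proof -
  have f_cont: "continuous_on UNIV f"
    using der by (auto intro!: continuous_at_imp_continuous_on has_derivative_continuous)
  have D0: "D x v = 0" if "x \<notin> K" for x
  proof -
    have "((\<lambda>x. 0) has_derivative D x) (at x)"
      by (rule has_derivative_transform_within_open[OF der, of "- K"])
        (use K that in \<open>auto intro: compact_imp_closed\<close>)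
    then have "D x = (\<lambda>v. 0)" using has_derivative_unique has_derivative_const by blast
    then show ?thesis by simp
  qed
  obtain M where M: "\<And>x. norm (D x v) \<le> M" "M \<ge> 0"
  proof -
    have "bounded ((\<lambda>x. D x v) ` K)"
      using K(1) cont by (intro compact_imp_bounded compact_continuous_image) (auto intro: continuous_on_subset)
    then obtain M where M: "\<And>x. x \<in> K \<Longrightarrow> norm (D x v) \<le> M" "M > 0"
      unfolding bounded_pos by auto
    have "norm (D x v) \<le> M" for x
      by (cases "x \<in> K") (use M D0 in auto)
    then show thesis using M(2) that[of M] by simp
  qed
  obtain R where R: "K \<subseteq> cball 0 R"
    using compact_imp_bounded[OF K(1)] unfolding bounded_iff subset_iff by auto
  define q where "q n x = real (Suc n) *\<^sub>R (f (x + (1 / real (Suc n)) *\<^sub>R v) - f x)" for n x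
  have f_int: "integrable lborel f"
  proof -
    have "integrable lborel (\<lambda>x. indicator K x *\<^sub>R f x)"
      by (rule borel_integrable_compact[OF K(1)]) (use f_cont in \<open>auto intro: continuous_on_subset\<close>)
    moreover have "indicator K x *\<^sub>R f x = f x" for x using K(2) by (auto simp: indicator_def)
    ultimately show ?thesis by simp
  qed
  have shift: "integrable lborel (\<lambda>x. f (x + c))" "integral\<^sup>L lborel (\<lambda>x. f (x + c)) = integral\<^sup>L lborel f" for c
  proof -
    have meas: "(+) c \<in> borel_measurable lborel" "f \<in> borel_measurable borel" using f_int by auto
    have "integrable (distr lborel borel ((+) c)) f" using f_int by (simp add: lborel_distr_plus)
    then show "integrable lborel (\<lambda>x. f (x + c))"
      using integrable_distr[of "(+) c" lborel borel f] by (simp add: add.commute)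
    have "integral\<^sup>L (distr lborel borel ((+) c)) f = integral\<^sup>L lborel (\<lambda>x. f (c + x))"
      by (rule integral_distr) (use meas in auto)
    then show "integral\<^sup>L lborel (\<lambda>x. f (x + c)) = integral\<^sup>L lborel f"
      by (simp add: lborel_distr_plus add.commute)
  qed
  have q_int: "integral\<^sup>L lborel (q n) = 0" for n
    unfolding q_def using shift f_int by simp
  \<comment> \<open>The step lengths are at most 1, so a quotient can be nonzero only within
    distance \<open>norm v\<close> of the ball of radius \<open>R\<close> that contains the support.
    This yields one integrable bound for all \<open>n\<close>.\<close>
  have q_bound: "norm (q n x) \<le> M * indicator (cball 0 (R + norm v)) x" for n x
  proof -
    define h where "h = 1 / real (Suc n)"
    have h: "0 < h" "h \<le> 1" by (auto simp: h_def)
    show ?thesis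
    proof (cases "x \<in> cball 0 (R + norm v)")
      case False
      then have "R + norm v < norm x" by simp
      then have "R < norm x" using norm_ge_zero[of v] by linarith
      then have "x \<notin> K" using R by auto
      moreover have "x + h *\<^sub>R v \<notin> K"
      proof
        assume "x + h *\<^sub>R v \<in> K"
        then have "norm (x + h *\<^sub>R v) \<le> R" using R by auto
        moreover have "norm x \<le> norm (x + h *\<^sub>R v) + norm (h *\<^sub>R v)"
          using norm_triangle_ineq4[of "x + h *\<^sub>R v" "h *\<^sub>R v"] by simp
        moreover have "norm (h *\<^sub>R v) \<le> norm v" using h by (simp add: mult_left_le_one_le)
        ultimately show False using False by simp
      qed
      ultimately show ?thesis using K(2) False by (simp add: q_def h_def)
    next
      case True
      have line: "((\<lambda>t. x + t *\<^sub>R v) has_derivative (\<lambda>h. h *\<^sub>R v)) (at t)" for t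
        by (auto intro!: derivative_eq_intros)
      have d: "((\<lambda>t. f (x + t *\<^sub>R v)) has_derivative (\<lambda>k. D (x + t *\<^sub>R v) (k *\<^sub>R v))) (at t)" for t
        by (rule has_derivative_compose[OF line der])
      have "\<exists>t\<in>{0<..<h}. norm (f (x + h *\<^sub>R v) - f (x + 0 *\<^sub>R v)) \<le> norm (D (x + t *\<^sub>R v) ((h - 0) *\<^sub>R v))"
        by (rule mvt_general[where f' = "\<lambda>t k. D (x + t *\<^sub>R v) (k *\<^sub>R v)"])
          (use h d in \<open>auto intro!: continuous_at_imp_continuous_on has_derivative_continuous\<close>)
      then obtain t where "norm (f (x + h *\<^sub>R v) - f x) \<le> norm (D (x + t *\<^sub>R v) (h *\<^sub>R v))" by auto
      also have "D (x + t *\<^sub>R v) (h *\<^sub>R v) = h *\<^sub>R D (x + t *\<^sub>R v) v"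
        using has_derivative_bounded_linear[OF der] by (simp add: linear_cmul bounded_linear.linear)
      also have "norm \<dots> \<le> h * M" using h M by simp
      finally have "norm (f (x + h *\<^sub>R v) - f x) \<le> h * M" .
      then have "norm (q n x) \<le> real (Suc n) * (h * M)"
        unfolding q_def h_def[symmetric] by simp
      also have "\<dots> = M" by (simp add: h_def)
      finally show ?thesis using True by simp
    qed
  qed
  have q_lim: "(\<lambda>n. q n x) \<longlonglongrightarrow> D x v" for x
  proof -
    have line: "((\<lambda>t. x + t *\<^sub>R v) has_derivative (\<lambda>h. h *\<^sub>R v)) (at 0)"
      by (auto intro!: derivative_eq_intros)
    have "((\<lambda>t. f (x + t *\<^sub>R v)) has_derivative (\<lambda>k. D (x + 0 *\<^sub>R v) (k *\<^sub>R v))) (at 0)"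
      by (rule has_derivative_compose[OF line der])
    moreover have "D x (k *\<^sub>R v) = k *\<^sub>R D x v" for k
      using has_derivative_bounded_linear[OF der] by (simp add: linear_cmul bounded_linear.linear)
    ultimately have "(\<lambda>t. norm (f (x + t *\<^sub>R v) - f x - t *\<^sub>R D x v) / norm t) \<midarrow>0\<rightarrow> 0"
      by (simp add: has_derivative_at)
    then have "(\<lambda>t. norm ((f (x + t *\<^sub>R v) - f x) /\<^sub>R t - D x v)) \<midarrow>0\<rightarrow> 0"
    proof (rule Lim_transform_eventually)
      have "norm (f (x + t *\<^sub>R v) - f x - t *\<^sub>R D x v) / norm t = norm ((f (x + t *\<^sub>R v) - f x) /\<^sub>R t - D x v)"
        if "t \<noteq> 0" for t
      proof -
        have "(f (x + t *\<^sub>R v) - f x) /\<^sub>R t - D x v = (f (x + t *\<^sub>R v) - f x - t *\<^sub>R D x v) /\<^sub>R t"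
          using that by (simp add: scaleR_right_diff_distrib)
        then show ?thesis by (simp add: divide_inverse mult.commute)
      qed
      then show "\<forall>\<^sub>F t in at 0. norm (f (x + t *\<^sub>R v) - f x - t *\<^sub>R D x v) / norm t
          = norm ((f (x + t *\<^sub>R v) - f x) /\<^sub>R t - D x v)"
        by (simp add: eventually_at_filter)
    qed
    then have lim: "((\<lambda>t. (f (x + t *\<^sub>R v) - f x) /\<^sub>R t) \<longlongrightarrow> D x v) (at 0)"
      using Lim_null tendsto_norm_zero_iff by metis
    have "filterlim (\<lambda>n. 1 / real (Suc n)) (at 0) sequentially"
      unfolding filterlim_at using LIMSEQ_Suc[OF lim_inverse_n'] by auto
    from filterlim_compose[OF lim this] show ?thesis
      by (simp add: q_def divide_inverse)
  qed
  have "(\<lambda>n. integral\<^sup>L lborel (q n)) \<longlonglongrightarrow> integral\<^sup>L lborel (\<lambda>x. D x v)"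
  proof (rule integral_dominated_convergence[where w = "\<lambda>x. M * indicator (cball 0 (R + norm v)) x"])
    show "(\<lambda>x. D x v) \<in> borel_measurable lborel"
      using cont by (simp add: borel_measurable_continuous_onI)
    show "q n \<in> borel_measurable lborel" for n
      unfolding q_def using shift(1) f_int by auto
    show "integrable lborel (\<lambda>x::'a. M * indicator (cball 0 (R + norm v)) x :: real)"
      using borel_integrable_compact[of "cball 0 (R + norm v) :: 'a set" "\<lambda>x. M :: real"]
      by (simp add: mult.commute del: integrable_mult_left_iff integrable_mult_right_iff)
    show "AE x in lborel. (\<lambda>n. q n x) \<longlonglongrightarrow> D x v" using q_lim by simp
    show "AE x in lborel. norm (q n x) \<le> M * indicator (cball 0 (R + norm v)) x" for n
      using q_bound by simp
  qed
  then show ?thesis using q_int by (simp add: LIMSEQ_const_iff)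
qed

text \<open>\<open>U\<close> and the complement of \<open>K\<close> are open and cover the space,
  and the extension is continuous on each of them.\<close>

lemma continuous_extend_by_zero:
  fixes f :: "'a::t2_space \<Rightarrow> 'b::real_normed_vector"
  assumes "open U" "compact K" "K \<subseteq> U" "continuous_on U f" "\<And>z. z \<in> U - K \<Longrightarrow> f z = 0"
  shows "continuous_on UNIV (\<lambda>z. if z \<in> U then f z else 0)"
proof -
  have "continuous_on (U \<union> - K) (\<lambda>z. if z \<in> U then f z else 0)"
  proof (rule continuous_on_open_Un)
    show "open (- K)" using assms(2) by (simp add: compact_imp_closed open_Compl)
    show "continuous_on U (\<lambda>z. if z \<in> U then f z else 0)"
      using assms(4) by (rule continuous_on_eq) simp
    show "continuous_on (- K) (\<lambda>z. if z \<in> U then f z else 0)"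
      by (rule continuous_on_eq[OF continuous_on_const[of _ 0]]) (use assms(5) in auto)
  qed (rule assms)
  moreover have "U \<union> - K = UNIV" using assms(3) by auto
  ultimately show ?thesis by simp
qed

lemma set_integrable_compact_support:
  fixes f :: "'a::euclidean_space \<Rightarrow> 'b::{banach, second_countable_topology}"
  assumes "compact K" "K \<subseteq> U" "continuous_on U f" "\<And>z. z \<in> U - K \<Longrightarrow> f z = 0"
  shows "set_integrable lborel U f"
proof -
  have "integrable lborel (\<lambda>x. indicator K x *\<^sub>R f x)"
    using assms by (intro borel_integrable_compact) (auto intro: continuous_on_subset)
  moreover have "indicator K x *\<^sub>R f x = indicator U x *\<^sub>R f x" for x
    using assms(2,4) by (auto simp: indicator_def)
  ultimately show ?thesis by (simp add: set_integrable_def)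
qed

lemma set_integral_fderiv:
  fixes f :: "complex ^ 'n::finite \<Rightarrow> complex"
  assumes "open U" "compact K" "K \<subseteq> U" "smooth_on U f" "\<And>z. z \<in> U - K \<Longrightarrow> f z = 0"
  shows "set_integrable lborel U (\<lambda>z. fderiv f z v)"
    and "set_lebesgue_integral lborel U (\<lambda>z. fderiv f z v) = 0"
proof -
  have f0: "fderiv f z v = 0" if "z \<in> U - K" for z v
    using fderiv_cong_open[of "U - K" z f "\<lambda>z. 0"] assms that
    by (simp add: compact_imp_closed open_Diff)
  show "set_integrable lborel U (\<lambda>z. fderiv f z v)"
    using f0 assms by (intro set_integrable_compact_support smooth_on_continuous_on smooth_on_fderiv) auto
  define f' where "f' z = (if z \<in> U then f z else 0)" for z
  define D where "D z v = (if z \<in> U then fderiv f z v else 0)" for z v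
  have D: "(f' has_derivative D z) (at z)" for z
  proof (cases "z \<in> U")
    case True
    then have "(f has_derivative D z) (at z)"
      using smooth_on_differentiable[OF assms(4) True] by (simp add: frechet_derivative_works D_def[abs_def])
    then show ?thesis
      by (rule has_derivative_transform_within_open[OF _ assms(1) True]) (simp add: f'_def)
  next
    case False
    have "((\<lambda>z. 0) has_derivative D z) (at z)" using False by (simp add: D_def[abs_def])
    then show ?thesis
      by (rule has_derivative_transform_within_open[of _ _ _ _ "- K"])
        (use False assms in \<open>auto simp: f'_def compact_imp_closed open_Compl\<close>)
  qed
  have "integral\<^sup>L lborel (\<lambda>z. D z v) = 0"
  proof (rule integral_directional_derivative[OF D])
    show "continuous_on UNIV (\<lambda>z. D z v)"
      unfolding D_def using f0 assms
      by (intro continuous_extend_by_zero[OF assms(1-3)] smooth_on_continuous_on smooth_on_fderiv) auto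
  qed (use assms in \<open>auto simp: f'_def\<close>)
  moreover have "D z v = indicator U z *\<^sub>R fderiv f z v" for z by (simp add: D_def indicator_def)
  ultimately show "set_lebesgue_integral lborel U (\<lambda>z. fderiv f z v) = 0"
    by (simp add: set_lebesgue_integral_def)
qed

lemma set_integral_wirt:
  fixes f :: "complex ^ 'n::finite \<Rightarrow> complex"
  assumes "open U" "compact K" "K \<subseteq> U" "smooth_on U f" "\<And>z. z \<in> U - K \<Longrightarrow> f z = 0"
  shows "set_integrable lborel U (wirt k f)" "set_lebesgue_integral lborel U (wirt k f) = 0"
    and "set_integrable lborel U (wirt_bar k f)" "set_lebesgue_integral lborel U (wirt_bar k f) = 0"
  unfolding wirt_def[abs_def] wirt_bar_def[abs_def]
  using set_integral_fderiv[OF assms] by simp_all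

lemma continuous_integral_eq_0:
  fixes f :: "'a::euclidean_space \<Rightarrow> real"
  assumes "open U" "compact K" "K \<subseteq> U" "continuous_on U f" "\<And>z. z \<in> U - K \<Longrightarrow> f z = 0"
    and nonneg: "\<And>z. z \<in> U \<Longrightarrow> 0 \<le> f z" and int: "set_lebesgue_integral lborel U f = 0" and "a \<in> U"
  shows "f a = 0"
proof (rule ccontr)
  assume "f a \<noteq> 0"
  then have pos: "f a > 0" using nonneg[OF assms(8)] by simp
  have "isCont f a" using assms(1,4,8) by (simp add: continuous_on_eq_continuous_at)
  then obtain d where d: "d > 0" "\<And>x. dist x a < d \<Longrightarrow> dist (f x) (f a) < f a / 2"
    using pos unfolding continuous_at_eps_delta by (metis half_gt_zero)
  obtain e where e: "e > 0" "ball a e \<subseteq> U" using assms(1,8) by (meson open_contains_ball)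
  define r where "r = min d e"
  have r: "r > 0" "ball a r \<subseteq> U" using d e by (auto simp: r_def)
  have fr: "f a / 2 \<le> f x" if "x \<in> ball a r" for x
    using d(2)[of x] that by (auto simp: r_def dist_commute dist_real_def abs_if split: if_splits)
  have "integral\<^sup>L lborel (\<lambda>x. indicator (ball a r) x *\<^sub>R (f a / 2)) \<le> integral\<^sup>L lborel (\<lambda>x. indicator U x *\<^sub>R f x)"
  proof (rule integral_mono)
    show "integrable lborel (\<lambda>x. indicator (ball a r) x *\<^sub>R (f a / 2))"
      using emeasure_lborel_ball_finite[of a r]
      by (intro integrable_scaleR_left integrable_real_indicator) (auto simp: less_top)
    show "integrable lborel (\<lambda>x. indicator U x *\<^sub>R f x)"
      using set_integrable_compact_support[OF assms(2-5)] by (simp add: set_integrable_def)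
    show "indicator (ball a r) x *\<^sub>R (f a / 2) \<le> indicator U x *\<^sub>R f x" for x
      using fr[of x] nonneg[of x] r by (auto simp: indicator_def subset_iff)
  qed
  also have "\<dots> = 0" using int by (simp add: set_lebesgue_integral_def)
  finally have "measure lborel (ball a r) * (f a / 2) \<le> 0" by simp
  then show False using content_ball_pos[OF r(1), of a] pos
    by (simp add: mult_le_0_iff)
qed

text \<open>Made for the uniqueness of formal adjoints, where \<open>h\<close> is a squared norm
  times the volume density. Since \<open>h\<close> has a sign, one bump around \<open>a\<close>
  decides. It is complex valued because \<open>L2_inner\<close> is.\<close>

lemma eq_0_if_bump_integrals_eq_0:
  fixes h :: "complex ^ 'n::finite \<Rightarrow> complex"
  assumes "open U" "continuous_on U h" and h: "\<And>z. z \<in> U \<Longrightarrow> h z = of_real (Re (h z))" "\<And>z. z \<in> U \<Longrightarrow> 0 \<le> Re (h z)"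
    and int: "\<And>\<eta> K. smooth_on UNIV \<eta> \<Longrightarrow> compact K \<Longrightarrow> K \<subseteq> U \<Longrightarrow> (\<And>z. z \<notin> K \<Longrightarrow> \<eta> z = 0) \<Longrightarrow>
      set_lebesgue_integral lborel U (\<lambda>z. \<eta> z * h z) = 0"
    and "a \<in> U"
  shows "h a = 0"
proof -
  obtain r where r: "r > 0" "cball a r \<subseteq> U" using assms(1,6) by (meson open_contains_cball)
  obtain \<eta> where \<eta>: "smooth_on UNIV (\<lambda>z. complex_of_real (\<eta> z))" "\<And>z. \<eta> z \<ge> 0" "\<eta> a > 0"
    "\<And>z. z \<notin> cball a r \<Longrightarrow> \<eta> z = 0" using exists_bump[OF r(1), of a] by auto
  have cont: "continuous_on U (\<lambda>z. \<eta> z)"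
    using continuous_on_Re[OF continuous_on_subset[OF smooth_on_continuous_on[OF \<eta>(1)] subset_UNIV[of U]]] by simp
  have "complex_of_real (set_lebesgue_integral lborel U (\<lambda>z. \<eta> z * Re (h z)))
      = set_lebesgue_integral lborel U (\<lambda>z. complex_of_real (\<eta> z * Re (h z)))"
    by (rule set_integral_complex_of_real[symmetric])
  also have "\<dots> = set_lebesgue_integral lborel U (\<lambda>z. of_real (\<eta> z) * h z)"
    unfolding set_lebesgue_integral_def
  proof (rule Bochner_Integration.integral_cong[OF refl])
    show "indicator U z *\<^sub>R complex_of_real (\<eta> z * Re (h z)) = indicator U z *\<^sub>R (of_real (\<eta> z) * h z)" for z
      using h(1)[of z] by (cases "z \<in> U") simp_all
  qed
  also have "\<dots> = 0"
    by (rule int[OF \<eta>(1) compact_cball r(2)]) (use \<eta>(4) in auto)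
  finally have "set_lebesgue_integral lborel U (\<lambda>z. \<eta> z * Re (h z)) = 0"
    by (rule of_real_eq_0_iff[THEN iffD1])
  then have "(\<lambda>z. \<eta> z * Re (h z)) a = 0"
  proof (rule continuous_integral_eq_0[OF assms(1) compact_cball r(2), rotated 3])
    show "continuous_on U (\<lambda>z. \<eta> z * Re (h z))"
      by (rule continuous_on_mult[OF cont continuous_on_Re[OF assms(2)]])
    show "0 \<le> \<eta> z * Re (h z)" if "z \<in> U" for z
      using h(2)[OF that] \<eta>(2) by simp
    show "\<eta> z * Re (h z) = 0" if "z \<in> U - cball a r" for z
      using \<eta>(4)[of z] that by simp
  qed (rule assms)
  then have "Re (h a) = 0" using \<eta>(3) by simp
  then show ?thesis using h(1)[OF assms(6)] by (metis of_real_0)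
qed

section \<open>Hermitian matrices of size two\<close>

lemma matrix_inv_unique:
  fixes P :: "'a::field ^ 'n ^ 'n"
  assumes "P ** Q = mat 1"
  shows "matrix_inv P = Q"
proof -
  have QP: "Q ** P = mat 1" using assms matrix_left_right_inverse by blast
  have "\<exists>B. P ** B = mat 1 \<and> B ** P = mat 1" using assms QP by blast
  then have "P ** matrix_inv P = mat 1 \<and> matrix_inv P ** P = mat 1"
    unfolding matrix_inv_def by (rule someI_ex)
  then have "matrix_inv P = (Q ** P) ** matrix_inv P" "P ** matrix_inv P = mat 1"
    using QP by (simp_all add: matrix_mul_lid)
  then show ?thesis by (simp add: matrix_mul_assoc[symmetric] matrix_mul_rid)
qed

lemma matrix_inv_2:
  fixes P :: "complex ^ 2 ^ 2"
  assumes "det P \<noteq> 0"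
  shows "matrix_inv P $ 1 $ 1 = P $ 2 $ 2 / det P" "matrix_inv P $ 1 $ 2 = - P $ 1 $ 2 / det P"
    "matrix_inv P $ 2 $ 1 = - P $ 2 $ 1 / det P" "matrix_inv P $ 2 $ 2 = P $ 1 $ 1 / det P"
proof -
  let ?Q = "vector [vector [P $ 2 $ 2 / det P, - P $ 1 $ 2 / det P],
    vector [- P $ 2 $ 1 / det P, P $ 1 $ 1 / det P]] :: complex ^ 2 ^ 2"
  have d: "P $ 1 $ 1 * P $ 2 $ 2 - P $ 1 $ 2 * P $ 2 $ 1 \<noteq> 0" using assms by (simp add: det_2)
  have "P ** ?Q = mat 1"
    using d by (simp add: vec_eq_iff forall_2 matrix_matrix_mult_def sum_2 mat_def det_2 divide_simps)
  then have "matrix_inv P = ?Q" by (rule matrix_inv_unique)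
  then show "matrix_inv P $ 1 $ 1 = P $ 2 $ 2 / det P" "matrix_inv P $ 1 $ 2 = - P $ 1 $ 2 / det P"
    "matrix_inv P $ 2 $ 1 = - P $ 2 $ 1 / det P" "matrix_inv P $ 2 $ 2 = P $ 1 $ 1 / det P"
    by simp_all
qed

lemma hermitian_pos_def_2:
  fixes P :: "complex ^ 2 ^ 2"
  assumes "hermitian_pos_def P"
  obtains p q r where "P $ 1 $ 1 = of_real p" "P $ 1 $ 2 = q" "P $ 2 $ 1 = cnj q" "P $ 2 $ 2 = of_real r"
    "p > 0" "r > 0" "p * r - (cmod q)\<^sup>2 > 0" "det P = of_real (p * r - (cmod q)\<^sup>2)"
proof -
  have herm: "P $ j $ i = cnj (P $ i $ j)" for i j
    using assms unfolding hermitian_pos_def_def hermitian_matrix_def by blast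
  have pos: "0 < Re (P $ 1 $ 1 * a * cnj a + P $ 1 $ 2 * a * cnj b + (P $ 2 $ 1 * b * cnj a + P $ 2 $ 2 * b * cnj b))"
    if "a \<noteq> 0 \<or> b \<noteq> 0" for a b
  proof -
    have "(vector [a, b] :: complex ^ 2) \<noteq> 0" using that by (simp add: vec_eq_iff forall_2)
    with assms have "0 < Re (\<Sum>i\<in>UNIV. \<Sum>j\<in>UNIV. P $ i $ j * (vector [a, b] :: complex ^ 2) $ i * cnj ((vector [a, b] :: complex ^ 2) $ j))"
      unfolding hermitian_pos_def_def by blast
    then show ?thesis by (simp add: sum_2)
  qed
  define p r q where "p = Re (P $ 1 $ 1)" and "r = Re (P $ 2 $ 2)" and "q = P $ 1 $ 2"
  have real: "P $ 1 $ 1 = of_real p" "P $ 2 $ 2 = of_real r"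
    using herm[of 1 1] herm[of 2 2] by (simp_all add: p_def r_def complex_eq_iff)
  have q: "P $ 1 $ 2 = q" "P $ 2 $ 1 = cnj q" using herm[of 2 1] by (simp_all add: q_def)
  have p: "p > 0" using pos[of 1 0] by (simp add: real)
  have r: "r > 0" using pos[of 0 1] by (simp add: real)
  \<comment> \<open>The vector (a, b) = (- cnj q, p) solves p a + cnj q b = 0, so the form there
    collapses to p times the determinant.\<close>
  have "0 < Re (of_real p * (- cnj q) * cnj (- cnj q) + q * (- cnj q) * cnj (of_real p)
      + (cnj q * of_real p * cnj (- cnj q) + of_real r * of_real p * cnj (of_real p)))"
    using pos[of "- cnj q" "of_real p"] p by (simp add: real q)
  also have "of_real p * (- cnj q) * cnj (- cnj q) + q * (- cnj q) * cnj (of_real p)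
      + (cnj q * of_real p * cnj (- cnj q) + of_real r * of_real p * cnj (of_real p))
      = of_real p * (of_real p * of_real r - q * cnj q)" by (simp add: algebra_simps)
  also have "\<dots> = of_real (p * (p * r - (cmod q)\<^sup>2))" by (simp add: complex_norm_square[symmetric])
  finally have "p * (p * r - (cmod q)\<^sup>2) > 0" by simp
  then have d: "p * r - (cmod q)\<^sup>2 > 0" using p by (simp add: zero_less_mult_iff)
  have "det P = of_real p * of_real r - q * cnj q" by (simp add: det_2 real q)
  also have "\<dots> = of_real (p * r - (cmod q)\<^sup>2)" by (simp add: complex_norm_square[symmetric])
  finally show thesis using that[OF real(1) q real(2) p r d] by blast
qed

lemma hermitian_pos_def_det:
  fixes P :: "complex ^ 2 ^ 2"
  assumes "hermitian_pos_def P"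
  shows "det P = of_real (Re (det P))" "Re (det P) > 0" "det P \<noteq> 0"
proof -
  obtain p q r where *: "(p::real) * r - (cmod q)\<^sup>2 > 0" "det P = of_real (p * r - (cmod q)\<^sup>2)"
    using hermitian_pos_def_2[OF assms] by metis
  show "det P = of_real (Re (det P))" "Re (det P) > 0" "det P \<noteq> 0"
    using *(1) unfolding *(2) by (simp_all only: Re_complex_of_real of_real_eq_0_iff)
qed

text \<open>Cholesky decomposition of the inverse matrix: traces against it become sums of squares.\<close>

lemma matrix_inv_gram:
  fixes P :: "complex ^ 2 ^ 2"
  assumes "hermitian_pos_def P"
  obtains v w :: "complex ^ 2" where
    "\<And>k l. matrix_inv P $ l $ k = v $ k * cnj (v $ l) + w $ k * cnj (w $ l)"
    "v $ 1 * w $ 2 - v $ 2 * w $ 1 \<noteq> 0"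
proof -
  obtain p q r where P: "P $ 1 $ 1 = of_real p" "P $ 1 $ 2 = q" "P $ 2 $ 1 = cnj q" "P $ 2 $ 2 = of_real r"
    "p > 0" "r > 0" "p * r - (cmod q)\<^sup>2 > 0" "det P = of_real (p * r - (cmod q)\<^sup>2)"
    using hermitian_pos_def_2[OF assms] .
  define d where "d = p * r - (cmod q)\<^sup>2"
  have d: "d > 0" "det P = of_real d" using P by (simp_all add: d_def)
  \<comment> \<open>The square of \<open>s\<close> is the first diagonal entry of the inverse; the
    off-diagonal entry then forces the second coordinate of \<open>v\<close>, and 1 / r is what
    remains of the last entry p / d for the square of \<open>t\<close>.\<close>
  define s where "s = sqrt (r / d)"
  have s: "s > 0" "s * s = r / d" using P(6) d(1) by (simp_all add: s_def)
  define t where "t = sqrt (1 / r)"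
  have t: "t > 0" "t * t = 1 / r" using P(6) by (simp_all add: t_def)
  define v where "v = (vector [of_real s, - q / of_real (d * s)] :: complex ^ 2)"
  define w where "w = (vector [0, of_real t] :: complex ^ 2)"
  have H: "matrix_inv P $ 1 $ 1 = of_real r / of_real d" "matrix_inv P $ 1 $ 2 = - q / of_real d"
    "matrix_inv P $ 2 $ 1 = - cnj q / of_real d" "matrix_inv P $ 2 $ 2 = of_real p / of_real d"
    using matrix_inv_2[of P] d P by simp_all
  have ss: "complex_of_real s * of_real s = of_real r / of_real d"
    using s(2) by (metis of_real_divide of_real_mult)
  have tt: "complex_of_real t * of_real t = 1 / of_real r"
    using t(2) by (metis of_real_1 of_real_divide of_real_mult)
  have "q * cnj q / (of_real (d * s) * of_real (d * s)) + of_real t * of_real t = of_real p / of_real d"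
  proof -
    have A: "q * cnj q = of_real (p * r - d)" by (simp add: d_def complex_norm_square[symmetric])
    have "(d * s) * (d * s) = d * r" using s(2) d(1) by (simp add: field_simps)
    then have B: "complex_of_real (d * s) * of_real (d * s) = of_real (d * r)" by (metis of_real_mult)
    have C: "(p * r - d) / (d * r) + 1 / r = p / d" using d(1) P(6) by (simp add: field_simps)
    have "q * cnj q / (of_real (d * s) * of_real (d * s)) + of_real t * of_real t
        = of_real (p * r - d) / of_real (d * r) + 1 / of_real r" by (simp only: A B tt)
    also have "\<dots> = of_real ((p * r - d) / (d * r) + 1 / r)" by simp
    finally show ?thesis unfolding C by simp
  qed
  then have "matrix_inv P $ 2 $ 2 = v $ 2 * cnj (v $ 2) + w $ 2 * cnj (w $ 2)"
    by (simp add: H v_def w_def)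
  moreover have "matrix_inv P $ 1 $ 1 = v $ 1 * cnj (v $ 1) + w $ 1 * cnj (w $ 1)"
    using ss by (simp add: H v_def w_def)
  moreover have "matrix_inv P $ 1 $ 2 = v $ 2 * cnj (v $ 1) + w $ 2 * cnj (w $ 1)"
    using s d by (simp add: H v_def w_def)
  moreover have "matrix_inv P $ 2 $ 1 = v $ 1 * cnj (v $ 2) + w $ 1 * cnj (w $ 2)"
    using s d by (simp add: H v_def w_def)
  ultimately have "matrix_inv P $ l $ k = v $ k * cnj (v $ l) + w $ k * cnj (w $ l)" for k l
    using exhaust_2[of k] exhaust_2[of l] by auto
  moreover have "v $ 1 * w $ 2 - v $ 2 * w $ 1 \<noteq> 0" using s t by (simp add: v_def w_def)
  ultimately show thesis using that by blast
qed

lemma hermitian_inverse_form: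
  fixes P :: "complex ^ 2 ^ 2" and x :: "complex ^ 2"
  assumes "hermitian_pos_def P"
  shows "0 \<le> Re (\<Sum>k\<in>UNIV. \<Sum>l\<in>UNIV. matrix_inv P $ l $ k * (cnj (x $ k) * x $ l))" (is "0 \<le> Re ?S")
    and "x \<noteq> 0 \<Longrightarrow> 0 < Re (\<Sum>k\<in>UNIV. \<Sum>l\<in>UNIV. matrix_inv P $ l $ k * (cnj (x $ k) * x $ l))"
    and "(\<Sum>k\<in>UNIV. \<Sum>l\<in>UNIV. matrix_inv P $ l $ k * (cnj (x $ k) * x $ l))
      = of_real (Re (\<Sum>k\<in>UNIV. \<Sum>l\<in>UNIV. matrix_inv P $ l $ k * (cnj (x $ k) * x $ l)))"
proof -
  obtain v w :: "complex ^ 2" where H: "\<And>k l. matrix_inv P $ l $ k = v $ k * cnj (v $ l) + w $ k * cnj (w $ l)"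
    and ne: "v $ 1 * w $ 2 - v $ 2 * w $ 1 \<noteq> 0" by (rule matrix_inv_gram[OF assms]) blast
  define a b where "a = v $ 1 * cnj (x $ 1) + v $ 2 * cnj (x $ 2)" and "b = w $ 1 * cnj (x $ 1) + w $ 2 * cnj (x $ 2)"
  have "?S = a * cnj a + b * cnj b" unfolding H a_def b_def by (simp add: sum_2 algebra_simps)
  also have "\<dots> = of_real ((cmod a)\<^sup>2 + (cmod b)\<^sup>2)" by (simp add: complex_norm_square[symmetric])
  finally have S'': "?S = of_real ((cmod a)\<^sup>2 + (cmod b)\<^sup>2)" .
  show "?S = of_real (Re ?S)" unfolding S'' by (simp only: Re_complex_of_real)
  from S'' have S: "Re ?S = (cmod a)\<^sup>2 + (cmod b)\<^sup>2" by simp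
  then show "0 \<le> Re ?S" by simp
  show "0 < Re ?S" if "x \<noteq> 0"
  proof (rule ccontr)
    assume "\<not> 0 < Re ?S"
    then have ab: "a = 0" "b = 0" unfolding S by (simp_all add: sum_power2_gt_zero_iff)
    \<comment> \<open>Cramer's rule for the system with rows \<open>v\<close> and
      \<open>w\<close>.\<close>
    have "(v $ 1 * w $ 2 - v $ 2 * w $ 1) * cnj (x $ 1) = a * w $ 2 - b * v $ 2"
      "(v $ 1 * w $ 2 - v $ 2 * w $ 1) * cnj (x $ 2) = b * v $ 1 - a * w $ 1"
      unfolding a_def b_def by (simp_all add: algebra_simps)
    then have "x $ 1 = 0" "x $ 2 = 0" using ab ne by simp_all
    then show False using that by (simp add: vec_eq_iff forall_2)
  qed
qed

section \<open>The Chern Laplacian and the strong maximum principle\<close>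

text \<open>The trace of the complex Hessian. Having no first order terms, it has a sign at an
  interior maximum by the second derivatives alone.\<close>

definition chern_laplacian ::
  "(complex ^ 'n \<Rightarrow> complex ^ 'n ^ 'n) \<Rightarrow> (complex ^ 'n \<Rightarrow> complex) \<Rightarrow> complex ^ 'n \<Rightarrow> complex" where
  "chern_laplacian G u z = (\<Sum>k\<in>UNIV. \<Sum>l\<in>UNIV. matrix_inv (G z) $ l $ k * wirt k (wirt_bar l u) z)"

lemma fderiv_eq_wirt:
  fixes f :: "complex ^ 'n::finite \<Rightarrow> complex"
  assumes "f differentiable (at z)"
  shows "fderiv f z v = (\<Sum>k\<in>UNIV. wirt k f z * v $ k + wirt_bar k f z * cnj (v $ k))"
proof -
  note lin = linear_frechet_derivative[OF assms]
  have v: "v = (\<Sum>k\<in>UNIV. Re (v $ k) *\<^sub>R axis k 1 + Im (v $ k) *\<^sub>R axis k \<i>)"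
  proof (rule vec_eq_iff[THEN iffD2], rule allI)
    fix j
    have "(\<Sum>k\<in>UNIV. Re (v $ k) *\<^sub>R axis k 1 + Im (v $ k) *\<^sub>R axis k \<i>) $ j
        = (\<Sum>k\<in>UNIV. if k = j then of_real (Re (v $ k)) + of_real (Im (v $ k)) * \<i> else 0)"
      unfolding sum_component by (rule sum.cong) (auto simp: axis_def complex_eq_iff)
    also have "\<dots> = v $ j" by (simp add: complex_eq_iff)
    finally show "v $ j = (\<Sum>k\<in>UNIV. Re (v $ k) *\<^sub>R axis k 1 + Im (v $ k) *\<^sub>R axis k \<i>) $ j" ..
  qed
  have "fderiv f z v = (\<Sum>k\<in>UNIV. of_real (Re (v $ k)) * fderiv f z (axis k 1) + of_real (Im (v $ k)) * fderiv f z (axis k \<i>))"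
    by (subst v) (simp only: linear_sum[OF lin] linear_add[OF lin] linear_cmul[OF lin] scaleR_conv_of_real[where 'a = complex])
  also have "\<dots> = (\<Sum>k\<in>UNIV. wirt k f z * v $ k + wirt_bar k f z * cnj (v $ k))"
  proof (rule sum.cong[OF refl])
    fix k
    show "of_real (Re (v $ k)) * fderiv f z (axis k 1) + of_real (Im (v $ k)) * fderiv f z (axis k \<i>)
        = wirt k f z * v $ k + wirt_bar k f z * cnj (v $ k)"
      by (simp add: wirt_def wirt_bar_def complex_eq_iff field_simps)
  qed
  finally show ?thesis .
qed

lemma wirt_direction:
  fixes f :: "complex ^ 'n::finite \<Rightarrow> complex"
  assumes "f differentiable (at z)"
  shows "(\<Sum>k\<in>UNIV. w $ k * wirt k f z) = (fderiv f z w - \<i> * fderiv f z (\<i> *s w)) / 2"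
    and "(\<Sum>k\<in>UNIV. cnj (w $ k) * wirt_bar k f z) = (fderiv f z w + \<i> * fderiv f z (\<i> *s w)) / 2"
proof -
  have "fderiv f z w - \<i> * fderiv f z (\<i> *s w) = 2 * (\<Sum>k\<in>UNIV. w $ k * wirt k f z)"
    unfolding fderiv_eq_wirt[OF assms]
    by (simp add: sum_distrib_left sum_subtractf[symmetric] algebra_simps)
  then show "(\<Sum>k\<in>UNIV. w $ k * wirt k f z) = (fderiv f z w - \<i> * fderiv f z (\<i> *s w)) / 2" by simp
  have "fderiv f z w + \<i> * fderiv f z (\<i> *s w) = 2 * (\<Sum>k\<in>UNIV. cnj (w $ k) * wirt_bar k f z)"
    unfolding fderiv_eq_wirt[OF assms]
    by (simp add: sum_distrib_left sum.distrib[symmetric] algebra_simps)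
  then show "(\<Sum>k\<in>UNIV. cnj (w $ k) * wirt_bar k f z) = (fderiv f z w + \<i> * fderiv f z (\<i> *s w)) / 2" by simp
qed

text \<open>The Levi form on \<open>w\<close> is a quarter of the real Laplacian on the complex line
  spanned by \<open>w\<close>; the mixed terms cancel by symmetry of second derivatives.\<close>

lemma levi_form_direction:
  fixes u :: "complex ^ 'n::finite \<Rightarrow> complex"
  assumes "open U" "smooth_on U u" "z \<in> U"
  shows "(\<Sum>k\<in>UNIV. \<Sum>l\<in>UNIV. w $ k * cnj (w $ l) * wirt k (wirt_bar l u) z)
    = (fderiv (\<lambda>x. fderiv u x w) z w + fderiv (\<lambda>x. fderiv u x (\<i> *s w)) z (\<i> *s w)) / 4"
proof -
  let ?iw = "\<i> *s w"
  define g where "g x = (1/2) * (fderiv u x w + \<i> * fderiv u x ?iw)" for x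
  have g_smooth: "smooth_on U g"
    unfolding g_def using assms by (intro smooth_on_mult smooth_on_add smooth_on_const smooth_on_fderiv)
  have D: "((\<lambda>x. fderiv u x v) has_derivative fderiv (\<lambda>x. fderiv u x v) z) (at z)" for v
    using differentiable_fderiv[OF assms(2,3)] by (simp add: frechet_derivative_works)
  have "(g has_derivative (\<lambda>v. (1/2) * (fderiv (\<lambda>x. fderiv u x w) z v + \<i> * fderiv (\<lambda>x. fderiv u x ?iw) z v))) (at z)"
    unfolding g_def by (auto intro!: derivative_eq_intros D)
  from fderivI[OF this] have Dg: "fderiv g z v = (1/2) * (fderiv (\<lambda>x. fderiv u x w) z v + \<i> * fderiv (\<lambda>x. fderiv u x ?iw) z v)" for v
    by simp
  have sw: "smooth_on U (wirt_bar l u)" for l by (rule smooth_on_wirt_bar[OF assms(1,2)])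
  have "(\<Sum>k\<in>UNIV. \<Sum>l\<in>UNIV. w $ k * cnj (w $ l) * wirt k (wirt_bar l u) z)
      = (\<Sum>k\<in>UNIV. w $ k * (\<Sum>l\<in>UNIV. cnj (w $ l) * wirt k (wirt_bar l u) z))"
    by (simp add: sum_distrib_left mult.assoc)
  also have "\<dots> = (\<Sum>k\<in>UNIV. w $ k * wirt k g z)"
  proof (rule sum.cong[OF refl])
    fix k
    have "wirt k g z = wirt k (\<lambda>x. \<Sum>l\<in>UNIV. cnj (w $ l) * wirt_bar l u x) z"
    proof (rule wirt_cong_open[OF assms(1,3)])
      show "g x = (\<Sum>l\<in>UNIV. cnj (w $ l) * wirt_bar l u x)" if "x \<in> U" for x
        using wirt_direction(2)[OF smooth_on_differentiable[OF assms(2) that]] by (simp add: g_def)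
    qed
    also have "\<dots> = (\<Sum>l\<in>UNIV. wirt k (\<lambda>x. cnj (w $ l) * wirt_bar l u x) z)"
      by (rule wirt_sum) (use smooth_on_differentiable[OF sw assms(3)] in auto)
    also have "\<dots> = (\<Sum>l\<in>UNIV. cnj (w $ l) * wirt k (wirt_bar l u) z)"
      using smooth_on_differentiable[OF sw assms(3)] by (simp add: wirt_cmult)
    finally show "w $ k * (\<Sum>l\<in>UNIV. cnj (w $ l) * wirt k (wirt_bar l u) z) = w $ k * wirt k g z" by simp
  qed
  also have "\<dots> = (fderiv g z w - \<i> * fderiv g z ?iw) / 2"
    by (rule wirt_direction) (rule smooth_on_differentiable[OF g_smooth assms(3)])
  also have "\<dots> = (fderiv (\<lambda>x. fderiv u x w) z w + fderiv (\<lambda>x. fderiv u x ?iw) z ?iw) / 4"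
    unfolding Dg using fderiv_commute[OF assms, of w ?iw] by (simp add: field_simps)
  finally show ?thesis .
qed

text \<open>On the real line through \<open>z\<close> a positive second derivative would make the
  first derivative, zero at the maximum, positive just behind it, and the restriction would rise
  above its maximum.\<close>

lemma second_derivative_at_max:
  assumes "smooth_on U u" "r > 0" "ball z r \<subseteq> U"
    and max: "\<And>x. x \<in> ball z r \<Longrightarrow> Re (u x) \<le> Re (u z)"
  shows "Re (fderiv (\<lambda>x. fderiv u x w) z w) \<le> 0"
proof (rule ccontr)
  assume neg: "\<not> ?thesis"
  have zU: "z \<in> U" using assms by auto
  define d where "d = r / (norm w + 1)"
  have nw: "norm w + 1 > 0" using norm_ge_zero[of w] by linarith
  have d: "d > 0" using assms(2) nw by (simp add: d_def)
  have inb: "z + t *\<^sub>R w \<in> ball z r" if "\<bar>t\<bar> < d" for t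
  proof -
    have "\<bar>t\<bar> * norm w \<le> \<bar>t\<bar> * (norm w + 1)" by (simp add: algebra_simps)
    also have "\<dots> < d * (norm w + 1)" using that nw by (rule mult_strict_right_mono)
    also have "\<dots> = r" using nw by (simp add: d_def)
    finally show ?thesis by (simp add: dist_norm)
  qed
  have line: "((\<lambda>t. z + t *\<^sub>R w) has_derivative (\<lambda>h. h *\<^sub>R w)) (at t)" for t
    by (auto intro!: derivative_eq_intros)
  have der: "((\<lambda>t. Re (f (z + t *\<^sub>R w))) has_real_derivative Re (fderiv f (z + t *\<^sub>R w) w)) (at t)"
    if "smooth_on U f" "\<bar>t\<bar> < d" for f t
  proof -
    have diff: "f differentiable (at (z + t *\<^sub>R w))"
      using smooth_on_differentiable[OF that(1)] inb[OF that(2)] assms(3) by auto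
    then have "(f has_derivative fderiv f (z + t *\<^sub>R w)) (at (z + t *\<^sub>R w))"
      by (simp add: frechet_derivative_works)
    from has_derivative_compose[OF line this]
    have "((\<lambda>t. Re (f (z + t *\<^sub>R w))) has_derivative (\<lambda>h. Re (fderiv f (z + t *\<^sub>R w) (h *\<^sub>R w)))) (at t)"
      by (rule bounded_linear.has_derivative[OF bounded_linear_Re])
    moreover have "Re (fderiv f (z + t *\<^sub>R w) (h *\<^sub>R w)) = Re (fderiv f (z + t *\<^sub>R w) w) * h" for h
      using linear_cmul[OF linear_frechet_derivative[OF diff]] by simp
    ultimately show ?thesis by (simp add: has_field_derivative_def)
  qed
  define p p' where "p t = Re (u (z + t *\<^sub>R w))" and "p' t = Re (fderiv u (z + t *\<^sub>R w) w)" for t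
  have p: "(p has_real_derivative p' t) (at t)" if "\<bar>t\<bar> < d" for t
    unfolding p_def p'_def by (rule der[OF assms(1) that])
  have p': "(p' has_real_derivative Re (fderiv (\<lambda>x. fderiv u x w) z w)) (at 0)"
    using der[OF smooth_on_fderiv[OF assms(1)], of 0 w] d by (simp add: p'_def[abs_def])
  have "p' 0 = 0"
    by (rule DERIV_local_max[OF p[of 0] d]) (use d max inb in \<open>auto simp: p_def\<close>)
  moreover obtain e where e: "e > 0" "\<And>h. 0 < h \<Longrightarrow> h < e \<Longrightarrow> p' 0 < p' (0 + h)"
    using DERIV_pos_inc_right[OF p'] neg by auto
  ultimately have p'_pos: "p' t > 0" if "0 < t" "t < e" for t using that by force
  define t where "t = min d e / 2"
  have t: "0 < t" "t < d" "t < e" using d e by (auto simp: t_def)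
  have "p 0 < p t"
  proof (rule DERIV_pos_imp_increasing_open[OF t(1)])
    show "\<exists>y. (p has_real_derivative y) (at x) \<and> y > 0" if "0 < x" "x < t" for x
      using p[of x] p'_pos[of x] that t by auto
    show "continuous_on {0..t} p"
    proof (intro continuous_at_imp_continuous_on ballI)
      show "isCont p x" if "x \<in> {0..t}" for x using DERIV_isCont[OF p[of x]] that t by auto
    qed
  qed
  moreover have "p t \<le> p 0" using max[OF inb[of t]] t by (simp add: p_def)
  ultimately show False by simp
qed

locale hermitian_chart =
  fixes U :: "(complex ^ 2) set" and G :: "complex ^ 2 \<Rightarrow> complex ^ 2 ^ 2"
  assumes open_U: "open U"
    and smooth_G: "\<And>i j. smooth_on U (\<lambda>z. G z $ i $ j)"
    and pos_G: "\<And>z. z \<in> U \<Longrightarrow> hermitian_pos_def (G z)"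
begin

lemma det_nz: "z \<in> U \<Longrightarrow> det (G z) \<noteq> 0"
  using hermitian_pos_def_det pos_G by blast

lemma smooth_det: "smooth_on U (\<lambda>z. det (G z))"
  unfolding det_2 by (intro smooth_on_diff smooth_on_mult smooth_G open_U)

lemma smooth_H: "smooth_on U (\<lambda>z. matrix_inv (G z) $ i $ j)"
proof -
  have "smooth_on U (\<lambda>z. matrix_inv (G z) $ 1 $ 1)" "smooth_on U (\<lambda>z. matrix_inv (G z) $ 2 $ 2)"
    "smooth_on U (\<lambda>z. matrix_inv (G z) $ 1 $ 2)" "smooth_on U (\<lambda>z. matrix_inv (G z) $ 2 $ 1)"
  proof -
    show "smooth_on U (\<lambda>z. matrix_inv (G z) $ 1 $ 1)"
      by (rule smooth_on_cong[OF open_U matrix_inv_2(1)[OF det_nz, symmetric]])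
        (assumption | intro smooth_on_divide smooth_on_minus smooth_G smooth_det det_nz open_U)+
    show "smooth_on U (\<lambda>z. matrix_inv (G z) $ 2 $ 2)"
      by (rule smooth_on_cong[OF open_U matrix_inv_2(4)[OF det_nz, symmetric]])
        (assumption | intro smooth_on_divide smooth_on_minus smooth_G smooth_det det_nz open_U)+
    show "smooth_on U (\<lambda>z. matrix_inv (G z) $ 1 $ 2)"
      by (rule smooth_on_cong[OF open_U matrix_inv_2(2)[OF det_nz, symmetric]])
        (assumption | intro smooth_on_divide smooth_on_minus smooth_G smooth_det det_nz open_U)+
    show "smooth_on U (\<lambda>z. matrix_inv (G z) $ 2 $ 1)"
      by (rule smooth_on_cong[OF open_U matrix_inv_2(3)[OF det_nz, symmetric]])
        (assumption | intro smooth_on_divide smooth_on_minus smooth_G smooth_det det_nz open_U)+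
  qed
  then show ?thesis using exhaust_2[of i] exhaust_2[of j] by auto
qed

text \<open>The rank one terms \<open>v\<close> and \<open>w\<close> of the inverse metric split the
  Laplacian into two Levi forms, each a sum of second derivatives along two real directions.\<close>

lemma chern_laplacian_at_max:
  assumes "smooth_on U u" "r > 0" "ball z r \<subseteq> U"
    and "\<And>x. x \<in> ball z r \<Longrightarrow> Re (u x) \<le> Re (u z)"
  shows "Re (chern_laplacian G u z) \<le> 0"
proof -
  have zU: "z \<in> U" using assms by auto
  obtain v w :: "complex ^ 2" where H: "\<And>k l. matrix_inv (G z) $ l $ k = v $ k * cnj (v $ l) + w $ k * cnj (w $ l)"
    using matrix_inv_gram[OF pos_G[OF zU]] by metis
  have "chern_laplacian G u z = (\<Sum>k\<in>UNIV. \<Sum>l\<in>UNIV. v $ k * cnj (v $ l) * wirt k (wirt_bar l u) z)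
      + (\<Sum>k\<in>UNIV. \<Sum>l\<in>UNIV. w $ k * cnj (w $ l) * wirt k (wirt_bar l u) z)"
    unfolding chern_laplacian_def H by (simp add: sum.distrib distrib_right)
  then show ?thesis
    unfolding levi_form_direction[OF open_U assms(1) zU]
    using second_derivative_at_max[OF assms, of v] second_derivative_at_max[OF assms, of "\<i> *s v"]
      second_derivative_at_max[OF assms, of w] second_derivative_at_max[OF assms, of "\<i> *s w"]
    by (simp add: add_nonpos_nonpos divide_nonpos_pos)
qed

end

section \<open>A Gaussian as barrier, and Hopf's form of the maximum principle\<close>

lemma wirt_coordinate:
  fixes z :: "complex ^ 'n::finite"
  shows "wirt k (\<lambda>z. z $ j) z = (if k = j then 1 else 0)" "wirt_bar k (\<lambda>z. z $ j) z = 0"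
proof -
  have "((\<lambda>z. z $ j) has_derivative (\<lambda>v. v $ j)) (at z)"
    by (rule bounded_linear_imp_has_derivative) (rule bounded_linear_vec_nth)
  from fderivI[OF this] show "wirt k (\<lambda>z. z $ j) z = (if k = j then 1 else 0)" "wirt_bar k (\<lambda>z. z $ j) z = 0"
    by (simp_all add: wirt_def wirt_bar_def axis_def)
qed

lemma wirt_compose:
  assumes "(h has_field_derivative h') (at (f z))" "f differentiable (at z)"
  shows "wirt k (\<lambda>z. h (f z)) z = h' * wirt k f z"
    and "wirt_bar k (\<lambda>z. h (f z)) z = h' * wirt_bar k f z"
proof -
  have "(h has_derivative (*) h') (at (f z))"
    using assms(1) by (simp add: has_field_derivative_def)
  moreover have "(f has_derivative fderiv f z) (at z)"
    using assms(2) by (simp add: frechet_derivative_works)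
  ultimately have "((\<lambda>z. h (f z)) has_derivative (\<lambda>v. h' * fderiv f z v)) (at z)"
    using has_derivative_compose by blast
  from fderivI[OF this] show "wirt k (\<lambda>z. h (f z)) z = h' * wirt k f z"
    "wirt_bar k (\<lambda>z. h (f z)) z = h' * wirt_bar k f z"
    by (simp_all add: wirt_def wirt_bar_def field_simps)
qed

lemma gaussian:
  fixes y :: "complex ^ 'n::finite"
  defines "E \<equiv> \<lambda>a z. complex_of_real (exp (- a * (dist z y)\<^sup>2))"
  shows "smooth_on UNIV (E a)"
    and "wirt k (wirt_bar l (E a)) z
      = E a z * (of_real (a\<^sup>2) * ((z $ l - y $ l) * cnj (z $ k - y $ k)) - (if k = l then of_real a else 0))"
proof -
  show sE: "smooth_on UNIV (E a)"
  proof -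
    \<comment> \<open>The functions a^n exp (a t) are the successive derivatives of exp (a t); the
      Gaussian is the member of order 0, composed with minus the squared distance.\<close>
    have "smooth_on UNIV (\<lambda>z. complex_of_real ((\<lambda>n t. a ^ n * exp (a * t)) 0 (Re (- of_real ((dist z y)\<^sup>2)))))"
      by (rule smooth_on_compose_real)
        (auto intro!: derivative_eq_intros smooth_on_minus smooth_on_dist_square simp del: of_real_power)
    then show ?thesis by (simp add: E_def)
  qed
  \<comment> \<open>The squared distance as a polynomial in the coordinates and their conjugates,
    from which both Wirtinger derivatives can be read off.\<close>
  define q where "q = (\<lambda>z::complex ^ 'n. \<Sum>k\<in>UNIV. (z $ k - y $ k) * cnj (z $ k - y $ k))"
  have coord: "smooth_on UNIV (\<lambda>z. z $ k - y $ k)" for k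
    by (intro smooth_on_diff smooth_on_const smooth_on_coordinate open_UNIV)
  have sq: "smooth_on UNIV q"
    unfolding q_def by (intro smooth_on_sum smooth_on_mult smooth_on_cnj coord open_UNIV)
  have q: "q z = of_real ((dist z y)\<^sup>2)" for z
    by (simp add: q_def dist_vec_def L2_set_def sum_nonneg dist_norm complex_norm_square
        del: of_real_power complex_cnj_diff)
  have E: "E a = (\<lambda>z. exp (- of_real a * q z))"
    unfolding E_def q by (simp flip: exp_of_real)
  have dc: "(\<lambda>z. z $ k - y $ k) differentiable (at z)" for k z
    by (rule smooth_on_differentiable[OF coord]) simp
  have dcc: "(\<lambda>z. cnj (z $ k - y $ k)) differentiable (at z)" for k z
    by (rule smooth_on_differentiable[OF smooth_on_cnj[OF open_UNIV coord]]) simp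
  have dz: "(\<lambda>z. z $ k) differentiable (at z)" for k and z :: "complex ^ 'n"
    by (rule smooth_on_differentiable[OF smooth_on_coordinate]) simp
  have wc: "wirt k (\<lambda>z. z $ j - y $ j) z = (if k = j then 1 else 0)" "wirt_bar k (\<lambda>z. z $ j - y $ j) z = 0" for k j z
    using dz by (simp_all add: wirt_diff wirt_coordinate)
  have wq: "wirt k q z = cnj (z $ k - y $ k)" "wirt_bar k q z = z $ k - y $ k" for k z
  proof -
    have dp: "(\<lambda>z. (z $ k - y $ k) * cnj (z $ k - y $ k)) differentiable (at z)" for k
      by (intro differentiable_mult dc dcc)
    have "wirt k q z = (\<Sum>j\<in>UNIV. wirt k (\<lambda>z. (z $ j - y $ j) * cnj (z $ j - y $ j)) z)"
      unfolding q_def by (rule wirt_sum) (rule dp)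
    also have "\<dots> = (\<Sum>j\<in>UNIV. if k = j then cnj (z $ j - y $ j) else 0)"
      by (rule sum.cong[OF refl]) (simp add: wirt_mult[OF dc dcc] wirt_cnj[OF dc] wc del: complex_cnj_diff)
    finally show "wirt k q z = cnj (z $ k - y $ k)" by (simp del: complex_cnj_diff)
    have "wirt_bar k q z = (\<Sum>j\<in>UNIV. wirt_bar k (\<lambda>z. (z $ j - y $ j) * cnj (z $ j - y $ j)) z)"
      unfolding q_def by (rule wirt_sum) (rule dp)
    also have "\<dots> = (\<Sum>j\<in>UNIV. if k = j then z $ j - y $ j else 0)"
      by (rule sum.cong[OF refl]) (simp add: wirt_mult[OF dc dcc] wirt_cnj[OF dc] wc del: complex_cnj_diff)
    finally show "wirt_bar k q z = z $ k - y $ k" by simp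
  qed
  have dq: "q differentiable (at z)" for z by (rule smooth_on_differentiable[OF sq]) simp
  have daq: "(\<lambda>z. - of_real a * q z) differentiable (at z)" for z
    by (intro differentiable_mult differentiable_const dq)
  have wbE: "wirt_bar l (E a) = (\<lambda>z. E a z * (- of_real a * (z $ l - y $ l)))"
    unfolding E by (rule ext) (simp only: wirt_compose[OF DERIV_exp daq] wirt_cmult[OF dq] wq)
  have wE: "wirt k (E a) z = E a z * (- of_real a * cnj (z $ k - y $ k))"
    unfolding E by (simp only: wirt_compose[OF DERIV_exp daq] wirt_cmult[OF dq] wq)
  have dE: "E a differentiable (at z)" by (rule smooth_on_differentiable[OF sE]) simp
  have "wirt k (wirt_bar l (E a)) z = wirt k (E a) z * (- of_real a * (z $ l - y $ l))
      + E a z * wirt k (\<lambda>z. - of_real a * (z $ l - y $ l)) z"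
    unfolding wbE by (rule wirt_mult) (intro dE differentiable_mult differentiable_const dc)+
  also have "wirt k (\<lambda>z. - of_real a * (z $ l - y $ l)) z = - of_real a * (if k = l then 1 else 0)"
    unfolding wirt_cmult[OF dc] wc ..
  finally show "wirt k (wirt_bar l (E a)) z
      = E a z * (of_real (a\<^sup>2) * ((z $ l - y $ l) * cnj (z $ k - y $ k)) - (if k = l then of_real a else 0))"
    unfolding wE by (cases "k = l") (simp_all add: algebra_simps power2_eq_square)
qed

context hermitian_chart
begin

lemma chern_laplacian_add:
  assumes "smooth_on U u" "smooth_on U v" "z \<in> U"
  shows "chern_laplacian G (\<lambda>z. u z + c * v z) z = chern_laplacian G u z + c * chern_laplacian G v z"
proof -
  have "wirt k (wirt_bar l (\<lambda>z. u z + c * v z)) z = wirt k (wirt_bar l u) z + c * wirt k (wirt_bar l v) z" for k l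
  proof -
    have "wirt k (wirt_bar l (\<lambda>z. u z + c * v z)) z = wirt k (\<lambda>z. wirt_bar l u z + c * wirt_bar l v z) z"
      using assms by (intro wirt_cong_open[OF open_U assms(3)])
        (simp add: wirt_add wirt_cmult smooth_on_differentiable)
    also have "\<dots> = wirt k (wirt_bar l u) z + c * wirt k (wirt_bar l v) z"
      using smooth_on_differentiable[OF smooth_on_wirt_bar[OF open_U assms(1)] assms(3)]
        smooth_on_differentiable[OF smooth_on_wirt_bar[OF open_U assms(2)] assms(3)]
      by (simp add: wirt_add wirt_cmult)
    finally show ?thesis .
  qed
  then show ?thesis
    unfolding chern_laplacian_def by (simp add: sum_2 algebra_simps)
qed

text \<open>The Laplacian of the Gaussian is the Gaussian times a^2 c - a T, where \<open>c\<close>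
  is the squared length of \<open>z - y\<close> in the inverse metric and \<open>T\<close> its
  trace. As \<open>c\<close> is positive at \<open>x\<close>, a large \<open>a\<close> makes the
  quadratic term win near \<open>x\<close>.\<close>

lemma barrier:
  assumes "x \<in> U" "x \<noteq> y"
  shows "\<exists>a>0. \<exists>r>0. \<forall>z\<in>ball x r.
    0 < Re (chern_laplacian G (\<lambda>z. complex_of_real (exp (- a * (dist z y)\<^sup>2))) z)"
proof -
  define c where "c z = Re (\<Sum>k\<in>UNIV. \<Sum>l\<in>UNIV. matrix_inv (G z) $ l $ k * (cnj (z $ k - y $ k) * (z $ l - y $ l)))" for z
  define T where "T z = Re (\<Sum>k\<in>UNIV. matrix_inv (G z) $ k $ k)" for z
  have coord: "smooth_on U (\<lambda>z. z $ k - y $ k)" for k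
    by (intro smooth_on_diff smooth_on_const open_U smooth_on_subset[OF smooth_on_coordinate subset_UNIV])
  have cont: "continuous_on U c" "continuous_on U T"
    unfolding c_def T_def
    by (intro continuous_on_Re smooth_on_continuous_on smooth_on_sum smooth_on_mult smooth_on_cnj coord smooth_H open_U)+
  have c0: "c x > 0"
    using hermitian_inverse_form(2)[OF pos_G[OF assms(1)], of "x - y"] assms(2) by (simp add: c_def)
  have "isCont c x" "isCont T x" using cont assms(1) open_U by (simp_all add: continuous_on_eq_continuous_at)
  then obtain d1 d2 where d1: "d1 > 0" "\<And>z. dist z x < d1 \<Longrightarrow> dist (c z) (c x) < c x / 2"
    and d2: "d2 > 0" "\<And>z. dist z x < d2 \<Longrightarrow> dist (T z) (T x) < 1"
    using c0 unfolding continuous_at_eps_delta by (metis half_gt_zero zero_less_one)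
  \<comment> \<open>Near \<open>x\<close> the function \<open>c\<close> exceeds
    \<open>c x / 2\<close> and \<open>T\<close> stays below \<bar>T x\<bar> + 1, so this
    \<open>a\<close> gives a c > T on a whole ball.\<close>
  define a where "a = (\<bar>T x\<bar> + 1) / (c x / 2) + 1"
  have a: "a > 0" "a * (c x / 2) > \<bar>T x\<bar> + 1"
    using c0 by (simp_all add: a_def field_simps add_nonneg_pos)
  have "0 < Re (chern_laplacian G (\<lambda>z. complex_of_real (exp (- a * (dist z y)\<^sup>2))) z)"
    if z: "z \<in> ball x (min d1 d2)" for z
  proof -
    have cz: "c z > c x / 2" using d1(2)[of z] z by (auto simp: dist_commute dist_real_def abs_if split: if_splits)
    have Tz: "T z < \<bar>T x\<bar> + 1" using d2(2)[of z] z by (auto simp: dist_commute dist_real_def abs_if split: if_splits)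
    have "T z < a * c z" using cz Tz a mult_strict_left_mono[OF cz a(1)] by linarith
    then have pos: "0 < a * (a * c z - T z)" using a(1) by simp
    have "chern_laplacian G (\<lambda>z. complex_of_real (exp (- a * (dist z y)\<^sup>2))) z
        = of_real (exp (- a * (dist z y)\<^sup>2)) * (of_real (a\<^sup>2)
            * (\<Sum>k\<in>UNIV. \<Sum>l\<in>UNIV. matrix_inv (G z) $ l $ k * (cnj (z $ k - y $ k) * (z $ l - y $ l)))
            - of_real a * (\<Sum>k\<in>UNIV. matrix_inv (G z) $ k $ k))"
      unfolding chern_laplacian_def gaussian(2) by (simp add: sum_2 algebra_simps)
    then have "Re (chern_laplacian G (\<lambda>z. complex_of_real (exp (- a * (dist z y)\<^sup>2))) z)
        = exp (- a * (dist z y)\<^sup>2) * (a\<^sup>2 * c z - a * T z)"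
      by (simp add: c_def T_def del: of_real_power)
    also have "\<dots> = exp (- a * (dist z y)\<^sup>2) * (a * (a * c z - T z))"
      by (simp add: power2_eq_square algebra_simps)
    also have "\<dots> > 0" using pos by simp
    finally show ?thesis .
  qed
  then show ?thesis using a(1) d1(1) d2(1) by (intro exI[of _ a] conjI exI[of _ "min d1 d2"]) auto
qed

text \<open>Hopf's argument. A ball around a point where u < M is enlarged until it touches the set
  where u = M, at \<open>x0\<close>. Adding a small multiple of the barrier to \<open>u\<close>
  produces a function with an interior maximum near \<open>x0\<close> but positive Laplacian there,
  a contradiction.\<close>

lemma strong_maximum_local:
  assumes u: "smooth_on U u" and sub: "\<And>z. z \<in> U \<Longrightarrow> 0 \<le> Re (chern_laplacian G u z)"
    and max: "\<And>z. z \<in> U \<Longrightarrow> Re (u z) \<le> M" and z0: "z0 \<in> U" "Re (u z0) = M"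
  shows "\<exists>r>0. ball z0 r \<subseteq> U \<and> (\<forall>z\<in>ball z0 r. Re (u z) = M)"
proof -
  obtain r where r: "r > 0" "cball z0 r \<subseteq> U" using open_U z0(1) by (meson open_contains_cball)
  have u_cont: "continuous_on S (\<lambda>z. Re (u z))" if "S \<subseteq> U" for S
    by (intro continuous_on_Re continuous_on_subset[OF smooth_on_continuous_on[OF u] that])
  have "Re (u y) = M" if y: "y \<in> ball z0 (r / 2)" for y
  proof (rule ccontr)
    assume ne: "Re (u y) \<noteq> M"
    \<comment> \<open>As \<open>y\<close> lies within \<open>r / 2\<close> of \<open>z0\<close> and
      \<open>z0\<close> is itself in \<open>S\<close>, the point of \<open>S\<close> nearest to
      \<open>y\<close> falls inside the open ball of radius \<open>r\<close>, away from the
      artificial boundary.\<close>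
    define S where "S = {x \<in> cball z0 r. Re (u x) = M}"
    have "closed S" unfolding S_def
      using continuous_closed_preimage_constant[OF u_cont[OF r(2)] closed_cball] by simp
    moreover have "z0 \<in> S" using z0 r by (simp add: S_def)
    ultimately obtain x0 where x0: "x0 \<in> S" and x0_min: "\<And>x. x \<in> S \<Longrightarrow> dist y x0 \<le> dist y x"
      using distance_attains_inf[of S y] by blast
    define R where "R = dist y x0"
    have R_pos: "R > 0" using x0 ne by (auto simp: R_def S_def)
    have R_less: "R < r / 2" using x0_min[OF \<open>z0 \<in> S\<close>] y by (simp add: R_def dist_commute)
    have less_M: "Re (u x) < M" if "dist y x < R" for x
    proof -
      have "dist z0 x \<le> dist z0 y + dist y x" by (rule dist_triangle)
      then have "x \<in> cball z0 r" using that y R_less by simp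
      moreover have "x \<notin> S" using x0_min[of x] that by (auto simp: R_def)
      ultimately show ?thesis using max[of x] r(2) by (force simp: S_def)
    qed
    have "dist z0 x0 \<le> dist z0 y + dist y x0" by (rule dist_triangle)
    then have x0_ball: "x0 \<in> ball z0 r" using y R_less by (simp add: R_def)
    have x0_U: "x0 \<in> U" using x0_ball r(2) by auto
    \<comment> \<open>The ball around the midpoint with half the radius touches the set where \<open>u = M\<close> only at \<open>x0\<close>.\<close>
    define y' where "y' = (1/2) *\<^sub>R (x0 + y)"
    have x0y': "dist x0 y' = R / 2"
    proof -
      have "x0 - y' = (1/2) *\<^sub>R (x0 - y)" unfolding y'_def
        by (simp add: scaleR_right_diff_distrib scaleR_right_distrib)
      then show ?thesis by (simp add: dist_norm R_def norm_minus_commute)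
    qed
    have touch: "Re (u x) < M" if "dist x y' \<le> R / 2" "x \<noteq> x0" for x
    proof (rule less_M)
      define a b where "a = x - y'" and "b = (1/2) *\<^sub>R (x0 - y)"
      have b2: "b + b = x0 - y" by (simp add: b_def flip: scaleR_left.add)
      have "y' + y' = x0 + y" by (simp add: y'_def flip: scaleR_left.add)
      have half: "v = w" if "v + v = w + w" for v w :: "complex ^ 2"
        using that by (simp add: vec_eq_iff)
      have xy: "x - y = a + b"
        by (rule half) (use b2 \<open>y' + y' = x0 + y\<close> in \<open>simp add: a_def algebra_simps\<close>)
      have xx0: "x - x0 = a - b"
        by (rule half) (use b2 \<open>y' + y' = x0 + y\<close> in \<open>simp add: a_def algebra_simps\<close>)
      \<comment> \<open>The parallelogram law bounds the left side by \<open>R^2\<close>; since x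
        differs from x0, the first summand alone is strictly smaller.\<close>
      have "(norm (x - y))\<^sup>2 + (norm (x - x0))\<^sup>2 = 2 * (norm a)\<^sup>2 + 2 * (norm b)\<^sup>2"
        unfolding xy xx0 by (simp add: power2_norm_eq_inner inner_simps)
      moreover have "norm b = R / 2" by (simp add: b_def R_def dist_norm norm_minus_commute)
      moreover have "(norm a)\<^sup>2 \<le> (R / 2)\<^sup>2"
        using that(1) by (intro power_mono) (simp_all add: a_def dist_norm)
      moreover have "(norm (x - x0))\<^sup>2 > 0" using that(2) by simp
      ultimately have "(norm (x - y))\<^sup>2 < R\<^sup>2" by (simp add: power2_eq_square)
      then have "norm (x - y) < R" using R_pos by (simp add: power_less_imp_less_base)
      then show "dist y x < R" by (simp add: dist_norm norm_minus_commute)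
    qed
    have "x0 \<noteq> y'" using x0y' R_pos by auto
    from barrier[OF x0_U this] obtain a \<rho>0 where a: "a > 0" "\<rho>0 > 0"
      and bar: "\<And>z. z \<in> ball x0 \<rho>0 \<Longrightarrow> 0 < Re (chern_laplacian G (\<lambda>z. complex_of_real (exp (- a * (dist z y')\<^sup>2))) z)"
      by blast
    define E where "E z = complex_of_real (exp (- a * (dist z y')\<^sup>2))" for z
    define \<delta> where "\<delta> = exp (- a * (R / 2)\<^sup>2)"
    obtain \<rho>1 where \<rho>1: "\<rho>1 > 0" "cball x0 \<rho>1 \<subseteq> ball z0 r"
      using x0_ball by (meson open_ball open_contains_cball)
    define \<rho> where "\<rho> = min (\<rho>0 / 2) \<rho>1"
    have \<rho>: "\<rho> > 0" "cball x0 \<rho> \<subseteq> U" "cball x0 \<rho> \<subseteq> ball x0 \<rho>0"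
    proof -
      show "\<rho> > 0" using a(2) \<rho>1(1) by (simp add: \<rho>_def)
      have "cball x0 \<rho> \<subseteq> cball x0 \<rho>1" by (rule subset_cball) (simp add: \<rho>_def)
      then show "cball x0 \<rho> \<subseteq> U" using \<rho>1(2) r(2) ball_subset_cball[of z0 r] by blast
      show "cball x0 \<rho> \<subseteq> ball x0 \<rho>0" using a(2) by (auto simp: \<rho>_def)
    qed
    have E_smooth: "smooth_on U E"
      unfolding E_def by (rule smooth_on_subset[OF gaussian(1) subset_UNIV])
    \<comment> \<open>The small sphere around \<open>x0\<close> is split. On \<open>K\<close>, which
      is compact and misses \<open>x0\<close>, \<open>u\<close> stays below M by a fixed margin that
      pays for the barrier. Off \<open>K\<close> the barrier is below \<delta>, its value at
      \<open>x0\<close>. Hence the perturbed function is smaller on the sphere than at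
      \<open>x0\<close>.\<close>
    define K where "K = sphere x0 \<rho> \<inter> cball y' (R / 2)"
    have "\<exists>\<epsilon>>0. \<forall>x\<in>K. Re (u x) + \<epsilon> < M"
    proof (cases "K = {}")
      case False
      have "compact K" by (simp add: K_def compact_Int_closed)
      moreover have "K \<subseteq> U" using \<rho>(2) by (auto simp: K_def)
      ultimately obtain k where k: "k \<in> K" "\<And>x. x \<in> K \<Longrightarrow> Re (u x) \<le> Re (u k)"
        using continuous_attains_sup[OF _ False u_cont] by blast
      have "Re (u k) < M" using k(1) \<rho>(1) by (intro touch) (auto simp: K_def dist_commute)
      then show ?thesis using k(2) by (intro exI[of _ "(M - Re (u k)) / 2"]) (fastforce simp: field_simps)
    qed (auto intro: exI[of _ 1])
    then obtain \<epsilon> where \<epsilon>: "\<epsilon> > 0" "\<And>x. x \<in> K \<Longrightarrow> Re (u x) + \<epsilon> < M" by blast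
    define v where "v z = u z + of_real \<epsilon> * E z" for z
    have v_smooth: "smooth_on U v"
      unfolding v_def by (intro smooth_on_add smooth_on_mult smooth_on_const u E_smooth open_U)
    have Re_v: "Re (v z) = Re (u z) + \<epsilon> * exp (- a * (dist z y')\<^sup>2)" for z by (simp add: v_def E_def)
    have v_x0: "Re (v x0) = M + \<epsilon> * \<delta>" using x0 by (simp add: Re_v x0y' \<delta>_def S_def)
    have v_sphere: "Re (v x) < M + \<epsilon> * \<delta>" if "x \<in> sphere x0 \<rho>" for x
    proof (cases "x \<in> K")
      case True
      have "exp (- a * (dist x y')\<^sup>2) \<le> 1" using a by simp
      then have "\<epsilon> * exp (- a * (dist x y')\<^sup>2) \<le> \<epsilon> * 1" using \<epsilon>(1) by (intro mult_left_mono) auto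
      moreover have "\<epsilon> * \<delta> > 0" using \<epsilon>(1) by (simp add: \<delta>_def)
      ultimately show ?thesis using \<epsilon>(2)[OF True] by (simp add: Re_v)
    next
      case False
      then have "dist x y' > R / 2" using that by (simp add: K_def dist_commute)
      then have "(dist x y')\<^sup>2 > (R / 2)\<^sup>2" using R_pos by (intro power_strict_mono) auto
      then have "exp (- a * (dist x y')\<^sup>2) < \<delta>" using a(1) by (simp add: \<delta>_def)
      then have "\<epsilon> * exp (- a * (dist x y')\<^sup>2) < \<epsilon> * \<delta>" using \<epsilon>(1) by simp
      moreover have "Re (u x) \<le> M" using max \<rho>(2) that by auto
      ultimately show ?thesis by (simp add: Re_v)
    qed
    have "continuous_on (cball x0 \<rho>) (\<lambda>z. Re (v z))"
      by (intro continuous_on_Re continuous_on_subset[OF smooth_on_continuous_on[OF v_smooth] \<rho>(2)])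
    then obtain p where p: "p \<in> cball x0 \<rho>" "\<And>x. x \<in> cball x0 \<rho> \<Longrightarrow> Re (v x) \<le> Re (v p)"
      using continuous_attains_sup[of "cball x0 \<rho>" "\<lambda>z. Re (v z)"] \<rho>(1) by auto
    have "p \<notin> sphere x0 \<rho>" using v_sphere[of p] p(2)[of x0] v_x0 \<rho>(1) by auto
    then have "p \<in> ball x0 \<rho>" using p(1) by auto
    then obtain s where s: "s > 0" "ball p s \<subseteq> ball x0 \<rho>" by (meson open_ball open_contains_ball)
    have "Re (chern_laplacian G v p) \<le> 0"
    proof (rule chern_laplacian_at_max[OF v_smooth s(1)])
      show "ball p s \<subseteq> U" using s(2) \<rho>(2) ball_subset_cball[of x0 \<rho>] by blast
      show "Re (v x) \<le> Re (v p)" if "x \<in> ball p s" for x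
        using p(2)[of x] s(2) that ball_subset_cball[of x0 \<rho>] by blast
    qed
    moreover have pU: "p \<in> U" using p(1) \<rho>(2) by blast
    have "chern_laplacian G v p = chern_laplacian G u p + of_real \<epsilon> * chern_laplacian G E p"
      unfolding v_def by (rule chern_laplacian_add[OF u E_smooth pU])
    moreover have "0 < Re (chern_laplacian G E p)"
      unfolding E_def by (rule bar) (use p(1) \<rho>(3) in blast)
    ultimately have "Re (chern_laplacian G u p) + \<epsilon> * Re (chern_laplacian G E p) \<le> 0"
      "\<epsilon> * Re (chern_laplacian G E p) > 0"
      using \<epsilon>(1) by simp_all
    then show False using sub[OF pU] by linarith
  qed
  moreover have "ball z0 (r / 2) \<subseteq> U" using r by (auto simp: subset_iff)
  ultimately show ?thesis using r(1) by (intro exI[of _ "r / 2"]) auto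
qed

end

text \<open>Compactness provides a point of maximum. The set of maximum points is closed by
  continuity and open by the local principle in a chart, hence everything by connectedness.\<close>

lemma strong_maximum_compact:
  fixes A :: "('a::t2_space, 2) chart set" and u :: "('a, 2) chart \<Rightarrow> complex ^ 2 \<Rightarrow> complex"
  assumes atlas: "complex_atlas A" and "compact (UNIV :: 'a set)" "connected (UNIV :: 'a set)"
    and G: "\<And>c. c \<in> A \<Longrightarrow> hermitian_chart (chart_image c) (g c)"
    and u: "\<And>c. c \<in> A \<Longrightarrow> smooth_on (chart_image c) (u c)"
    and glob: "\<And>c d x. c \<in> A \<Longrightarrow> d \<in> A \<Longrightarrow> x \<in> fst c \<Longrightarrow> x \<in> fst d \<Longrightarrow> u c (snd c x) = u d (snd d x)"
    and sub: "\<And>c z. c \<in> A \<Longrightarrow> z \<in> chart_image c \<Longrightarrow> 0 \<le> Re (chern_laplacian (g c) (u c) z)"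
  shows "\<exists>M. \<forall>c\<in>A. \<forall>z\<in>chart_image c. Re (u c z) = M"
proof -
  have charts: "open (fst c)" "continuous_on (fst c) (snd c)" if "c \<in> A" for c
    using atlas that unfolding complex_atlas_def homeomorphism_def by blast+
  have "\<exists>c. c \<in> A \<and> x \<in> fst c" for x using atlas unfolding complex_atlas_def by blast
  \<comment> \<open>An arbitrary chart at every point turns the family \<open>u\<close> into one
    function on the manifold; by \<open>glob\<close> the choice does not affect its value.\<close>
  then obtain ch where ch: "\<And>x. ch x \<in> A" "\<And>x. x \<in> fst (ch x)" by metis
  define U where "U x = Re (u (ch x) (snd (ch x) x))" for x
  have U: "U x = Re (u c (snd c x))" if "c \<in> A" "x \<in> fst c" for c x
    unfolding U_def using glob[OF ch(1) that(1) ch(2) that(2)] by simp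
  have cont: "continuous_on UNIV U"
  proof (rule continuous_at_imp_continuous_on, rule ballI)
    fix x
    let ?c = "ch x"
    have "continuous_on (fst ?c) (\<lambda>x. Re (u ?c (snd ?c x)))"
      by (intro continuous_on_Re continuous_on_compose2[OF smooth_on_continuous_on[OF u] charts(2)] ch(1))
        (auto simp: chart_image_def)
    then have "continuous_on (fst ?c) U"
      by (rule continuous_on_eq) (rule U[OF ch(1), symmetric])
    then show "isCont U x"
      using charts(1)[OF ch(1)] ch(2) by (simp add: continuous_on_eq_continuous_at)
  qed
  obtain m where m: "\<And>x. U x \<le> U m"
    using continuous_attains_sup[OF assms(2) UNIV_not_empty cont] by auto
  define S where "S = {x. U x = U m}"
  have "closed S" unfolding S_def
    using cont by (intro closed_Collect_eq) auto
  moreover have "open S"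
  proof (rule Topological_Spaces.openI)
    fix x assume "x \<in> S"
    let ?c = "ch x"
    interpret hermitian_chart "chart_image ?c" "g ?c" by (rule G[OF ch(1)])
    have xz: "snd ?c x \<in> chart_image ?c" using ch(2) by (simp add: chart_image_def)
    have "\<exists>r>0. ball (snd ?c x) r \<subseteq> chart_image ?c \<and> (\<forall>z\<in>ball (snd ?c x) r. Re (u ?c z) = U m)"
    proof (rule strong_maximum_local[OF u[OF ch(1)] sub[OF ch(1)] _ xz])
      show "Re (u ?c z) \<le> U m" if "z \<in> chart_image ?c" for z
        using that m U[OF ch(1)] unfolding chart_image_def by (metis imageE)
      show "Re (u ?c (snd ?c x)) = U m" using \<open>x \<in> S\<close> U[OF ch(1) ch(2)] by (simp add: S_def)
    qed
    then obtain r where r: "r > 0" "\<And>z. z \<in> ball (snd ?c x) r \<Longrightarrow> Re (u ?c z) = U m" by blast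
    have "open (fst ?c \<inter> snd ?c -` ball (snd ?c x) r)"
      by (rule continuous_open_preimage[OF charts(2)[OF ch(1)] charts(1)[OF ch(1)] open_ball])
    moreover have "fst ?c \<inter> snd ?c -` ball (snd ?c x) r \<subseteq> S"
      using r(2) U[OF ch(1)] by (auto simp: S_def)
    moreover have "x \<in> fst ?c \<inter> snd ?c -` ball (snd ?c x) r" using ch(2) r(1) by simp
    ultimately show "\<exists>T. open T \<and> x \<in> T \<and> T \<subseteq> S" by blast
  qed
  moreover have "m \<in> S" by (simp add: S_def)
  ultimately have "S = UNIV"
    using connectedD[OF assms(3), of S "- S"] by auto
  have "Re (u c z) = U m" if cA: "c \<in> A" and zc: "z \<in> chart_image c" for c z
  proof -
    obtain x where "x \<in> fst c" "z = snd c x" using zc unfolding chart_image_def by blast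
    then show ?thesis using U[OF cA] \<open>S = UNIV\<close> unfolding S_def by (metis UNIV_I mem_Collect_eq)
  qed
  then show ?thesis by blast
qed

section \<open>Forms of low degree\<close>

lemma sum_length_0: "(\<Sum>I | length I = 0. f I) = f []"
  by simp

lemma sum_length_1: "(\<Sum>I :: 'n::finite list | length I = 1. f I) = (\<Sum>i\<in>UNIV. f [i])"
proof (rule sum.reindex_bij_witness[of _ "\<lambda>i. [i]" hd])
qed (auto simp: length_Suc_conv)

lemma sum_length_2: "(\<Sum>I :: 'n::finite list | length I = 2. f I) = (\<Sum>i\<in>UNIV. \<Sum>j\<in>UNIV. f [i, j])"
proof -
  have "(\<Sum>I :: 'n list | length I = 2. f I) = (\<Sum>(i, j)\<in>UNIV \<times> UNIV. f [i, j])"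
    by (rule sum.reindex_bij_witness[of _ "\<lambda>(i, j). [i, j]" "\<lambda>I. (I ! 0, I ! 1)"])
      (auto simp: length_Suc_conv numeral_2_eq_2)
  then show ?thesis by (simp add: sum.cartesian_product)
qed

lemma del_1: "del \<alpha> [i] J z = wirt i (\<alpha> [] J) z"
  by (simp add: del_def omit_def)

lemma del_2: "del \<alpha> [i, j] J z = wirt i (\<alpha> [j] J) z - wirt j (\<alpha> [i] J) z"
  by (simp add: del_def omit_def numeral_2_eq_2)

lemma delbar_1: "delbar \<alpha> I [j] z = (- 1) ^ length I * wirt_bar j (\<alpha> I []) z"
  by (simp add: delbar_def omit_def)

lemma delbar_2: "delbar \<alpha> I [j, l] z = (- 1) ^ length I * (wirt_bar j (\<alpha> I [l]) z - wirt_bar l (\<alpha> I [j]) z)"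
  by (simp add: delbar_def omit_def numeral_2_eq_2)

lemma fund_form_1: "fund_form G [i] [j] = (\<lambda>z. \<i> * G z $ i $ j)"
  by (simp add: fund_form_def[abs_def])

lemma form_inner_0_1:
  fixes G :: "complex ^ 'n::finite \<Rightarrow> complex ^ 'n ^ 'n"
  shows "form_inner G 0 1 \<alpha> \<beta> z
    = (\<Sum>j\<in>UNIV. \<Sum>l\<in>UNIV. \<alpha> [] [j] z * cnj (\<beta> [] [l] z) * matrix_inv (G z) $ j $ l)"
  unfolding form_inner_def sum_length_0 sum_length_1 by simp

lemma form_inner_1_0:
  fixes G :: "complex ^ 'n::finite \<Rightarrow> complex ^ 'n ^ 'n"
  shows "form_inner G 1 0 \<alpha> \<beta> z
    = (\<Sum>i\<in>UNIV. \<Sum>k\<in>UNIV. \<alpha> [i] [] z * cnj (\<beta> [k] [] z) * matrix_inv (G z) $ k $ i)"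
  unfolding form_inner_def sum_length_0 sum_length_1 by simp

lemma form_inner_1_1:
  fixes G :: "complex ^ 'n::finite \<Rightarrow> complex ^ 'n ^ 'n"
  shows "form_inner G 1 1 \<alpha> \<beta> z
    = (\<Sum>i\<in>UNIV. \<Sum>k\<in>UNIV. \<Sum>j\<in>UNIV. \<Sum>l\<in>UNIV. \<alpha> [i] [j] z * cnj (\<beta> [k] [l] z)
        * matrix_inv (G z) $ k $ i * matrix_inv (G z) $ j $ l)"
  unfolding form_inner_def sum_length_1 by simp

lemmas smooth_rules = smooth_on_sum smooth_on_add smooth_on_diff smooth_on_minus smooth_on_mult
  smooth_on_cnj smooth_on_const smooth_on_wirt smooth_on_wirt_bar

section \<open>Derivatives of the metric\<close>

text \<open>\<open>X\<close> and \<open>Y\<close> stand for the derivatives of the inverse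
  \<open>Q\<close> and of \<open>P\<close>: differentiating Q P = 1 and solving for \<open>X\<close>
  avoids the quotient formulas for the entries.\<close>

lemma matrix_inv_derivative:
  fixes P X Y :: "complex ^ 'n ^ 'n"
  assumes "P ** Q = mat 1" "X ** P + Q ** Y = 0"
  shows "X = - (Q ** Y ** Q)"
proof -
  have "X = (X ** P) ** Q" using assms(1) by (simp add: matrix_mul_assoc[symmetric])
  also have "X ** P = - (Q ** Y)" using assms(2) by (simp add: eq_neg_iff_add_eq_0)
  finally show ?thesis by (simp add: vec_eq_iff matrix_matrix_mult_def sum_negf)
qed

context hermitian_chart
begin

abbreviation H :: "complex ^ 2 \<Rightarrow> complex ^ 2 ^ 2" where "H z \<equiv> matrix_inv (G z)"
abbreviation D :: "complex ^ 2 \<Rightarrow> complex" where "D z \<equiv> det (G z)"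
abbreviation dG :: "2 \<Rightarrow> 2 \<Rightarrow> 2 \<Rightarrow> complex ^ 2 \<Rightarrow> complex" where "dG k i j \<equiv> wirt k (\<lambda>z. G z $ i $ j)"
abbreviation dbG :: "2 \<Rightarrow> 2 \<Rightarrow> 2 \<Rightarrow> complex ^ 2 \<Rightarrow> complex" where "dbG l i j \<equiv> wirt_bar l (\<lambda>z. G z $ i $ j)"
abbreviation ddG :: "2 \<Rightarrow> 2 \<Rightarrow> 2 \<Rightarrow> 2 \<Rightarrow> complex ^ 2 \<Rightarrow> complex" where
  "ddG k l i j \<equiv> wirt k (wirt_bar l (\<lambda>z. G z $ i $ j))"

lemma smooth_dG: "smooth_on U (dG k i j)" and smooth_dbG: "smooth_on U (dbG k i j)"
  by (intro smooth_on_wirt smooth_on_wirt_bar smooth_G open_U)+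

lemma G_hermitian: "z \<in> U \<Longrightarrow> cnj (G z $ i $ j) = G z $ j $ i"
  using pos_G unfolding hermitian_pos_def_def hermitian_matrix_def by metis

lemma GH: "z \<in> U \<Longrightarrow> G z ** H z = mat 1" and HG: "z \<in> U \<Longrightarrow> H z ** G z = mat 1"
proof -
  assume "z \<in> U"
  then have "invertible (G z)" using det_nz by (simp add: invertible_det_nz)
  then obtain Q where Q: "G z ** Q = mat 1" "Q ** G z = mat 1" unfolding invertible_def by blast
  then have "H z = Q" by (intro matrix_inv_unique)
  then show "G z ** H z = mat 1" "H z ** G z = mat 1" using Q by simp_all
qed

lemma HG_sum: "z \<in> U \<Longrightarrow> (\<Sum>m\<in>UNIV. H z $ i $ m * G z $ m $ n) = (if i = n then 1 else 0)"
  using HG[of z] by (simp add: vec_eq_iff matrix_matrix_mult_def mat_def)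

lemma H_hermitian:
  assumes "z \<in> U"
  shows "cnj (H z $ i $ j) = H z $ j $ i"
proof -
  obtain v w :: "complex ^ 2" where H: "\<And>k l. H z $ l $ k = v $ k * cnj (v $ l) + w $ k * cnj (w $ l)"
    by (rule matrix_inv_gram[OF pos_G[OF assms]]) blast
  show ?thesis unfolding H by (simp add: mult.commute)
qed

lemma dbG_eq: "z \<in> U \<Longrightarrow> dbG k i j z = cnj (dG k j i z)"
proof -
  assume z: "z \<in> U"
  have "dbG k i j z = wirt_bar k (\<lambda>z. cnj (G z $ j $ i)) z"
    by (rule wirt_bar_cong_open[OF open_U z]) (simp add: G_hermitian)
  then show ?thesis using wirt_cnj(2)[OF smooth_on_differentiable[OF smooth_G z]] by simp
qed

lemma dH:
  assumes z: "z \<in> U"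
  shows "wirt k (\<lambda>z. H z $ i $ j) z
      = - (\<Sum>m\<in>UNIV. \<Sum>n\<in>UNIV. H z $ i $ m * dG k m n z * H z $ n $ j)"
    and "wirt_bar k (\<lambda>z. H z $ i $ j) z
      = - (\<Sum>m\<in>UNIV. \<Sum>n\<in>UNIV. H z $ i $ m * dbG k m n z * H z $ n $ j)"
proof -
  have main: "X $ i $ j = - (\<Sum>m\<in>UNIV. \<Sum>n\<in>UNIV. H z $ i $ m * Y $ m $ n * H z $ n $ j)"
    if "\<And>i n. (\<Sum>m\<in>UNIV. X $ i $ m * G z $ m $ n + H z $ i $ m * Y $ m $ n) = 0" for X Y :: "complex ^ 2 ^ 2"
  proof -
    have "X ** G z + H z ** Y = 0"
      using that by (simp add: vec_eq_iff matrix_matrix_mult_def sum.distrib)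
    from matrix_inv_derivative[OF GH[OF z] this] have "X $ i $ j = - (H z ** Y ** H z) $ i $ j" by simp
    also have "(H z ** Y ** H z) $ i $ j = (\<Sum>m\<in>UNIV. \<Sum>n\<in>UNIV. H z $ i $ m * Y $ m $ n * H z $ n $ j)"
      by (simp add: matrix_matrix_mult_def sum_2 algebra_simps)
    finally show ?thesis .
  qed
  note dGH = smooth_on_differentiable[OF smooth_H z] smooth_on_differentiable[OF smooth_G z]
  have dp: "(\<lambda>z. H z $ i $ m * G z $ m $ n) differentiable (at z)" for i m n
    by (intro differentiable_mult dGH)
  have "(\<Sum>m\<in>UNIV. wirt k (\<lambda>z. H z $ i $ m) z * G z $ m $ n + H z $ i $ m * dG k m n z) = 0" for i n
  proof -
    have "(\<Sum>m\<in>UNIV. wirt k (\<lambda>z. H z $ i $ m) z * G z $ m $ n + H z $ i $ m * dG k m n z)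
        = wirt k (\<lambda>z. \<Sum>m\<in>UNIV. H z $ i $ m * G z $ m $ n) z"
      by (simp add: wirt_sum[OF dp] wirt_mult[OF dGH])
    also have "\<dots> = wirt k (\<lambda>z. if i = n then 1 else 0) z"
      by (rule wirt_cong_open[OF open_U z]) (rule HG_sum)
    finally show ?thesis by simp
  qed
  from main[of "\<chi> i j. wirt k (\<lambda>z. H z $ i $ j) z" "\<chi> i j. dG k i j z"] this
  show "wirt k (\<lambda>z. H z $ i $ j) z
      = - (\<Sum>m\<in>UNIV. \<Sum>n\<in>UNIV. H z $ i $ m * dG k m n z * H z $ n $ j)" by simp
  have "(\<Sum>m\<in>UNIV. wirt_bar k (\<lambda>z. H z $ i $ m) z * G z $ m $ n + H z $ i $ m * dbG k m n z) = 0" for i n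
  proof -
    have "(\<Sum>m\<in>UNIV. wirt_bar k (\<lambda>z. H z $ i $ m) z * G z $ m $ n + H z $ i $ m * dbG k m n z)
        = wirt_bar k (\<lambda>z. \<Sum>m\<in>UNIV. H z $ i $ m * G z $ m $ n) z"
      by (simp add: wirt_sum[OF dp] wirt_mult[OF dGH])
    also have "\<dots> = wirt_bar k (\<lambda>z. if i = n then 1 else 0) z"
      by (rule wirt_bar_cong_open[OF open_U z]) (rule HG_sum)
    finally show ?thesis by simp
  qed
  from main[of "\<chi> i j. wirt_bar k (\<lambda>z. H z $ i $ j) z" "\<chi> i j. dbG k i j z"] this
  show "wirt_bar k (\<lambda>z. H z $ i $ j) z
      = - (\<Sum>m\<in>UNIV. \<Sum>n\<in>UNIV. H z $ i $ m * dbG k m n z * H z $ n $ j)" by simp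
qed

text \<open>Jacobi's formula: \<open>D\<close> times \<open>H\<close> is the adjugate, so the right
  side is the linearised determinant.\<close>

lemma dD:
  assumes z: "z \<in> U"
  shows "wirt k D z = D z * (\<Sum>m\<in>UNIV. \<Sum>n\<in>UNIV. H z $ n $ m * dG k m n z)"
    and "wirt_bar k D z = D z * (\<Sum>m\<in>UNIV. \<Sum>n\<in>UNIV. H z $ n $ m * dbG k m n z)"
proof -
  note d = smooth_on_differentiable[OF smooth_G z]
  have dp: "(\<lambda>z. G z $ i $ j * G z $ m $ n) differentiable (at z)" for i j m n
    by (intro differentiable_mult d)
  have DH: "D z * H z $ 1 $ 1 = G z $ 2 $ 2" "D z * H z $ 1 $ 2 = - G z $ 1 $ 2"
    "D z * H z $ 2 $ 1 = - G z $ 2 $ 1" "D z * H z $ 2 $ 2 = G z $ 1 $ 1"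
    using matrix_inv_2[OF det_nz[OF z]] det_nz[OF z] by simp_all
  have "D z * (\<Sum>m\<in>UNIV. \<Sum>n\<in>UNIV. H z $ n $ m * E m n)
      = G z $ 2 $ 2 * E 1 1 - G z $ 2 $ 1 * E 1 2 - G z $ 1 $ 2 * E 2 1 + G z $ 1 $ 1 * E 2 2" for E
    unfolding sum_2 distrib_left mult.assoc[symmetric] DH by simp
  note E = this
  have "wirt k D z = wirt k (\<lambda>z. G z $ 1 $ 1 * G z $ 2 $ 2 - G z $ 1 $ 2 * G z $ 2 $ 1) z"
    by (simp add: det_2)
  also have "\<dots> = D z * (\<Sum>m\<in>UNIV. \<Sum>n\<in>UNIV. H z $ n $ m * dG k m n z)"
    unfolding E wirt_diff[OF dp dp] wirt_mult[OF d d] by (simp add: algebra_simps)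
  finally show "wirt k D z = D z * (\<Sum>m\<in>UNIV. \<Sum>n\<in>UNIV. H z $ n $ m * dG k m n z)" .
  have "wirt_bar k D z = wirt_bar k (\<lambda>z. G z $ 1 $ 1 * G z $ 2 $ 2 - G z $ 1 $ 2 * G z $ 2 $ 1) z"
    by (simp add: det_2)
  also have "\<dots> = D z * (\<Sum>m\<in>UNIV. \<Sum>n\<in>UNIV. H z $ n $ m * dbG k m n z)"
    unfolding E wirt_diff[OF dp dp] wirt_mult[OF d d] by (simp add: algebra_simps)
  finally show "wirt_bar k D z = D z * (\<Sum>m\<in>UNIV. \<Sum>n\<in>UNIV. H z $ n $ m * dbG k m n z)" .
qed

text \<open>The trace of the torsion of the Chern connection. Its conjugate is written through
  \<open>\<partial>\<close>bar-derivatives of \<open>g\<close> so that it can be differentiated directly.\<close>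

definition tau :: "2 \<Rightarrow> complex ^ 2 \<Rightarrow> complex" where
  "tau i z = (\<Sum>n\<in>UNIV. \<Sum>k\<in>UNIV. H z $ n $ k * (dG i k n z - dG k i n z))"

definition tau_bar :: "2 \<Rightarrow> complex ^ 2 \<Rightarrow> complex" where
  "tau_bar j z = (\<Sum>n\<in>UNIV. \<Sum>k\<in>UNIV. H z $ k $ n * (dbG j n k z - dbG k n j z))"

lemma smooth_tau: "smooth_on U (tau i)"
  unfolding tau_def[abs_def] by (intro smooth_rules smooth_H smooth_G open_U)

lemma smooth_tau_bar: "smooth_on U (tau_bar i)"
  unfolding tau_bar_def[abs_def] by (intro smooth_rules smooth_H smooth_G open_U)

lemma tau_bar_eq: "z \<in> U \<Longrightarrow> tau_bar j z = cnj (tau j z)"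
  unfolding tau_def tau_bar_def by (simp add: H_hermitian dbG_eq)

text \<open>The source of the torsion in the formal adjoints: moving a derivative off a test form
  makes it fall on the density \<open>D\<close> times \<open>H\<close>, and the resulting divergence
  is a trace of torsion, zero if the torsion vanishes.\<close>

lemma divergence_DH:
  assumes z: "z \<in> U"
  shows "(\<Sum>k\<in>UNIV. wirt k (\<lambda>z. D z * H z $ j $ k) z) = D z * (\<Sum>l\<in>UNIV. tau l z * H z $ j $ l)"
    and "(\<Sum>k\<in>UNIV. wirt_bar k (\<lambda>z. D z * H z $ k $ j) z) = D z * (\<Sum>l\<in>UNIV. tau_bar l z * H z $ l $ j)"
proof -
  note d = smooth_on_differentiable[OF smooth_det z] smooth_on_differentiable[OF smooth_H z]
  show "(\<Sum>k\<in>UNIV. wirt k (\<lambda>z. D z * H z $ j $ k) z) = D z * (\<Sum>l\<in>UNIV. tau l z * H z $ j $ l)"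
    unfolding wirt_mult[OF d] dD[OF z] dH[OF z] tau_def by (simp add: sum_2 algebra_simps)
  show "(\<Sum>k\<in>UNIV. wirt_bar k (\<lambda>z. D z * H z $ k $ j) z) = D z * (\<Sum>l\<in>UNIV. tau_bar l z * H z $ l $ j)"
    unfolding wirt_mult[OF d] dD[OF z] dH[OF z] tau_bar_def by (simp add: sum_2 algebra_simps)
qed

section \<open>The formal adjoints on the fundamental form\<close>

text \<open>Pairing with \<omega> is taking the metric trace: \<open>G\<close> cancels one of the
  two inverse metrics.\<close>

lemma form_inner_fund_form:
  assumes z: "z \<in> U"
  shows "form_inner G 1 1 \<alpha> (fund_form G) z = - \<i> * (\<Sum>i\<in>UNIV. \<Sum>j\<in>UNIV. \<alpha> [i] [j] z * H z $ j $ i)"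
proof -
  have HGH: "(\<Sum>k\<in>UNIV. \<Sum>l\<in>UNIV. G z $ l $ k * H z $ k $ i * H z $ j $ l) = H z $ j $ i" for i j
  proof -
    have "(\<Sum>k\<in>UNIV. \<Sum>l\<in>UNIV. G z $ l $ k * H z $ k $ i * H z $ j $ l)
        = (\<Sum>k\<in>UNIV. (\<Sum>l\<in>UNIV. H z $ j $ l * G z $ l $ k) * H z $ k $ i)"
      by (simp add: sum_2 algebra_simps)
    also have "\<dots> = H z $ j $ i" unfolding HG_sum[OF z] by (simp add: if_distrib[of "\<lambda>x. x * _"] cong: if_cong)
    finally show ?thesis .
  qed
  have "form_inner G 1 1 \<alpha> (fund_form G) z
      = - \<i> * (\<Sum>i\<in>UNIV. \<Sum>j\<in>UNIV. \<alpha> [i] [j] z * (\<Sum>k\<in>UNIV. \<Sum>l\<in>UNIV. G z $ l $ k * H z $ k $ i * H z $ j $ l))"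
    unfolding form_inner_1_1 fund_form_1 complex_cnj_mult G_hermitian[OF z] by (simp add: sum_2 algebra_simps)
  then show ?thesis unfolding HGH .
qed

text \<open>Integration by parts against the trace of \<open>del \<phi>\<close>. The pairing
  conjugates its second argument, so the integrand shows \<open>tau\<close> where the adjoint itself
  carries \<open>tau_bar\<close>.\<close>

lemma adjoint_del_fund_form:
  assumes \<phi>: "test_form U 0 1 \<phi>"
  shows "L2_inner U G 1 1 (del \<phi>) (fund_form G) = L2_inner U G 0 1 \<phi> (\<lambda>I J z. - \<i> * tau_bar (hd J) z)"
proof -
  obtain K where K: "compact K" "K \<subseteq> U" and \<phi>0: "\<And>j z. z \<in> U - K \<Longrightarrow> \<phi> [] [j] z = 0"
    using \<phi> unfolding test_form_def vanishes_on_def by auto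
  have s\<phi>: "smooth_on U (\<phi> [] [j])" for j
    using \<phi> unfolding test_form_def local_form_def by auto
  \<comment> \<open>A compactly supported vector density: its divergence is the trace of the
    derivatives of \<phi> plus a zeroth order term, and it integrates to zero.\<close>
  define X where "X i z = (\<Sum>j\<in>UNIV. \<phi> [] [j] z * (D z * H z $ j $ i))" for i z
  have sX: "smooth_on U (X i)" for i
    unfolding X_def[abs_def] by (intro smooth_rules s\<phi> smooth_det smooth_H open_U)
  have X0: "X i z = 0" if "z \<in> U - K" for i z using \<phi>0[OF that] by (simp add: X_def)
  \<comment> \<open>The zeroth order term that is left over; the 4 is \<open>2 ^ CARD(2)\<close>
    from the volume form.\<close>
  define F where "F z = 4 * \<i> * (D z * (\<Sum>j\<in>UNIV. \<Sum>l\<in>UNIV. \<phi> [] [j] z * tau l z * H z $ j $ l))" for z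
  have sF: "smooth_on U F"
    unfolding F_def[abs_def] by (intro smooth_rules s\<phi> smooth_det smooth_H smooth_tau open_U)
  have iF: "set_integrable lborel U F"
    by (rule set_integrable_compact_support[OF K smooth_on_continuous_on[OF sF]]) (simp add: F_def \<phi>0)
  note iX = set_integral_wirt(1,2)[OF open_U K sX X0]
  have div: "(\<Sum>i\<in>UNIV. wirt i (X i) z) = D z * (\<Sum>i\<in>UNIV. \<Sum>j\<in>UNIV. wirt i (\<phi> [] [j]) z * H z $ j $ i)
      + D z * (\<Sum>j\<in>UNIV. \<Sum>l\<in>UNIV. \<phi> [] [j] z * tau l z * H z $ j $ l)" if z: "z \<in> U" for z
  proof -
    have dDH: "(\<lambda>z. D z * H z $ j $ i) differentiable (at z)" for i j
      by (intro differentiable_mult smooth_on_differentiable[OF smooth_det z] smooth_on_differentiable[OF smooth_H z])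
    have dp: "(\<lambda>z. \<phi> [] [j] z * (D z * H z $ j $ i)) differentiable (at z)" for i j
      by (intro differentiable_mult dDH smooth_on_differentiable[OF s\<phi> z])
    have "(\<Sum>i\<in>UNIV. wirt i (X i) z) = (\<Sum>i\<in>UNIV. \<Sum>j\<in>UNIV. wirt i (\<phi> [] [j]) z * (D z * H z $ j $ i)
        + \<phi> [] [j] z * wirt i (\<lambda>z. D z * H z $ j $ i) z)"
      unfolding X_def wirt_sum[OF dp] wirt_mult[OF smooth_on_differentiable[OF s\<phi> z] dDH] ..
    also have "\<dots> = D z * (\<Sum>i\<in>UNIV. \<Sum>j\<in>UNIV. wirt i (\<phi> [] [j]) z * H z $ j $ i)
        + (\<Sum>j\<in>UNIV. \<phi> [] [j] z * (\<Sum>i\<in>UNIV. wirt i (\<lambda>z. D z * H z $ j $ i) z))"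
      by (simp add: sum_2 algebra_simps)
    finally show ?thesis unfolding divergence_DH(1)[OF z] by (simp add: sum_2 algebra_simps)
  qed
  have lhs: "form_inner G 1 1 (del \<phi>) (fund_form G) z * (2 ^ CARD(2) * D z)
      = F z + (- 4 * \<i>) * (wirt 1 (X 1) z + wirt 2 (X 2) z)" if z: "z \<in> U" for z
    unfolding form_inner_fund_form[OF z] del_1 F_def
    using div[OF z] by (simp add: sum_2 algebra_simps)
  have rhs: "form_inner G 0 1 \<phi> (\<lambda>I J z. - \<i> * tau_bar (hd J) z) z * (2 ^ CARD(2) * D z) = F z" if z: "z \<in> U" for z
    unfolding form_inner_0_1 F_def by (simp add: tau_bar_eq[OF z] sum_2 algebra_simps)
  have "L2_inner U G 1 1 (del \<phi>) (fund_form G)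
      = set_lebesgue_integral lborel U (\<lambda>z. F z + (- 4 * \<i>) * (wirt 1 (X 1) z + wirt 2 (X 2) z))"
    unfolding L2_inner_def by (rule set_lebesgue_integral_cong) (use lhs open_U in auto)
  also have "\<dots> = set_lebesgue_integral lborel U F"
    using iF iX by (simp add: set_integral_add)
  also have "\<dots> = L2_inner U G 0 1 \<phi> (\<lambda>I J z. - \<i> * tau_bar (hd J) z)"
    unfolding L2_inner_def by (rule set_lebesgue_integral_cong) (use rhs open_U in auto)
  finally show ?thesis .
qed

lemma adjoint_delbar_fund_form:
  assumes \<phi>: "test_form U 1 0 \<phi>"
  shows "L2_inner U G 1 1 (delbar \<phi>) (fund_form G) = L2_inner U G 1 0 \<phi> (\<lambda>I J z. \<i> * tau (hd I) z)"
proof -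
  obtain K where K: "compact K" "K \<subseteq> U" and \<phi>0: "\<And>j z. z \<in> U - K \<Longrightarrow> \<phi> [j] [] z = 0"
    using \<phi> unfolding test_form_def vanishes_on_def by auto
  have s\<phi>: "smooth_on U (\<phi> [j] [])" for j
    using \<phi> unfolding test_form_def local_form_def by auto
  define X where "X j z = (\<Sum>i\<in>UNIV. \<phi> [i] [] z * (D z * H z $ j $ i))" for j z
  have sX: "smooth_on U (X i)" for i
    unfolding X_def[abs_def] by (intro smooth_rules s\<phi> smooth_det smooth_H open_U)
  have X0: "X i z = 0" if "z \<in> U - K" for i z using \<phi>0[OF that] by (simp add: X_def)
  define F where "F z = - (4 * \<i> * (D z * (\<Sum>i\<in>UNIV. \<Sum>l\<in>UNIV. \<phi> [i] [] z * tau_bar l z * H z $ l $ i)))" for z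
  have sF: "smooth_on U F"
    unfolding F_def[abs_def] by (intro smooth_rules s\<phi> smooth_det smooth_H smooth_tau_bar open_U)
  have iF: "set_integrable lborel U F"
    by (rule set_integrable_compact_support[OF K smooth_on_continuous_on[OF sF]]) (simp add: F_def \<phi>0)
  note iX = set_integral_wirt(3,4)[OF open_U K sX X0]
  have div: "(\<Sum>j\<in>UNIV. wirt_bar j (X j) z) = D z * (\<Sum>i\<in>UNIV. \<Sum>j\<in>UNIV. wirt_bar j (\<phi> [i] []) z * H z $ j $ i)
      + D z * (\<Sum>i\<in>UNIV. \<Sum>l\<in>UNIV. \<phi> [i] [] z * tau_bar l z * H z $ l $ i)" if z: "z \<in> U" for z
  proof -
    have dDH: "(\<lambda>z. D z * H z $ j $ i) differentiable (at z)" for i j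
      by (intro differentiable_mult smooth_on_differentiable[OF smooth_det z] smooth_on_differentiable[OF smooth_H z])
    have dp: "(\<lambda>z. \<phi> [i] [] z * (D z * H z $ j $ i)) differentiable (at z)" for i j
      by (intro differentiable_mult dDH smooth_on_differentiable[OF s\<phi> z])
    have "(\<Sum>j\<in>UNIV. wirt_bar j (X j) z) = (\<Sum>j\<in>UNIV. \<Sum>i\<in>UNIV. wirt_bar j (\<phi> [i] []) z * (D z * H z $ j $ i)
        + \<phi> [i] [] z * wirt_bar j (\<lambda>z. D z * H z $ j $ i) z)"
      unfolding X_def wirt_sum[OF dp] wirt_mult[OF smooth_on_differentiable[OF s\<phi> z] dDH] ..
    also have "\<dots> = D z * (\<Sum>i\<in>UNIV. \<Sum>j\<in>UNIV. wirt_bar j (\<phi> [i] []) z * H z $ j $ i)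
        + (\<Sum>i\<in>UNIV. \<phi> [i] [] z * (\<Sum>j\<in>UNIV. wirt_bar j (\<lambda>z. D z * H z $ j $ i) z))"
      by (simp add: sum_2 algebra_simps)
    finally show ?thesis unfolding divergence_DH(2)[OF z] by (simp add: sum_2 algebra_simps)
  qed
  have lhs: "form_inner G 1 1 (delbar \<phi>) (fund_form G) z * (2 ^ CARD(2) * D z)
      = F z + (4 * \<i>) * (wirt_bar 1 (X 1) z + wirt_bar 2 (X 2) z)" if z: "z \<in> U" for z
    unfolding form_inner_fund_form[OF z] delbar_1 F_def
    using div[OF z] by (simp add: sum_2 algebra_simps)
  have rhs: "form_inner G 1 0 \<phi> (\<lambda>I J z. \<i> * tau (hd I) z) z * (2 ^ CARD(2) * D z) = F z" if z: "z \<in> U" for z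
    unfolding form_inner_1_0 F_def by (simp add: tau_bar_eq[OF z] sum_2 algebra_simps)
  have "L2_inner U G 1 1 (delbar \<phi>) (fund_form G)
      = set_lebesgue_integral lborel U (\<lambda>z. F z + (4 * \<i>) * (wirt_bar 1 (X 1) z + wirt_bar 2 (X 2) z))"
    unfolding L2_inner_def by (rule set_lebesgue_integral_cong) (use lhs open_U in auto)
  also have "\<dots> = set_lebesgue_integral lborel U F"
    using iF iX by (simp add: set_integral_add)
  also have "\<dots> = L2_inner U G 1 0 \<phi> (\<lambda>I J z. \<i> * tau (hd I) z)"
    unfolding L2_inner_def by (rule set_lebesgue_integral_cong) (use rhs open_U in auto)
  finally show ?thesis .
qed

text \<open>To be applied to the difference \<delta> of two adjoints of the same form, or its
  conjugate: the integrand is a bump times the squared norm of \<delta> times the volume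
  density.\<close>

lemma eq_0_if_orthogonal_to_bumps:
  fixes \<delta> :: "2 \<Rightarrow> complex ^ 2 \<Rightarrow> complex"
  assumes s: "\<And>j. smooth_on U (\<delta> j)"
    and int: "\<And>\<eta> K. smooth_on UNIV \<eta> \<Longrightarrow> compact K \<Longrightarrow> K \<subseteq> U \<Longrightarrow> (\<And>z. z \<notin> K \<Longrightarrow> \<eta> z = 0) \<Longrightarrow>
      set_lebesgue_integral lborel U (\<lambda>z. \<eta> z * (4 * D z * (\<Sum>k\<in>UNIV. \<Sum>l\<in>UNIV. H z $ l $ k * (cnj (\<delta> k z) * \<delta> l z)))) = 0"
    and z: "z \<in> U"
  shows "\<delta> j z = 0"
proof -
  define h where "h z = 4 * D z * (\<Sum>k\<in>UNIV. \<Sum>l\<in>UNIV. H z $ l $ k * (cnj (\<delta> k z) * \<delta> l z))" for z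
  define x where "x z = (\<chi> k. \<delta> k z)" for z
  have hx: "h z = 4 * D z * (\<Sum>k\<in>UNIV. \<Sum>l\<in>UNIV. H z $ l $ k * (cnj (x z $ k) * x z $ l))" for z
    by (simp add: h_def x_def)
  have h_real: "h z = of_real (4 * Re (D z) * Re (\<Sum>k\<in>UNIV. \<Sum>l\<in>UNIV. H z $ l $ k * (cnj (x z $ k) * x z $ l)))"
    if "z \<in> U" for z
    unfolding hx by (subst hermitian_pos_def_det(1)[OF pos_G[OF that]], subst hermitian_inverse_form(3)[OF pos_G[OF that]])
      (simp only: of_real_mult of_real_numeral)
  have sh: "smooth_on U h" unfolding h_def[abs_def]
    by (intro smooth_rules s smooth_det smooth_H open_U)
  have "h z = 0"
  proof (rule eq_0_if_bump_integrals_eq_0[where U = U and h = h and a = z])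
    show "open U" "continuous_on U h" "z \<in> U"
      by (rule open_U smooth_on_continuous_on[OF sh] z)+
    show "h z = of_real (Re (h z))" if "z \<in> U" for z unfolding h_real[OF that] Re_complex_of_real ..
    show "0 \<le> Re (h z)" if "z \<in> U" for z
      unfolding h_real[OF that] Re_complex_of_real
      using hermitian_pos_def_det(2)[OF pos_G[OF that]] hermitian_inverse_form(1)[OF pos_G[OF that]]
      by (intro mult_nonneg_nonneg) auto
    show "set_lebesgue_integral lborel U (\<lambda>z. \<eta> z * h z) = 0"
      if "smooth_on UNIV \<eta>" "compact K" "K \<subseteq> U" "\<And>z. z \<notin> K \<Longrightarrow> \<eta> z = 0" for \<eta> K
      unfolding h_def by (rule int[OF that])
  qed
  then have "Re (\<Sum>k\<in>UNIV. \<Sum>l\<in>UNIV. H z $ l $ k * (cnj (x z $ k) * x z $ l)) = 0"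
    unfolding h_real[OF z] using hermitian_pos_def_det(2)[OF pos_G[OF z]]
    by (simp only: of_real_eq_0_iff mult_eq_0_iff) auto
  then have "x z = 0" using hermitian_inverse_form(2)[OF pos_G[OF z], of "x z"] by force
  then show ?thesis by (simp add: x_def vec_eq_iff)
qed

lemma set_integrable_test:
  assumes "smooth_on UNIV \<eta>" "compact K" "K \<subseteq> U" "\<And>z. z \<notin> K \<Longrightarrow> \<eta> z = 0" "smooth_on U f"
  shows "set_integrable lborel U (\<lambda>z. \<eta> z * f z)"
proof (rule set_integrable_compact_support[OF assms(2,3)])
  show "continuous_on U (\<lambda>z. \<eta> z * f z)"
    by (intro smooth_on_continuous_on smooth_on_mult open_U assms smooth_on_subset[OF assms(1) subset_UNIV])
qed (use assms(4) in auto)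

text \<open>The form found by integration by parts shows that an adjoint exists, so the one chosen
  by \<open>SOME\<close> is an adjoint as well. Testing against a bump times the difference of the
  two shows that they agree on the chart.\<close>

lemma del_star_fund_form:
  assumes "z \<in> U"
  shows "del_star U G 1 1 (fund_form G) [] [m] z = - \<i> * tau_bar m z"
proof -
  let ?\<beta> = "\<lambda>I J z. - \<i> * tau_bar (hd J) z"
  let ?P = "\<lambda>\<beta>. local_form U (1 - 1) 1 \<beta> \<and> (\<forall>\<phi>. test_form U (1 - 1) 1 \<phi> \<longrightarrow>
        L2_inner U G 1 1 (del \<phi>) (fund_form G) = L2_inner U G (1 - 1) 1 \<phi> \<beta>)"
  define \<beta> where "\<beta> = del_star U G 1 1 (fund_form G)"
  have "?P ?\<beta>"
    using adjoint_del_fund_form smooth_tau_bar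
    by (auto simp: local_form_def intro!: smooth_on_mult smooth_on_minus smooth_on_const open_U)
  then have "?P (Eps ?P)" by (rule someI[where P = ?P])
  then have "?P \<beta>" unfolding \<beta>_def del_star_def .
  then have \<beta>: "\<And>j. smooth_on U (\<beta> [] [j])"
    "\<And>\<phi>. test_form U 0 1 \<phi> \<Longrightarrow> L2_inner U G 0 1 \<phi> \<beta> = L2_inner U G 0 1 \<phi> ?\<beta>"
    using adjoint_del_fund_form by (simp_all add: local_form_def)
  define \<delta> where "\<delta> j z = \<beta> [] [j] z - (- \<i> * tau_bar j z)" for j z
  have s\<delta>: "smooth_on U (\<delta> j)" for j
    unfolding \<delta>_def[abs_def] by (intro smooth_rules \<beta> smooth_tau_bar open_U)
  have "\<delta> m z = 0"
  proof (rule eq_0_if_orthogonal_to_bumps[OF s\<delta> _ assms])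
    fix \<eta> K assume \<eta>: "smooth_on UNIV \<eta>" "compact K" "K \<subseteq> U" "\<And>z. z \<notin> K \<Longrightarrow> \<eta> z = 0"
    have s\<eta>: "smooth_on U \<eta>" using smooth_on_subset[OF \<eta>(1) subset_UNIV] .
    \<comment> \<open>Cutting off the difference itself turns the pairing with it into a weighted
      squared norm.\<close>
    define \<phi> where "\<phi> I J z = \<eta> z * \<delta> (J ! 0) z" for I J :: "2 list" and z
    have "test_form U 0 1 \<phi>"
      unfolding test_form_def local_form_def vanishes_on_def
    proof (intro conjI exI[of _ K] allI impI)
      show "smooth_on U (\<phi> I J)" for I J
        unfolding \<phi>_def[abs_def] by (intro smooth_on_mult s\<eta> s\<delta> open_U)
    qed (use \<eta> in \<open>auto simp: \<phi>_def\<close>)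
    from \<beta>(2)[OF this] have eq: "L2_inner U G 0 1 \<phi> \<beta> - L2_inner U G 0 1 \<phi> ?\<beta> = 0" by simp
    define W where "W b z = 4 * D z * (\<Sum>j\<in>UNIV. \<Sum>l\<in>UNIV. \<delta> j z * cnj (b l z) * H z $ j $ l)"
      for b :: "2 \<Rightarrow> complex ^ 2 \<Rightarrow> complex" and z
    have L2: "L2_inner U G 0 1 \<phi> b = set_lebesgue_integral lborel U (\<lambda>z. \<eta> z * W (\<lambda>j. b [] [j]) z)" for b
      unfolding L2_inner_def form_inner_0_1 W_def \<phi>_def
      by (rule arg_cong[where f = "set_lebesgue_integral lborel U"], rule ext) (simp add: sum_2 algebra_simps)
    have int: "set_integrable lborel U (\<lambda>z. \<eta> z * W b z)" if "\<And>l. smooth_on U (b l)" for b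
      by (rule set_integrable_test[OF \<eta>])
        (auto simp: W_def[abs_def] intro!: smooth_rules s\<delta> that smooth_det smooth_H open_U)
    have "set_lebesgue_integral lborel U (\<lambda>z. \<eta> z * (4 * D z * (\<Sum>k\<in>UNIV. \<Sum>l\<in>UNIV. H z $ l $ k * (cnj (\<delta> k z) * \<delta> l z))))
      = set_lebesgue_integral lborel U (\<lambda>z. \<eta> z * W (\<lambda>j. \<beta> [] [j]) z - \<eta> z * W (\<lambda>j. ?\<beta> [] [j]) z)"
      by (rule arg_cong[where f = "set_lebesgue_integral lborel U"], rule ext)
        (simp add: W_def \<delta>_def sum_2 algebra_simps)
    also have "\<dots> = L2_inner U G 0 1 \<phi> \<beta> - L2_inner U G 0 1 \<phi> ?\<beta>"
      unfolding L2
      by (rule set_integral_diff) (intro int \<beta> smooth_rules smooth_tau_bar open_U | simp)+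
    finally show "set_lebesgue_integral lborel U (\<lambda>z. \<eta> z * (4 * D z * (\<Sum>k\<in>UNIV. \<Sum>l\<in>UNIV. H z $ l $ k * (cnj (\<delta> k z) * \<delta> l z)))) = 0"
      using eq by simp
  qed
  then show ?thesis by (simp only: \<delta>_def \<beta>_def right_minus_eq complex_cnj_zero_iff)
qed

lemma delbar_star_fund_form:
  assumes "z \<in> U"
  shows "delbar_star U G 1 1 (fund_form G) [m] [] z = \<i> * tau m z"
proof -
  let ?\<beta> = "\<lambda>I J z. \<i> * tau (hd I) z"
  let ?P = "\<lambda>\<beta>. local_form U 1 (1 - 1) \<beta> \<and> (\<forall>\<phi>. test_form U 1 (1 - 1) \<phi> \<longrightarrow>
        L2_inner U G 1 1 (delbar \<phi>) (fund_form G) = L2_inner U G 1 (1 - 1) \<phi> \<beta>)"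
  define \<beta> where "\<beta> = delbar_star U G 1 1 (fund_form G)"
  have "?P ?\<beta>"
    using adjoint_delbar_fund_form smooth_tau
    by (auto simp: local_form_def intro!: smooth_on_mult smooth_on_minus smooth_on_const open_U)
  then have "?P (Eps ?P)" by (rule someI[where P = ?P])
  then have "?P \<beta>" unfolding \<beta>_def delbar_star_def .
  then have \<beta>: "\<And>j. smooth_on U (\<beta> [j] [])"
    "\<And>\<phi>. test_form U 1 0 \<phi> \<Longrightarrow> L2_inner U G 1 0 \<phi> \<beta> = L2_inner U G 1 0 \<phi> ?\<beta>"
    using adjoint_delbar_fund_form by (simp_all add: local_form_def)
  \<comment> \<open>The inner product of (1,0)-forms contracts \<open>H\<close> in the order
    opposite to that of (0,1)-forms; conjugating the difference restores the pattern of
    \<open>eq_0_if_orthogonal_to_bumps\<close>.\<close>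
  define \<delta> where "\<delta> j z = cnj (\<beta> [j] [] z - \<i> * tau j z)" for j z
  have s\<delta>: "smooth_on U (\<delta> j)" for j
    unfolding \<delta>_def[abs_def] by (intro smooth_rules \<beta> smooth_tau open_U)
  have "\<delta> m z = 0"
  proof (rule eq_0_if_orthogonal_to_bumps[OF s\<delta> _ assms])
    fix \<eta> K assume \<eta>: "smooth_on UNIV \<eta>" "compact K" "K \<subseteq> U" "\<And>z. z \<notin> K \<Longrightarrow> \<eta> z = 0"
    have s\<eta>: "smooth_on U \<eta>" using smooth_on_subset[OF \<eta>(1) subset_UNIV] .
    define \<phi> where "\<phi> I J z = \<eta> z * cnj (\<delta> (I ! 0) z)" for I J :: "2 list" and z
    have "test_form U 1 0 \<phi>"
      unfolding test_form_def local_form_def vanishes_on_def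
    proof (intro conjI exI[of _ K] allI impI)
      show "smooth_on U (\<phi> I J)" for I J
        unfolding \<phi>_def[abs_def] by (intro smooth_on_mult smooth_on_cnj s\<eta> s\<delta> open_U)
    qed (use \<eta> in \<open>auto simp: \<phi>_def\<close>)
    from \<beta>(2)[OF this] have eq: "L2_inner U G 1 0 \<phi> \<beta> - L2_inner U G 1 0 \<phi> ?\<beta> = 0" by simp
    define W where "W b z = 4 * D z * (\<Sum>i\<in>UNIV. \<Sum>k\<in>UNIV. cnj (\<delta> i z) * cnj (b k z) * H z $ k $ i)"
      for b :: "2 \<Rightarrow> complex ^ 2 \<Rightarrow> complex" and z
    have L2: "L2_inner U G 1 0 \<phi> b = set_lebesgue_integral lborel U (\<lambda>z. \<eta> z * W (\<lambda>j. b [j] []) z)" for b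
      unfolding L2_inner_def form_inner_1_0 W_def \<phi>_def
      by (rule arg_cong[where f = "set_lebesgue_integral lborel U"], rule ext) (simp add: sum_2 algebra_simps)
    have int: "set_integrable lborel U (\<lambda>z. \<eta> z * W b z)" if "\<And>l. smooth_on U (b l)" for b
      by (rule set_integrable_test[OF \<eta>])
        (auto simp: W_def[abs_def] intro!: smooth_rules s\<delta> that smooth_det smooth_H open_U)
    have "set_lebesgue_integral lborel U (\<lambda>z. \<eta> z * (4 * D z * (\<Sum>k\<in>UNIV. \<Sum>l\<in>UNIV. H z $ l $ k * (cnj (\<delta> k z) * \<delta> l z))))
      = set_lebesgue_integral lborel U (\<lambda>z. \<eta> z * W (\<lambda>j. \<beta> [j] []) z - \<eta> z * W (\<lambda>j. ?\<beta> [j] []) z)"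
      by (rule arg_cong[where f = "set_lebesgue_integral lborel U"], rule ext)
        (simp add: W_def \<delta>_def sum_2 algebra_simps)
    also have "\<dots> = L2_inner U G 1 0 \<phi> \<beta> - L2_inner U G 1 0 \<phi> ?\<beta>"
      unfolding L2
      by (rule set_integral_diff) (intro int \<beta> smooth_rules smooth_tau open_U | simp)+
    finally show "set_lebesgue_integral lborel U (\<lambda>z. \<eta> z * (4 * D z * (\<Sum>k\<in>UNIV. \<Sum>l\<in>UNIV. H z $ l $ k * (cnj (\<delta> k z) * \<delta> l z)))) = 0"
      using eq by simp
  qed
  then show ?thesis by (simp only: \<delta>_def \<beta>_def right_minus_eq complex_cnj_zero_iff)
qed

end

section \<open>Curvature of pluriclosed metrics\<close>

context hermitian_chart
begin

text \<open>\<open>second_ricci\<close> contracts the Chern curvature over its form indices \<open>k\<close>, \<open>l\<close> (contracting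
  over \<open>i\<close>, \<open>j\<close> gives the Chern-Ricci form); \<open>torsion_square\<close> is the term \<open>Q\<close> of pluriclosed flow.\<close>

definition chern_curvature :: "2 \<Rightarrow> 2 \<Rightarrow> 2 \<Rightarrow> 2 \<Rightarrow> complex ^ 2 \<Rightarrow> complex" where
  "chern_curvature k l i j z =
     (\<Sum>n\<in>UNIV. \<Sum>m\<in>UNIV. dG k i n z * H z $ n $ m * dbG l m j z) - ddG k l i j z"

definition second_ricci :: "2 \<Rightarrow> 2 \<Rightarrow> complex ^ 2 \<Rightarrow> complex" where
  "second_ricci i j z = (\<Sum>k\<in>UNIV. \<Sum>l\<in>UNIV. H z $ l $ k * chern_curvature k l i j z)"

definition torsion :: "2 \<Rightarrow> 2 \<Rightarrow> 2 \<Rightarrow> complex ^ 2 \<Rightarrow> complex" where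
  "torsion i k n z = dG i k n z - dG k i n z"

definition torsion_square :: "2 \<Rightarrow> 2 \<Rightarrow> complex ^ 2 \<Rightarrow> complex" where
  "torsion_square i j z = (\<Sum>k\<in>UNIV. \<Sum>l\<in>UNIV. \<Sum>n\<in>UNIV. \<Sum>m\<in>UNIV.
     H z $ l $ k * H z $ n $ m * torsion i k n z * cnj (torsion j l m z))"

lemma ddG_commute: "z \<in> U \<Longrightarrow> wirt_bar l (dG k i j) z = ddG k l i j z"
  using wirt_commute(2)[OF open_U smooth_G] by simp

lemma wirt_bar_tau:
  assumes z: "z \<in> U"
  shows "wirt_bar j (tau i) z = (\<Sum>n\<in>UNIV. \<Sum>k\<in>UNIV.
      H z $ n $ k * (ddG i j k n z - ddG k j i n z)
      - (\<Sum>p\<in>UNIV. \<Sum>q\<in>UNIV. H z $ n $ p * dbG j p q z * H z $ q $ k) * (dG i k n z - dG k i n z))"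
proof -
  have d: "(\<lambda>z. H z $ n $ k) differentiable (at z)" "dG i k n differentiable (at z)" for i n k
    by (rule smooth_on_differentiable[OF smooth_H z] smooth_on_differentiable[OF smooth_dG z])+
  have d2: "(\<lambda>z. dG i k n z - dG k i n z) differentiable (at z)" for i k n by (intro differentiable_diff d)
  have d3: "(\<lambda>z. H z $ n $ k * (dG i k n z - dG k i n z)) differentiable (at z)" for i n k
    by (intro differentiable_mult d d2)
  have d4: "(\<lambda>z. \<Sum>k\<in>UNIV. H z $ n $ k * (dG i k n z - dG k i n z)) differentiable (at z)" for n
    by (intro differentiable_sum' d3)
  show ?thesis
    unfolding tau_def wirt_sum(2)[OF d4] wirt_sum(2)[OF d3] wirt_mult(2)[OF d(1) d2] wirt_diff(2)[OF d(2) d(2)]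
      ddG_commute[OF z] dH(2)[OF z]
    by (simp add: algebra_simps)
qed

lemma wirt_tau_bar:
  assumes z: "z \<in> U"
  shows "wirt i (tau_bar j) z = (\<Sum>n\<in>UNIV. \<Sum>k\<in>UNIV.
      H z $ k $ n * (ddG i j n k z - ddG i k n j z)
      - (\<Sum>p\<in>UNIV. \<Sum>q\<in>UNIV. H z $ k $ p * dG i p q z * H z $ q $ n) * (dbG j n k z - dbG k n j z))"
proof -
  have d: "(\<lambda>z. H z $ n $ k) differentiable (at z)" "dbG i k n differentiable (at z)" for i n k
    by (rule smooth_on_differentiable[OF smooth_H z] smooth_on_differentiable[OF smooth_dbG z])+
  have d2: "(\<lambda>z. dbG j n k z - dbG k n j z) differentiable (at z)" for n k by (intro differentiable_diff d)
  have d3: "(\<lambda>z. H z $ k $ n * (dbG j n k z - dbG k n j z)) differentiable (at z)" for n k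
    by (intro differentiable_mult d d2)
  have d4: "(\<lambda>z. \<Sum>k\<in>UNIV. H z $ k $ n * (dbG j n k z - dbG k n j z)) differentiable (at z)" for n
    by (intro differentiable_sum' d3)
  show ?thesis
    unfolding tau_bar_def wirt_sum(1)[OF d4] wirt_sum(1)[OF d3] wirt_mult(1)[OF d(1) d2] wirt_diff(1)[OF d(2) d(2)]
      dH(1)[OF z]
    by (simp add: algebra_simps)
qed

lemma wirt_bar_log_det:
  assumes z: "z \<in> U"
  shows "wirt_bar j (\<lambda>z. Ln (D z)) z = (\<Sum>m\<in>UNIV. \<Sum>n\<in>UNIV. H z $ n $ m * dbG j m n z)"
proof -
  \<comment> \<open>A positive determinant stays off the branch cut of \<open>Ln\<close>.\<close>
  have "D z \<notin> \<real>\<^sub>\<le>\<^sub>0"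
    using hermitian_pos_def_det(1,2)[OF pos_G[OF z]] by (metis complex_nonpos_Reals_iff not_less)
  then have "wirt_bar j (\<lambda>z. Ln (D z)) z = inverse (D z) * wirt_bar j D z"
    by (intro wirt_compose has_field_derivative_Ln smooth_on_differentiable[OF smooth_det z])
  then show ?thesis using det_nz[OF z] by (simp add: dD[OF z])
qed

lemma ddbar_log_det:
  assumes z: "z \<in> U"
  shows "wirt i (wirt_bar j (\<lambda>z. Ln (D z))) z = (\<Sum>m\<in>UNIV. \<Sum>n\<in>UNIV. H z $ n $ m * ddG i j m n z
      - (\<Sum>p\<in>UNIV. \<Sum>q\<in>UNIV. H z $ n $ p * dG i p q z * H z $ q $ m) * dbG j m n z)"
proof -
  have d: "(\<lambda>z. H z $ n $ k) differentiable (at z)" "dbG i k n differentiable (at z)" for i n k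
    by (rule smooth_on_differentiable[OF smooth_H z] smooth_on_differentiable[OF smooth_dbG z])+
  have d3: "(\<lambda>z. H z $ n $ m * dbG j m n z) differentiable (at z)" for n m
    by (intro differentiable_mult d)
  have d4: "(\<lambda>z. \<Sum>n\<in>UNIV. H z $ n $ m * dbG j m n z) differentiable (at z)" for m
    by (intro differentiable_sum' d3)
  have "wirt i (wirt_bar j (\<lambda>z. Ln (D z))) z = wirt i (\<lambda>z. \<Sum>m\<in>UNIV. \<Sum>n\<in>UNIV. H z $ n $ m * dbG j m n z) z"
    by (rule wirt_cong_open[OF open_U z wirt_bar_log_det])
  then show ?thesis
    unfolding wirt_sum(1)[OF d4] wirt_sum(1)[OF d3] wirt_mult(1)[OF d] dH(1)[OF z]
    by (simp add: algebra_simps)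
qed

text \<open>The formulas for the adjoints hold on the entire open chart, so they can be
  differentiated once more.\<close>

lemma bismut_ricci_matrix_eq:
  assumes z: "z \<in> U"
  shows "bismut_ricci_matrix U G z $ i $ j
    = wirt_bar j (tau i) z + wirt i (tau_bar j) z - wirt i (wirt_bar j (\<lambda>z. Ln (D z))) z"
proof -
  have 1: "del (del_star U G 1 1 (fund_form G)) [i] [j] z = - \<i> * wirt i (tau_bar j) z"
  proof -
    have "wirt i (del_star U G 1 1 (fund_form G) [] [j]) z = wirt i (\<lambda>z. - \<i> * tau_bar j z) z"
      by (rule wirt_cong_open[OF open_U z del_star_fund_form])
    then show ?thesis unfolding del_1 wirt_cmult(1)[OF smooth_on_differentiable[OF smooth_tau_bar z]] .
  qed
  have 2: "delbar (delbar_star U G 1 1 (fund_form G)) [i] [j] z = - (\<i> * wirt_bar j (tau i) z)"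
  proof -
    have "wirt_bar j (delbar_star U G 1 1 (fund_form G) [i] []) z = wirt_bar j (\<lambda>z. \<i> * tau i z) z"
      by (rule wirt_bar_cong_open[OF open_U z delbar_star_fund_form])
    then show ?thesis unfolding delbar_1 wirt_cmult(2)[OF smooth_on_differentiable[OF smooth_tau z]] by simp
  qed
  have 3: "del (delbar (log_det G)) [i] [j] z = wirt i (wirt_bar j (\<lambda>z. Ln (D z))) z"
    unfolding del_1 delbar_1[abs_def] by (simp add: log_det_def[abs_def])
  show ?thesis
    unfolding bismut_ricci_matrix_def bismut_rho_def vec_lambda_beta 1 2 3
    by (simp add: field_simps)
qed

lemma del_fund_form: "z \<in> U \<Longrightarrow> del (fund_form G) [k, i] [j] z = \<i> * torsion k i j z"
  by (simp add: del_2 fund_form_1 wirt_cmult smooth_on_differentiable[OF smooth_G] torsion_def algebra_simps)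

lemma delbar_fund_form: "z \<in> U \<Longrightarrow> delbar (fund_form G) [i] [l, j] z = - \<i> * (dbG l i j z - dbG j i l z)"
  by (simp add: delbar_2 fund_form_1 wirt_cmult smooth_on_differentiable[OF smooth_G] algebra_simps)

lemma pluriclosed_ddG:
  assumes "vanishes_on U 2 2 (del (delbar (fund_form G)))" and z: "z \<in> U"
  shows "ddG k l i j z - ddG k j i l z - ddG i l k j z + ddG i j k l z = 0"
proof -
  have d: "dbG l i j differentiable (at z)" for l i j by (rule smooth_on_differentiable[OF smooth_dbG z])
  have "wirt k (delbar (fund_form G) [i] [l, j]) z = - \<i> * (ddG k l i j z - ddG k j i l z)" for k i
  proof -
    have "wirt k (delbar (fund_form G) [i] [l, j]) z = wirt k (\<lambda>z. - \<i> * (dbG l i j z - dbG j i l z)) z"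
      by (rule wirt_cong_open[OF open_U z delbar_fund_form])
    also have "\<dots> = - \<i> * (ddG k l i j z - ddG k j i l z)"
      unfolding wirt_cmult(1)[OF differentiable_diff[OF d d]] wirt_diff(1)[OF d d] ..
    finally show ?thesis .
  qed
  moreover have "del (delbar (fund_form G)) [k, i] [l, j] z = 0"
    using assms unfolding vanishes_on_def by simp
  ultimately have "- \<i> * (ddG k l i j z - ddG k j i l z) + \<i> * (ddG i l k j z - ddG i j k l z) = 0"
    unfolding del_2 by simp
  then have "- \<i> * (ddG k l i j z - ddG k j i l z - ddG i l k j z + ddG i j k l z) = 0"
    by (simp add: algebra_simps)
  then show ?thesis by simp
qed

text \<open>For pluriclosed metrics the second order terms of \<open>\<rho>\<close> match those of the second Ricci
  curvature; what is left is a polynomial identity in \<open>g\<^sup>-\<^sup>1\<close> and the first derivatives of \<open>g\<close>.\<close>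

lemma bismut_ricci_eq_second_ricci:
  assumes "vanishes_on U 2 2 (del (delbar (fund_form G)))" and z: "z \<in> U"
  shows "bismut_ricci_matrix U G z $ i $ j = second_ricci i j z - torsion_square i j z"
proof -
  \<comment> \<open>Pluriclosedness trades the second derivative in \<open>second_ricci\<close> for
    the three that occur in \<rho>.\<close>
  have C: "ddG k l i j z = ddG k j i l z + ddG i l k j z - ddG i j k l z" for k l
    using pluriclosed_ddG[OF assms, of k l i j] by (simp add: algebra_simps)
  have T: "cnj (torsion j l m z) = dbG j m l z - dbG l m j z" for j l m
    using z by (simp add: torsion_def dbG_eq)
  show ?thesis
    unfolding bismut_ricci_matrix_eq[OF z] wirt_bar_tau[OF z] wirt_tau_bar[OF z] ddbar_log_det[OF z]
      second_ricci_def torsion_square_def chern_curvature_def T C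
    unfolding torsion_def by (simp add: sum_2 algebra_simps)
qed

end

section \<open>Bochner formulas\<close>

text \<open>\<open>S\<close> is the squared norm of \<open>E\<close> as a bilinear form: with both
  Gram matrices resolved into rank one terms it is the sum of the squares of the values
  \<open>e\<close> on four pairs of vectors. If the vectors form bases, these values determine
  \<open>E\<close>.\<close>

lemma gram_form:
  fixes v w p q :: "complex ^ 2" and E :: "2 \<Rightarrow> 2 \<Rightarrow> complex"
  assumes H: "\<And>k l. H l k = v $ k * cnj (v $ l) + w $ k * cnj (w $ l)"
    and K: "\<And>i j. K j i = p $ i * cnj (p $ j) + q $ i * cnj (q $ j)"
  defines "S \<equiv> \<Sum>k\<in>UNIV. \<Sum>l\<in>UNIV. \<Sum>i\<in>UNIV. \<Sum>j\<in>UNIV. H l k * K j i * E k i * cnj (E l j)"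
  shows "0 \<le> Re S"
    and "Re S = 0 \<Longrightarrow> v $ 1 * w $ 2 - v $ 2 * w $ 1 \<noteq> 0 \<Longrightarrow> p $ 1 * q $ 2 - p $ 2 * q $ 1 \<noteq> 0 \<Longrightarrow> E k i = 0"
proof -
  define e where "e s t = s $ 1 * (t $ 1 * E 1 1 + t $ 2 * E 1 2) + s $ 2 * (t $ 1 * E 2 1 + t $ 2 * E 2 2)"
    for s t :: "complex ^ 2"
  have "S = e v p * cnj (e v p) + e v q * cnj (e v q) + e w p * cnj (e w p) + e w q * cnj (e w q)"
    unfolding S_def H K e_def by (simp add: sum_2 algebra_simps)
  also have "\<dots> = of_real ((cmod (e v p))\<^sup>2 + (cmod (e v q))\<^sup>2 + (cmod (e w p))\<^sup>2 + (cmod (e w q))\<^sup>2)"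
    by (simp add: complex_norm_square[symmetric])
  finally have S: "Re S = (cmod (e v p))\<^sup>2 + (cmod (e v q))\<^sup>2 + (cmod (e w p))\<^sup>2 + (cmod (e w q))\<^sup>2" by simp
  then show "0 \<le> Re S" by simp
  show "E k i = 0" if "Re S = 0" and vw: "v $ 1 * w $ 2 - v $ 2 * w $ 1 \<noteq> 0" and pq: "p $ 1 * q $ 2 - p $ 2 * q $ 1 \<noteq> 0"
  proof -
    \<comment> \<open>Used twice: once to remove the basis \<open>v\<close>, \<open>w\<close>, once
      to remove \<open>p\<close>, \<open>q\<close>.\<close>
    have cramer: "x = 0 \<and> y = 0" if "a * x + b * y = 0" "c * x + d * y = 0" "a * d - b * c \<noteq> 0" for a b c d x y :: complex
    proof -
      have "(a * d - b * c) * x = d * (a * x + b * y) - b * (c * x + d * y)"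
        "(a * d - b * c) * y = a * (c * x + d * y) - c * (a * x + b * y)" by (simp_all add: algebra_simps)
      then show ?thesis using that by simp
    qed
    have "e v p = 0 \<and> e v q = 0 \<and> e w p = 0 \<and> e w q = 0"
      using that(1) unfolding S by (simp add: add_nonneg_eq_0_iff)
    then have *: "t $ 1 * E 1 1 + t $ 2 * E 1 2 = 0 \<and> t $ 1 * E 2 1 + t $ 2 * E 2 2 = 0" if "t = p \<or> t = q" for t
      using that vw unfolding e_def by (intro cramer[of "v $ 1" _ "v $ 2" _ "w $ 1" "w $ 2"]) auto
    have "E 1 1 = 0 \<and> E 1 2 = 0" "E 2 1 = 0 \<and> E 2 2 = 0"
      using *[of p] *[of q] pq by (intro cramer[of "p $ 1" _ "p $ 2" _ "q $ 1" "q $ 2"]; simp)+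
    then show ?thesis using exhaust_2[of k] exhaust_2[of i] by auto
  qed
qed

context hermitian_chart
begin

lemma torsion_antisym: "torsion k i n z = - torsion i k n z"
  by (simp add: torsion_def)

lemma torsion_diag [simp]: "torsion k k n z = 0"
  by (simp add: torsion_def)

lemma torsion_square_form:
  assumes z: "z \<in> U"
  defines "S \<equiv> \<lambda>x :: complex ^ 2. \<Sum>i\<in>UNIV. \<Sum>j\<in>UNIV. torsion_square i j z * x $ i * cnj (x $ j)"
  shows "0 \<le> Re (S x)" and "Re (S x) = 0 \<Longrightarrow> x \<noteq> 0 \<Longrightarrow> torsion i k n z = 0"
proof -
  obtain v w :: "complex ^ 2" where H: "\<And>k l. H z $ l $ k = v $ k * cnj (v $ l) + w $ k * cnj (w $ l)"
    and ne: "v $ 1 * w $ 2 - v $ 2 * w $ 1 \<noteq> 0"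
    by (rule matrix_inv_gram[OF pos_G[OF z]]) blast
  \<comment> \<open>The second factor reads \<open>H\<close> with its indices exchanged, that is,
    conjugated, so its rank one terms use the conjugate vectors.\<close>
  define p q :: "complex ^ 2" where "p = (\<chi> i. cnj (v $ i))" and "q = (\<chi> i. cnj (w $ i))"
  have H': "H z $ i $ j = p $ i * cnj (p $ j) + q $ i * cnj (q $ j)" for i j
    by (simp add: H p_def q_def mult.commute)
  have ne': "p $ 1 * q $ 2 - p $ 2 * q $ 1 \<noteq> 0"
  proof
    assume "p $ 1 * q $ 2 - p $ 2 * q $ 1 = 0"
    then have "cnj (v $ 1 * w $ 2 - v $ 2 * w $ 1) = 0" by (simp add: p_def q_def)
    then show False using ne by (simp only: complex_cnj_zero_iff)
  qed
  define X where "X k n = (\<Sum>i\<in>UNIV. x $ i * torsion i k n z)" for k n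
  have S: "S x = (\<Sum>k\<in>UNIV. \<Sum>l\<in>UNIV. \<Sum>n\<in>UNIV. \<Sum>m\<in>UNIV. H z $ l $ k * H z $ n $ m * X k n * cnj (X l m))"
    unfolding S_def torsion_square_def X_def by (simp add: sum_2 algebra_simps)
  note gram = gram_form[where H = "\<lambda>l k. H z $ l $ k" and K = "\<lambda>m n. H z $ n $ m" and E = X, OF H H']
  show "0 \<le> Re (S x)" unfolding S by (rule gram(1))
  show "torsion i k n z = 0" if "Re (S x) = 0" "x \<noteq> 0"
  proof -
    have X: "X k n = 0" for k n
      using gram(2)[OF _ ne ne'] that(1) unfolding S by blast
    \<comment> \<open>In dimension two each contraction has one surviving term, so one nonzero
      coordinate of \<open>x\<close> is enough.\<close>
    have "x $ 2 * torsion 1 2 n z = 0" "x $ 1 * torsion 1 2 n z = 0"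
      using X[of 1 n] X[of 2 n] unfolding X_def by (simp_all add: sum_2 torsion_antisym[of 2 1])
    moreover have "x $ 1 \<noteq> 0 \<or> x $ 2 \<noteq> 0" using that(2) by (auto simp: vec_eq_iff forall_2)
    ultimately have "torsion 1 2 n z = 0" by auto
    then show ?thesis using exhaust_2[of i] exhaust_2[of k] torsion_antisym[of 2 1 n z] by auto
  qed
qed

lemma ddbar_cnj_holomorphic:
  assumes s: "smooth_on U f" and h: "\<And>l z. z \<in> U \<Longrightarrow> wirt_bar l f z = 0" and z: "z \<in> U"
  shows "wirt k (\<lambda>z. cnj (f z)) z = 0" "wirt_bar l (\<lambda>z. cnj (f z)) z = cnj (wirt l f z)"
    "wirt k (\<lambda>z. cnj (wirt l f z)) z = 0"
proof -
  have *: "wirt k (\<lambda>z. cnj (f z)) z = 0" "wirt_bar l (\<lambda>z. cnj (f z)) z = cnj (wirt l f z)" if "z \<in> U" for k l z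
    using wirt_cnj[OF smooth_on_differentiable[OF s that]] h[OF that] by simp_all
  show "wirt k (\<lambda>z. cnj (f z)) z = 0" "wirt_bar l (\<lambda>z. cnj (f z)) z = cnj (wirt l f z)"
    by (rule *[OF z])+
  have "wirt_bar k (wirt l f) z = wirt l (wirt_bar k f) z"
    using wirt_commute(2)[OF open_U s z] by simp
  also have "\<dots> = wirt l (\<lambda>z. 0) z"
    by (rule wirt_cong_open[OF open_U z]) (rule h)
  finally show "wirt k (\<lambda>z. cnj (wirt l f z)) z = 0"
    using wirt_cnj(1)[OF smooth_on_differentiable[OF smooth_on_wirt[OF open_U s] z]] by simp
qed

text \<open>\<open>E\<close> is the Chern covariant derivative of \<alpha> and \<open>v\<close> its
  metric dual. The metric trace in \<Delta> contracts the form indices \<open>k\<close>,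
  \<open>l\<close> of the curvature, which is why the second Ricci curvature appears and not the
  Chern-Ricci form.\<close>

lemma bochner_1_0:
  assumes s: "\<And>i. smooth_on U (\<alpha> i)" and h: "\<And>i l z. z \<in> U \<Longrightarrow> wirt_bar l (\<alpha> i) z = 0" and z: "z \<in> U"
  defines "E \<equiv> \<lambda>k i. wirt k (\<alpha> i) z - (\<Sum>n\<in>UNIV. \<Sum>m\<in>UNIV. dG k i n z * H z $ n $ m * \<alpha> m z)"
    and "v \<equiv> \<lambda>i. \<Sum>m\<in>UNIV. H z $ i $ m * \<alpha> m z"
  shows "chern_laplacian G (\<lambda>z. \<Sum>i\<in>UNIV. \<Sum>j\<in>UNIV. H z $ j $ i * \<alpha> i z * cnj (\<alpha> j z)) z
    = (\<Sum>k\<in>UNIV. \<Sum>l\<in>UNIV. \<Sum>i\<in>UNIV. \<Sum>j\<in>UNIV. H z $ l $ k * H z $ j $ i * E k i * cnj (E l j))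
      + (\<Sum>i\<in>UNIV. \<Sum>j\<in>UNIV. second_ricci i j z * cnj (v i) * v j)"
proof -
  define u where "u z = (\<Sum>i\<in>UNIV. \<Sum>j\<in>UNIV. H z $ j $ i * \<alpha> i z * cnj (\<alpha> j z))" for z
  \<comment> \<open>\<open>E\<close> lives at the single point \<open>z\<close>; its conjugate is
    needed as a function, since it is differentiated again.\<close>
  define F where "F l j z = cnj (wirt l (\<alpha> j) z) - (\<Sum>m\<in>UNIV. \<Sum>n\<in>UNIV. cnj (\<alpha> m z) * H z $ m $ n * dbG l n j z)" for l j z
  have d: "(\<lambda>z. H z $ n $ k) differentiable (at z)" "dbG i k n differentiable (at z)"
    "\<alpha> i differentiable (at z)" "(\<lambda>z. cnj (\<alpha> i z)) differentiable (at z)"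
    "(\<lambda>z. cnj (wirt l (\<alpha> i) z)) differentiable (at z)"
    if "z \<in> U" for i n k l z
    by (rule smooth_on_differentiable[OF _ that]; intro smooth_rules smooth_H smooth_G s open_U)+
  have cs: "wirt k (\<lambda>z. cnj (\<alpha> i z)) z = 0" "wirt_bar l (\<lambda>z. cnj (\<alpha> i z)) z = cnj (wirt l (\<alpha> i) z)"
    "wirt k (\<lambda>z. cnj (wirt l (\<alpha> i) z)) z = 0" if "z \<in> U" for i k l z
    by (rule ddbar_cnj_holomorphic[OF s _ that]; rule h; assumption)+
  have u_bar: "wirt_bar l u z = (\<Sum>i\<in>UNIV. \<Sum>j\<in>UNIV. F l j z * H z $ j $ i * \<alpha> i z)" if z: "z \<in> U" for l z
  proof -
    note d' = d[OF z]
    have d2: "(\<lambda>z. H z $ j $ i * \<alpha> i z) differentiable (at z)" for i j by (intro differentiable_mult d')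
    have d3: "(\<lambda>z. H z $ j $ i * \<alpha> i z * cnj (\<alpha> j z)) differentiable (at z)" for i j by (intro differentiable_mult d2 d')
    have d4: "(\<lambda>z. \<Sum>j\<in>UNIV. H z $ j $ i * \<alpha> i z * cnj (\<alpha> j z)) differentiable (at z)" for i by (intro differentiable_sum' d3)
    show ?thesis
      unfolding u_def wirt_sum(2)[OF d4] wirt_sum(2)[OF d3] wirt_mult(2)[OF d2 d'(4)] wirt_mult(2)[OF d'(1,3)]
        h[OF z] cs(2)[OF z] dH(2)[OF z] F_def
      by (simp add: sum_2 algebra_simps)
  qed
  have FE: "F l j z = cnj (E l j)" for l j
    unfolding F_def E_def by (simp add: sum_2 H_hermitian[OF z] dbG_eq[OF z] algebra_simps)
  have cv: "cnj (v i) = (\<Sum>m\<in>UNIV. cnj (\<alpha> m z) * H z $ m $ i)" for i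
    unfolding v_def by (simp add: H_hermitian[OF z] mult.commute)
  note d' = d[OF z]
  have d1: "(\<lambda>z. cnj (\<alpha> m z) * H z $ m $ n) differentiable (at z)" for m n by (intro differentiable_mult d')
  have d2: "(\<lambda>z. cnj (\<alpha> m z) * H z $ m $ n * dbG l n j z) differentiable (at z)" for m n l j by (intro differentiable_mult d1 d')
  have d3: "(\<lambda>z. \<Sum>n\<in>UNIV. cnj (\<alpha> m z) * H z $ m $ n * dbG l n j z) differentiable (at z)" for m l j by (intro differentiable_sum' d2)
  have d4: "(\<lambda>z. \<Sum>m\<in>UNIV. \<Sum>n\<in>UNIV. cnj (\<alpha> m z) * H z $ m $ n * dbG l n j z) differentiable (at z)" for l j by (intro differentiable_sum' d3)
  have dF: "F l j differentiable (at z)" for l j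
    unfolding F_def[abs_def] by (intro differentiable_diff d' d4)
  \<comment> \<open>The conjugate components are antiholomorphic, so the derivative only meets
    \<open>H\<close> and the first derivatives of the metric; these terms make up the
    curvature.\<close>
  have wF: "wirt k (F l j) z = (\<Sum>n\<in>UNIV. cnj (v n) * chern_curvature k l n j z)" for k l j
    unfolding F_def wirt_diff(1)[OF d'(5) d4] wirt_sum(1)[OF d3] wirt_sum(1)[OF d2] wirt_mult(1)[OF d1 d'(2)] wirt_mult(1)[OF d'(4,1)]
      cs[OF z] dH(1)[OF z] cv chern_curvature_def
    by (simp add: sum_2 algebra_simps)
  have e1: "(\<lambda>z. F l j z * H z $ j $ i) differentiable (at z)" for i j l by (intro differentiable_mult dF d')
  have e2: "(\<lambda>z. F l j z * H z $ j $ i * \<alpha> i z) differentiable (at z)" for i j l by (intro differentiable_mult e1 d')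
  have e3: "(\<lambda>z. \<Sum>j\<in>UNIV. F l j z * H z $ j $ i * \<alpha> i z) differentiable (at z)" for i l by (intro differentiable_sum' e2)
  have "wirt k (wirt_bar l u) z = (\<Sum>i\<in>UNIV. \<Sum>j\<in>UNIV. H z $ j $ i * E k i * cnj (E l j))
      + (\<Sum>i\<in>UNIV. \<Sum>j\<in>UNIV. chern_curvature k l i j z * cnj (v i) * v j)" for k l
  proof -
    have "wirt k (wirt_bar l u) z = wirt k (\<lambda>z. \<Sum>i\<in>UNIV. \<Sum>j\<in>UNIV. F l j z * H z $ j $ i * \<alpha> i z) z"
      by (rule wirt_cong_open[OF open_U z u_bar])
    also have "\<dots> = (\<Sum>j\<in>UNIV. wirt k (F l j) z * v j) + (\<Sum>i\<in>UNIV. \<Sum>j\<in>UNIV. H z $ j $ i * E k i * F l j z)"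
      unfolding wirt_sum(1)[OF e3] wirt_sum(1)[OF e2] wirt_mult(1)[OF e1 d'(3)] wirt_mult(1)[OF dF d'(1)] dH(1)[OF z] E_def v_def
      by (simp add: sum_2 algebra_simps)
    finally show ?thesis unfolding wF FE by (simp add: sum_2 algebra_simps)
  qed
  note dd = this
  show ?thesis
    unfolding u_def[symmetric] chern_laplacian_def dd second_ricci_def by (simp add: sum_2 algebra_simps)
qed

text \<open>\<open>f\<close> is a section of the canonical line bundle, whose norm divides by
  \<open>D\<close>, and \<open>e\<close> is its Chern covariant derivative. The bundle curvature is
  the trace over the last two indices; tracing over the first two as well gives the trace of
  \<open>second_ricci\<close>.\<close>

lemma bochner_2_0:
  assumes s: "smooth_on U f" and h: "\<And>l z. z \<in> U \<Longrightarrow> wirt_bar l f z = 0" and z: "z \<in> U"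
  defines "e \<equiv> \<lambda>k. wirt k f z - f z * (\<Sum>m\<in>UNIV. \<Sum>n\<in>UNIV. H z $ n $ m * dG k m n z)"
  shows "chern_laplacian G (\<lambda>z. f z * cnj (f z) / D z) z
    = (\<Sum>k\<in>UNIV. \<Sum>l\<in>UNIV. H z $ l $ k * (e k * cnj (e l))) / D z
      + f z * cnj (f z) / D z * (\<Sum>i\<in>UNIV. \<Sum>j\<in>UNIV. H z $ j $ i * second_ricci i j z)"
proof -
  define u where "u z = f z * cnj (f z) / D z" for z
  define L where "L l z = (\<Sum>m\<in>UNIV. \<Sum>n\<in>UNIV. H z $ n $ m * dbG l m n z)" for l z
  define F where "F l z = cnj (wirt l f z) - cnj (f z) * L l z" for l z
  have sL: "smooth_on U (L l)" for l unfolding L_def[abs_def] by (intro smooth_rules smooth_H smooth_G open_U)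
  have d: "f differentiable (at z)" "(\<lambda>z. cnj (f z)) differentiable (at z)"
    "(\<lambda>z. cnj (wirt l f z)) differentiable (at z)" "L l differentiable (at z)" "D differentiable (at z)"
    if "z \<in> U" for l z
    by (rule smooth_on_differentiable[OF _ that]; intro smooth_rules sL smooth_det s open_U)+
  have cs: "wirt k (\<lambda>z. cnj (f z)) z = 0" "wirt_bar l (\<lambda>z. cnj (f z)) z = cnj (wirt l f z)"
    "wirt k (\<lambda>z. cnj (wirt l f z)) z = 0" if "z \<in> U" for k l z
    by (rule ddbar_cnj_holomorphic[OF s _ that]; rule h; assumption)+
  have u_bar: "wirt_bar l u z = f z * inverse (D z) * F l z" if z: "z \<in> U" for l z
  proof -
    note d' = d[OF z]
    have i: "(\<lambda>z. inverse (D z)) differentiable (at z)" by (rule differentiable_inverse_at[OF d'(5) det_nz[OF z]])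
    have d2: "(\<lambda>z. f z * cnj (f z)) differentiable (at z)" by (intro differentiable_mult d')
    have Dbar: "wirt_bar l D z = D z * L l z" unfolding dD[OF z] L_def ..
    show ?thesis
      unfolding u_def divide_inverse wirt_mult(2)[OF d2 i] wirt_mult(2)[OF d'(1,2)] wirt_inverse(2)[OF d'(5) det_nz[OF z]]
        h[OF z] cs(2)[OF z] F_def Dbar
      using det_nz[OF z] by (simp add: field_simps power2_eq_square)
  qed
  note d' = d[OF z]
  have i: "(\<lambda>z. inverse (D z)) differentiable (at z)" by (rule differentiable_inverse_at[OF d'(5) det_nz[OF z]])
  have d2: "(\<lambda>z. cnj (f z) * L l z) differentiable (at z)" for l by (intro differentiable_mult d')
  have dF: "F l differentiable (at z)" for l unfolding F_def[abs_def] by (intro differentiable_diff d' d2)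
  have fi: "(\<lambda>z. f z * inverse (D z)) differentiable (at z)" by (intro differentiable_mult d' i)
  have FE: "F l z = cnj (e l)" for l
    unfolding F_def e_def L_def by (simp add: H_hermitian[OF z] dbG_eq[OF z] sum_2 algebra_simps)
  have wL: "wirt k (L l) z = - (\<Sum>m\<in>UNIV. \<Sum>n\<in>UNIV. H z $ n $ m * chern_curvature k l m n z)" for k l
  proof -
    have "wirt k (L l) z = wirt k (wirt_bar l (\<lambda>z. Ln (D z))) z"
      by (rule wirt_cong_open[OF open_U z]) (simp add: wirt_bar_log_det L_def)
    then show ?thesis unfolding ddbar_log_det[OF z] chern_curvature_def by (simp add: sum_2 algebra_simps)
  qed
  have wF: "wirt k (F l) z = cnj (f z) * (\<Sum>m\<in>UNIV. \<Sum>n\<in>UNIV. H z $ n $ m * chern_curvature k l m n z)" for k l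
    unfolding F_def wirt_diff(1)[OF d'(3) d2] wirt_mult(1)[OF d'(2,4)] cs[OF z] wL by simp
  have wfi: "wirt k (\<lambda>z. f z * inverse (D z)) z = e k / D z" for k
    unfolding wirt_mult(1)[OF d'(1) i] wirt_inverse(1)[OF d'(5) det_nz[OF z]] dD[OF z] e_def
    using det_nz[OF z] by (simp add: field_simps power2_eq_square)
  have dd: "wirt k (wirt_bar l u) z = e k * cnj (e l) / D z
      + f z * cnj (f z) / D z * (\<Sum>m\<in>UNIV. \<Sum>n\<in>UNIV. H z $ n $ m * chern_curvature k l m n z)" for k l
  proof -
    have "wirt k (wirt_bar l u) z = wirt k (\<lambda>z. f z * inverse (D z) * F l z) z"
      by (rule wirt_cong_open[OF open_U z u_bar])
    then show ?thesis
      unfolding wirt_mult(1)[OF fi dF] wfi wF FE by (simp add: divide_inverse algebra_simps)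
  qed
  show ?thesis
    unfolding u_def[symmetric] chern_laplacian_def dd second_ricci_def by (simp add: sum_2 divide_inverse algebra_simps)
qed

text \<open>The Laplacian splits into the nonnegative terms \<open>N\<close>, \<open>P\<close> and
  \<open>Q\<close>, so a vanishing sum forces Q = 0. The vector \<open>x\<close> at which the
  torsion form is evaluated is nonzero because \<open>u z\<close> is the pairing of \<alpha> with
  its dual.\<close>

lemma laplacian_1_0:
  assumes "vanishes_on U 2 2 (del (delbar (fund_form G)))"
    and psd: "hermitian_pos_semidef (bismut_ricci_matrix U G z)"
    and s: "\<And>i. smooth_on U (\<alpha> i)" and h: "\<And>i l z. z \<in> U \<Longrightarrow> wirt_bar l (\<alpha> i) z = 0" and z: "z \<in> U"
  defines "u \<equiv> \<lambda>z. \<Sum>i\<in>UNIV. \<Sum>j\<in>UNIV. H z $ j $ i * \<alpha> i z * cnj (\<alpha> j z)"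
  shows "0 \<le> Re (chern_laplacian G u z)"
    and "Re (chern_laplacian G u z) = 0 \<Longrightarrow> u z \<noteq> 0 \<Longrightarrow> torsion i k n z = 0"
proof -
  define x :: "complex ^ 2" where "x = (\<chi> i. cnj (\<Sum>m\<in>UNIV. H z $ i $ m * \<alpha> m z))"
  define E where "E k i = wirt k (\<alpha> i) z - (\<Sum>n\<in>UNIV. \<Sum>m\<in>UNIV. dG k i n z * H z $ n $ m * \<alpha> m z)" for k i
  define N where "N = (\<Sum>k\<in>UNIV. \<Sum>l\<in>UNIV. \<Sum>i\<in>UNIV. \<Sum>j\<in>UNIV. H z $ l $ k * H z $ j $ i * E k i * cnj (E l j))"
  define P where "P = (\<Sum>i\<in>UNIV. \<Sum>j\<in>UNIV. bismut_ricci_matrix U G z $ i $ j * x $ i * cnj (x $ j))"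
  define Q where "Q = (\<Sum>i\<in>UNIV. \<Sum>j\<in>UNIV. torsion_square i j z * x $ i * cnj (x $ j))"
  have R: "second_ricci i j z = bismut_ricci_matrix U G z $ i $ j + torsion_square i j z" for i j
    using bismut_ricci_eq_second_ricci[OF assms(1) z, of i j] by simp
  have "chern_laplacian G u z = N + (\<Sum>i\<in>UNIV. \<Sum>j\<in>UNIV. second_ricci i j z * x $ i * cnj (x $ j))"
    unfolding u_def N_def E_def x_def by (subst bochner_1_0[OF s h z]) simp_all
  also have "\<dots> = N + (P + Q)" unfolding R P_def Q_def by (simp add: sum.distrib distrib_right)
  finally have eq: "Re (chern_laplacian G u z) = Re N + (Re P + Re Q)" by simp
  obtain v w :: "complex ^ 2" where H: "\<And>k l. H z $ l $ k = v $ k * cnj (v $ l) + w $ k * cnj (w $ l)"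
    by (rule matrix_inv_gram[OF pos_G[OF z]]) blast
  have N: "0 \<le> Re N" unfolding N_def
    by (rule gram_form(1)[where H = "\<lambda>l k. H z $ l $ k" and K = "\<lambda>j i. H z $ j $ i", OF H H])
  have P: "0 \<le> Re P" using psd unfolding hermitian_pos_semidef_def P_def by blast
  have Q: "0 \<le> Re Q" unfolding Q_def by (rule torsion_square_form(1)[OF z])
  show "0 \<le> Re (chern_laplacian G u z)" using eq N P Q by simp
  show "torsion i k n z = 0" if "Re (chern_laplacian G u z) = 0" "u z \<noteq> 0"
  proof (rule torsion_square_form(2)[OF z])
    show "Re (\<Sum>i\<in>UNIV. \<Sum>j\<in>UNIV. torsion_square i j z * x $ i * cnj (x $ j)) = 0"
      using eq N P Q that(1) by (simp add: Q_def)
    show "x \<noteq> 0"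
    proof
      assume "x = 0"
      have "u z = (\<Sum>j\<in>UNIV. cnj (\<alpha> j z) * cnj (x $ j))"
        unfolding u_def x_def by (simp add: sum_2 algebra_simps)
      then show False using \<open>x = 0\<close> that(2) by simp
    qed
  qed
qed

text \<open>The trace is the sum of the values of the form at the two vectors of the Cholesky
  decomposition. If it is zero, the form vanishes at the first of them, which is nonzero by
  independence.\<close>

lemma trace_nonneg:
  assumes z: "z \<in> U"
    and psd: "\<And>x :: complex ^ 2. 0 \<le> Re (\<Sum>i\<in>UNIV. \<Sum>j\<in>UNIV. P i j * x $ i * cnj (x $ j))"
  shows "0 \<le> Re (\<Sum>i\<in>UNIV. \<Sum>j\<in>UNIV. H z $ j $ i * P i j)"
    and "Re (\<Sum>i\<in>UNIV. \<Sum>j\<in>UNIV. H z $ j $ i * P i j) = 0 \<Longrightarrow>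
      \<exists>x :: complex ^ 2. x \<noteq> 0 \<and> Re (\<Sum>i\<in>UNIV. \<Sum>j\<in>UNIV. P i j * x $ i * cnj (x $ j)) = 0"
proof -
  obtain v w :: "complex ^ 2" where H: "\<And>k l. H z $ l $ k = v $ k * cnj (v $ l) + w $ k * cnj (w $ l)"
    and ne: "v $ 1 * w $ 2 - v $ 2 * w $ 1 \<noteq> 0"
    by (rule matrix_inv_gram[OF pos_G[OF z]]) blast
  have tr: "(\<Sum>i\<in>UNIV. \<Sum>j\<in>UNIV. H z $ j $ i * P i j)
      = (\<Sum>i\<in>UNIV. \<Sum>j\<in>UNIV. P i j * v $ i * cnj (v $ j)) + (\<Sum>i\<in>UNIV. \<Sum>j\<in>UNIV. P i j * w $ i * cnj (w $ j))"
    unfolding H by (simp add: sum_2 algebra_simps)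
  show "0 \<le> Re (\<Sum>i\<in>UNIV. \<Sum>j\<in>UNIV. H z $ j $ i * P i j)"
    unfolding tr using psd[of v] psd[of w] by simp
  assume "Re (\<Sum>i\<in>UNIV. \<Sum>j\<in>UNIV. H z $ j $ i * P i j) = 0"
  then have "Re (\<Sum>i\<in>UNIV. \<Sum>j\<in>UNIV. P i j * v $ i * cnj (v $ j)) = 0"
    unfolding tr plus_complex.sel using psd[of v] psd[of w] by linarith
  moreover have "v \<noteq> 0" using ne by auto
  ultimately show "\<exists>x :: complex ^ 2. x \<noteq> 0 \<and> Re (\<Sum>i\<in>UNIV. \<Sum>j\<in>UNIV. P i j * x $ i * cnj (x $ j)) = 0" by blast
qed

lemma bismut_scalar_nonneg_if_ricci_nonneg:
  assumes "z \<in> U" "hermitian_pos_semidef (bismut_ricci_matrix U G z)"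
  shows "0 \<le> bismut_scalar U G z"
  unfolding bismut_scalar_def
  by (rule trace_nonneg(1)[OF assms(1)]) (use assms(2) in \<open>simp add: hermitian_pos_semidef_def\<close>)

text \<open>The curvature enters only through its full trace, so a sign of the scalar curvature is
  enough. A zero Laplacian kills the trace of the torsion square, hence its value at some nonzero
  vector, hence the torsion.\<close>

lemma laplacian_2_0:
  assumes "vanishes_on U 2 2 (del (delbar (fund_form G)))"
    and r: "0 \<le> bismut_scalar U G z"
    and s: "smooth_on U f" and h: "\<And>l z. z \<in> U \<Longrightarrow> wirt_bar l f z = 0" and z: "z \<in> U"
  defines "u \<equiv> \<lambda>z. f z * cnj (f z) / D z"
  shows "0 \<le> Re (chern_laplacian G u z)"
    and "Re (chern_laplacian G u z) = 0 \<Longrightarrow> u z \<noteq> 0 \<Longrightarrow> torsion i k n z = 0"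
proof -
  define e :: "complex ^ 2" where "e = (\<chi> k. cnj (wirt k f z - f z * (\<Sum>m\<in>UNIV. \<Sum>n\<in>UNIV. H z $ n $ m * dG k m n z)))"
  define N where "N = Re (\<Sum>k\<in>UNIV. \<Sum>l\<in>UNIV. H z $ l $ k * (cnj (e $ k) * e $ l))"
  define T where "T = (\<Sum>i\<in>UNIV. \<Sum>j\<in>UNIV. H z $ j $ i * torsion_square i j z)"
  define d where "d = Re (D z)"
  have d: "d > 0" "D z = of_real d" using hermitian_pos_def_det[OF pos_G[OF z]] by (simp_all add: d_def)
  define c where "c = (cmod (f z))\<^sup>2 / d"
  have u: "u z = of_real c" unfolding u_def c_def d(2) by (simp add: complex_norm_square[symmetric])
  have R: "second_ricci i j z = bismut_ricci_matrix U G z $ i $ j + torsion_square i j z" for i j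
    using bismut_ricci_eq_second_ricci[OF assms(1) z, of i j] by simp
  have "chern_laplacian G u z = (\<Sum>k\<in>UNIV. \<Sum>l\<in>UNIV. H z $ l $ k * (cnj (e $ k) * e $ l)) / of_real d
      + of_real c * (\<Sum>i\<in>UNIV. \<Sum>j\<in>UNIV. H z $ j $ i * second_ricci i j z)"
    unfolding u[symmetric] unfolding u_def e_def by (subst bochner_2_0[OF s h z]) (simp_all add: d(2))
  also have "\<dots> = of_real (1 / d) * (\<Sum>k\<in>UNIV. \<Sum>l\<in>UNIV. H z $ l $ k * (cnj (e $ k) * e $ l))
      + of_real c * ((\<Sum>i\<in>UNIV. \<Sum>j\<in>UNIV. H z $ j $ i * bismut_ricci_matrix U G z $ i $ j) + T)"
    unfolding R T_def by (simp add: sum.distrib distrib_left)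
  finally have eq: "Re (chern_laplacian G u z) = N / d + c * (bismut_scalar U G z + Re T)"
    by (simp add: N_def bismut_scalar_def)
  have N: "0 \<le> N" unfolding N_def by (rule hermitian_inverse_form(1)[OF pos_G[OF z]])
  note tr = trace_nonneg[where P = "\<lambda>i j. torsion_square i j z", OF z torsion_square_form(1)[OF z]]
  have T: "0 \<le> Re T" unfolding T_def by (rule tr(1))
  have c: "0 \<le> c" using d by (simp add: c_def)
  have terms: "0 \<le> N / d" "0 \<le> c * bismut_scalar U G z" "0 \<le> c * Re T" using N d c T r by simp_all
  show "0 \<le> Re (chern_laplacian G u z)" unfolding eq using terms by (simp add: distrib_left)
  show "torsion i k n z = 0" if "Re (chern_laplacian G u z) = 0" "u z \<noteq> 0"
  proof -
    have "c * Re T = 0" using that(1) terms unfolding eq distrib_left by linarith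
    then have "Re T = 0" using that(2) unfolding u by simp
    then obtain x :: "complex ^ 2" where "x \<noteq> 0"
      "Re (\<Sum>i\<in>UNIV. \<Sum>j\<in>UNIV. torsion_square i j z * x $ i * cnj (x $ j)) = 0"
      using tr(2) unfolding T_def by blast
    then show ?thesis using torsion_square_form(2)[OF z] by blast
  qed
qed

end

section \<open>Global forms on a compact surface\<close>

lemma (in hermitian_chart) chern_laplacian_const:
  assumes "\<And>z. z \<in> U \<Longrightarrow> u z = C" and z: "z \<in> U"
  shows "chern_laplacian G u z = 0"
proof -
  have "wirt_bar l u x = 0" if "x \<in> U" for l x
    using wirt_bar_cong_open[OF open_U that assms(1), where k = l] by simp
  then have "wirt k (wirt_bar l u) z = 0" for k l
    using wirt_cong_open[OF open_U z, of "wirt_bar l u" "\<lambda>z. 0" k] by simp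
  then show ?thesis by (simp add: chern_laplacian_def)
qed

lemma (in hermitian_chart) torsion_free_vanishes:
  assumes "\<And>i k n z. z \<in> U \<Longrightarrow> torsion i k n z = 0"
  shows "vanishes_on U 2 1 (del (fund_form G))" "vanishes_on U 1 2 (delbar (fund_form G))"
proof -
  show "vanishes_on U 2 1 (del (fund_form G))"
    unfolding vanishes_on_def
    using assms by (auto simp: length_Suc_conv numeral_2_eq_2 del_fund_form)
  have "dbG l i j z = dbG j i l z" if "z \<in> U" for l i j z
    using assms[OF that, of l j i] that by (simp add: dbG_eq torsion_def)
  then show "vanishes_on U 1 2 (delbar (fund_form G))"
    unfolding vanishes_on_def
    by (auto simp: length_Suc_conv numeral_2_eq_2 delbar_fund_form)
qed

lemma hermitian_chart_metric:
  assumes "complex_atlas A" "hermitian_metric A g" "c \<in> A"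
  shows "hermitian_chart (chart_image c) (g c)"
proof
  show op: "open (chart_image c)" using assms(1,3) unfolding complex_atlas_def by blast
  show "hermitian_pos_def (g c z)" if "z \<in> chart_image c" for z
    using assms(2,3) that unfolding hermitian_metric_def by blast
  have "local_form (chart_image c) 1 1 (fund_form (g c))"
    using assms(2,3) unfolding hermitian_metric_def pq_form_def by blast
  then have "smooth_on (chart_image c) (fund_form (g c) [i] [j])" for i j
    unfolding local_form_def by simp
  from smooth_on_mult[OF op smooth_on_const[of _ "- \<i>"] this]
  show "smooth_on (chart_image c) (\<lambda>z. g c z $ i $ j)" for i j
    unfolding fund_form_1 by (simp add: mult.assoc[symmetric])
qed

section \<open>Behaviour under change of charts\<close>

abbreviation jacobian :: "('a, 2) chart \<Rightarrow> ('a, 2) chart \<Rightarrow> 'a \<Rightarrow> 2 \<Rightarrow> 2 \<Rightarrow> complex" where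
  "jacobian c d x k i \<equiv> wirt i (\<lambda>z. transition c d z $ k) (snd c x)"

lemma pq_form_transition:
  assumes "pq_form A p q \<alpha>" "c \<in> A" "d \<in> A" "x \<in> fst c" "x \<in> fst d" "length I = p" "length J = q"
  shows "\<alpha> c I J (snd c x) = (\<Sum>K | length K = p. \<Sum>L | length L = q.
      \<alpha> d K L (snd d x) * (\<Prod>a<p. jacobian c d x (K ! a) (I ! a))
      * (\<Prod>b<q. cnj (jacobian c d x (L ! b) (J ! b))))"
  using assms unfolding pq_form_def by blast

lemma metric_transition:
  fixes A :: "('a::topological_space, 2) chart set"
  assumes "hermitian_metric A g" "c \<in> A" "d \<in> A" "x \<in> fst c" "x \<in> fst d"
  shows "g c (snd c x) $ i $ j
    = (\<Sum>k\<in>UNIV. \<Sum>l\<in>UNIV. g d (snd d x) $ k $ l * jacobian c d x k i * cnj (jacobian c d x l j))"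
proof -
  have "fund_form (g c) [i] [j] (snd c x) = (\<Sum>K | length K = 1. \<Sum>L | length L = 1.
      fund_form (g d) K L (snd d x) * (\<Prod>a<1. jacobian c d x (K ! a) ([i] ! a))
      * (\<Prod>b<1. cnj (jacobian c d x (L ! b) ([j] ! b))))"
    using assms unfolding hermitian_metric_def by (intro pq_form_transition) auto
  then have "\<i> * g c (snd c x) $ i $ j
      = \<i> * (\<Sum>k\<in>UNIV. \<Sum>l\<in>UNIV. g d (snd d x) $ k $ l * jacobian c d x k i * cnj (jacobian c d x l j))"
    unfolding sum_length_1 fund_form_1 by (simp add: sum_distrib_left mult.assoc)
  then show ?thesis by simp
qed

lemma form_1_0_transition:
  fixes A :: "('a::topological_space, 2) chart set"
  assumes "pq_form A 1 0 \<alpha>" "c \<in> A" "d \<in> A" "x \<in> fst c" "x \<in> fst d"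
  shows "\<alpha> c [i] [] (snd c x) = (\<Sum>k\<in>UNIV. \<alpha> d [k] [] (snd d x) * jacobian c d x k i)"
proof -
  have "\<alpha> c [i] [] (snd c x) = (\<Sum>K | length K = 1. \<Sum>L | length L = 0.
      \<alpha> d K L (snd d x) * (\<Prod>a<1. jacobian c d x (K ! a) ([i] ! a))
      * (\<Prod>b<0. cnj (jacobian c d x (L ! b) ([] ! b))))"
    by (rule pq_form_transition[OF assms]) auto
  then show ?thesis unfolding sum_length_1 sum_length_0 by simp
qed

lemma form_2_0_antisym:
  assumes "local_form U 2 0 \<alpha>" "z \<in> U"
  shows "\<alpha> [i, j] [] z = - \<alpha> [j, i] [] z"
proof -
  have "\<alpha> ([j, i][0 := [j, i] ! 1, 1 := [j, i] ! 0]) [] z = - \<alpha> [j, i] [] z"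
    using assms unfolding local_form_def
    by (metis One_nat_def length_Cons list.size(3) numeral_2_eq_2 pos2 zero_neq_one lessI)
  then show ?thesis by simp
qed

lemma form_2_0_transition:
  fixes A :: "('a::topological_space, 2) chart set"
  assumes "pq_form A 2 0 \<alpha>" "c \<in> A" "d \<in> A" "x \<in> fst c" "x \<in> fst d"
  shows "\<alpha> c [1, 2] [] (snd c x) = \<alpha> d [1, 2] [] (snd d x)
    * (jacobian c d x 1 1 * jacobian c d x 2 2 - jacobian c d x 2 1 * jacobian c d x 1 2)"
proof -
  have "\<alpha> c [1, 2] [] (snd c x) = (\<Sum>K | length K = 2. \<Sum>L | length L = 0.
      \<alpha> d K L (snd d x) * (\<Prod>a<2. jacobian c d x (K ! a) ([1, 2] ! a))
      * (\<Prod>b<0. cnj (jacobian c d x (L ! b) ([] ! b))))"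
    by (rule pq_form_transition[OF assms]) auto
  also have "\<dots> = (\<Sum>k\<in>UNIV. \<Sum>l\<in>UNIV. \<alpha> d [k, l] [] (snd d x) * (jacobian c d x k 1 * jacobian c d x l 2))"
    unfolding sum_length_2 sum_length_0 by (simp add: numeral_2_eq_2)
  finally have 1: "\<alpha> c [1, 2] [] (snd c x)
      = (\<Sum>k\<in>UNIV. \<Sum>l\<in>UNIV. \<alpha> d [k, l] [] (snd d x) * (jacobian c d x k 1 * jacobian c d x l 2))" .
  have "local_form (chart_image d) 2 0 (\<alpha> d)" "snd d x \<in> chart_image d"
    using assms unfolding pq_form_def chart_image_def by auto
  note anti = form_2_0_antisym[OF this]
  have diag: "\<alpha> d [k, k] [] (snd d x) = 0" for k using anti[of k k] by simp
  show ?thesis unfolding 1 using anti[of 2 1] by (simp add: sum_2 diag algebra_simps)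
qed

text \<open>In matrix form P = T R S with \<open>S\<close> the conjugate transpose of
  \<open>T\<close>, so the inverse of \<open>P\<close> absorbs the factors that \<open>a\<close>
  picks up. The invertibility of \<open>T\<close> is read off from that of \<open>P\<close>.\<close>

lemma dual_norm_transition:
  fixes P R :: "complex ^ 2 ^ 2" and a b :: "2 \<Rightarrow> complex"
  assumes "det P \<noteq> 0"
    and P: "\<And>i j. P $ i $ j = (\<Sum>k\<in>UNIV. \<Sum>l\<in>UNIV. R $ k $ l * t k i * cnj (t l j))"
    and a: "\<And>i. a i = (\<Sum>k\<in>UNIV. b k * t k i)"
  shows "(\<Sum>i\<in>UNIV. \<Sum>j\<in>UNIV. matrix_inv P $ j $ i * a i * cnj (a j))
    = (\<Sum>i\<in>UNIV. \<Sum>j\<in>UNIV. matrix_inv R $ j $ i * b i * cnj (b j))"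
proof -
  define T S :: "complex ^ 2 ^ 2" where "T = (\<chi> i k. t k i)" and "S = (\<chi> l j. cnj (t l j))"
  have "P = T ** (R ** S)"
    by (simp add: vec_eq_iff matrix_matrix_mult_def T_def S_def P sum_2 algebra_simps)
  moreover obtain Q where Q: "P ** Q = mat 1"
    using assms(1) unfolding invertible_det_nz[symmetric] invertible_def by blast
  ultimately have "T ** ((R ** S) ** Q) = mat 1" by (simp add: matrix_mul_assoc)
  then have "((R ** S) ** Q) ** T = mat 1" using matrix_left_right_inverse by blast
  then have "R ** (S ** Q ** T) = mat 1" by (simp add: matrix_mul_assoc)
  then have "matrix_inv R = S ** Q ** T" by (rule matrix_inv_unique)
  moreover have "matrix_inv P = Q" using Q by (rule matrix_inv_unique)
  ultimately show ?thesis
    by (simp add: a matrix_matrix_mult_def T_def S_def sum_2 algebra_simps)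
qed

lemma det_transition:
  fixes P R :: "complex ^ 2 ^ 2"
  assumes "\<And>i j. P $ i $ j = (\<Sum>k\<in>UNIV. \<Sum>l\<in>UNIV. R $ k $ l * t k i * cnj (t l j))"
  defines "\<tau> \<equiv> t 1 1 * t 2 2 - t 2 1 * t 1 2"
  shows "det P = det R * (\<tau> * cnj \<tau>)"
  unfolding det_2 assms(1) \<tau>_def by (simp add: sum_2 algebra_simps)

text \<open>For q = 0 two closed forms are cohomologous if they agree on the charts, so families
  that differ only in irrelevant values share a class; when all closed forms vanish, one class
  remains.\<close>

lemma dolbeault_trivial_if_no_closed_forms:
  assumes "\<And>\<alpha>. \<alpha> \<in> delbar_closed_forms A p 0 \<Longrightarrow> form_vanishes A p 0 \<alpha>"
  shows "dolbeault_trivial A p 0"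
proof -
  let ?X = "delbar_closed_forms A p 0"
  let ?R = "{(\<alpha>, \<beta>). \<alpha> \<in> ?X \<and> \<beta> \<in> ?X \<and> delbar_exact A p 0 (\<lambda>c I J z. \<alpha> c I J z - \<beta> c I J z)}"
  \<comment> \<open>Ensures that the quotient has exactly one element instead of none.\<close>
  have "(\<lambda>c I J z. 0) \<in> ?X"
    unfolding delbar_closed_forms_def pq_form_def local_form_def form_vanishes_def vanishes_on_def delbar_def
    by (simp add: smooth_on_const)
  moreover have "?R `` {\<alpha>} = ?X" if "\<alpha> \<in> ?X" for \<alpha>
  proof -
    have "delbar_exact A p 0 (\<lambda>c I J z. \<alpha> c I J z - \<beta> c I J z)" if "\<beta> \<in> ?X" for \<beta>
      using assms[OF \<open>\<alpha> \<in> ?X\<close>] assms[OF that]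
      by (simp add: delbar_exact_def form_vanishes_def vanishes_on_def)
    then show ?thesis using that by auto
  qed
  ultimately have "?X // ?R = {?X}" unfolding quotient_def by blast
  then show ?thesis unfolding dolbeault_trivial_def dolbeault_cohomology_def by (simp add: is_singleton_def)
qed

text \<open>The common end of both Bochner arguments: the value of the constant decides. If it is
  nonzero, both premises of \<open>flat\<close> hold at every point.\<close>

lemma kaehler_or_zero:
  fixes A :: "('a::t2_space, 2) chart set"
  assumes A: "complex_atlas A" "compact (UNIV :: 'a set)" "connected (UNIV :: 'a set)" and g: "hermitian_metric A g"
    and u: "\<And>c. c \<in> A \<Longrightarrow> smooth_on (chart_image c) (u c)"
    and real: "\<And>c z. c \<in> A \<Longrightarrow> z \<in> chart_image c \<Longrightarrow> u c z \<in> \<real>"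
    and glob: "\<And>c d x. c \<in> A \<Longrightarrow> d \<in> A \<Longrightarrow> x \<in> fst c \<Longrightarrow> x \<in> fst d \<Longrightarrow> u c (snd c x) = u d (snd d x)"
    and sub: "\<And>c z. c \<in> A \<Longrightarrow> z \<in> chart_image c \<Longrightarrow> 0 \<le> Re (chern_laplacian (g c) (u c) z)"
    and flat: "\<And>c z i k n. c \<in> A \<Longrightarrow> z \<in> chart_image c \<Longrightarrow> Re (chern_laplacian (g c) (u c) z) = 0 \<Longrightarrow>
      u c z \<noteq> 0 \<Longrightarrow> hermitian_chart.torsion (g c) i k n z = 0"
  shows "kaehler A g \<or> (\<forall>c\<in>A. \<forall>z\<in>chart_image c. u c z = 0)"
proof -
  note chart = hermitian_chart_metric[OF A(1) g]
  obtain M where M: "\<And>c z. c \<in> A \<Longrightarrow> z \<in> chart_image c \<Longrightarrow> Re (u c z) = M"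
    using strong_maximum_compact[OF A chart u glob sub] by blast
  have uM: "u c z = of_real M" if "c \<in> A" "z \<in> chart_image c" for c z
    using M[OF that] real[OF that] by (metis Re_complex_of_real Reals_cases)
  show ?thesis
  proof (cases "M = 0")
    case True
    then show ?thesis using uM by simp
  next
    case False
    have "vanishes_on (chart_image c) 2 1 (del (fund_form (g c))) \<and>
        vanishes_on (chart_image c) 1 2 (delbar (fund_form (g c)))" if c: "c \<in> A" for c
    proof -
      interpret hermitian_chart "chart_image c" "g c" by (rule chart[OF c])
      have "torsion i k n z = 0" if z: "z \<in> chart_image c" for i k n z
      proof (rule flat[OF c z])
        show "Re (chern_laplacian (g c) (u c) z) = 0"
          using chern_laplacian_const[OF uM[OF c] z] by simp
        show "u c z \<noteq> 0" using uM[OF c z] False by simp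
      qed
      then show ?thesis using torsion_free_vanishes by blast
    qed
    then show ?thesis unfolding kaehler_def form_vanishes_def by blast
  qed
qed

lemma closed_form_1_0:
  assumes "\<alpha> \<in> delbar_closed_forms A 1 0" "c \<in> A"
  shows "smooth_on (chart_image c) (\<alpha> c [i] [])" "z \<in> chart_image c \<Longrightarrow> wirt_bar l (\<alpha> c [i] []) z = 0"
proof -
  show "smooth_on (chart_image c) (\<alpha> c [i] [])"
    using assms unfolding delbar_closed_forms_def pq_form_def local_form_def by simp
  assume "z \<in> chart_image c"
  then have "delbar (\<alpha> c) [i] [l] z = 0"
    using assms unfolding delbar_closed_forms_def form_vanishes_def vanishes_on_def by simp
  then show "wirt_bar l (\<alpha> c [i] []) z = 0" by (simp add: delbar_1)
qed

lemma closed_form_2_0: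
  assumes "\<alpha> \<in> delbar_closed_forms A 2 0" "c \<in> A"
  shows "smooth_on (chart_image c) (\<alpha> c [i, j] [])" "z \<in> chart_image c \<Longrightarrow> wirt_bar l (\<alpha> c [i, j] []) z = 0"
proof -
  show "smooth_on (chart_image c) (\<alpha> c [i, j] [])"
    using assms unfolding delbar_closed_forms_def pq_form_def local_form_def by simp
  assume "z \<in> chart_image c"
  then have "delbar (\<alpha> c) [i, j] [l] z = 0"
    using assms unfolding delbar_closed_forms_def form_vanishes_def vanishes_on_def by simp
  then show "wirt_bar l (\<alpha> c [i, j] []) z = 0" by (simp add: delbar_1)
qed

lemma kaehler_or_H_1_0_trivial:
  fixes A :: "('a::t2_space, 2) chart set"
  assumes A: "complex_atlas A" "compact (UNIV :: 'a set)" "connected (UNIV :: 'a set)" and g: "hermitian_metric A g"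
    and pc: "pluriclosed A g" and ric: "bismut_ricci_nonneg A g"
  shows "kaehler A g \<or> dolbeault_trivial A 1 0"
proof (subst disj_commute, rule disjCI, rule dolbeault_trivial_if_no_closed_forms)
  fix \<alpha> assume nk: "\<not> kaehler A g"  and \<alpha>: "\<alpha> \<in> delbar_closed_forms A 1 0"
  note chart = hermitian_chart_metric[OF A(1) g]
  define u where "u c z = (\<Sum>i\<in>UNIV. \<Sum>j\<in>UNIV. matrix_inv (g c z) $ j $ i * \<alpha> c [i] [] z * cnj (\<alpha> c [j] [] z))" for c z
  \<comment> \<open>The norm of \<alpha> in the shape of \<open>hermitian_inverse_form\<close>,
    which expects the conjugate components as its vector.\<close>
  have u_form: "u c z = (\<Sum>k\<in>UNIV. \<Sum>l\<in>UNIV. matrix_inv (g c z) $ l $ k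
      * (cnj ((\<chi> i. cnj (\<alpha> c [i] [] z)) $ k) * (\<chi> i. cnj (\<alpha> c [i] [] z)) $ l))" for c z
    by (simp add: u_def mult.assoc)
  have pos: "hermitian_pos_def (g c z)" if "c \<in> A" "z \<in> chart_image c" for c z
    using g that unfolding hermitian_metric_def by blast
  have "kaehler A g \<or> (\<forall>c\<in>A. \<forall>z\<in>chart_image c. u c z = 0)"
  proof (rule kaehler_or_zero[OF A g])
    fix c assume c: "c \<in> A"
    interpret hermitian_chart "chart_image c" "g c" by (rule chart[OF c])
    have pcc: "vanishes_on (chart_image c) 2 2 (del (delbar (fund_form (g c))))"
      using pc c unfolding pluriclosed_def form_vanishes_def by blast
    note s = closed_form_1_0(1)[OF \<alpha> c] and h = closed_form_1_0(2)[OF \<alpha> c]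
    show "smooth_on (chart_image c) (u c)"
      unfolding u_def by (intro smooth_rules smooth_H s open_U)
    fix z assume z: "z \<in> chart_image c"
    show "u c z \<in> \<real>" unfolding u_form
      by (subst hermitian_inverse_form(3)[OF pos[OF c z]]) (rule Reals_of_real)
    have psd: "hermitian_pos_semidef (bismut_ricci_matrix (chart_image c) (g c) z)"
      using ric c z unfolding bismut_ricci_nonneg_def by blast
    note lap = laplacian_1_0[where \<alpha> = "\<lambda>i. \<alpha> c [i] []", OF pcc psd s _ z, folded u_def]
    show "0 \<le> Re (chern_laplacian (g c) (u c) z)" by (rule lap(1)) (rule h)
    show "torsion i k n z = 0" if "Re (chern_laplacian (g c) (u c) z) = 0" "u c z \<noteq> 0" for i k n
      by (rule lap(2)[OF _ that]) (rule h)
  next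
    fix c d x assume cd: "c \<in> A" "d \<in> A" "x \<in> fst c" "x \<in> fst d"
    have "det (g c (snd c x)) \<noteq> 0"
      using hermitian_chart.det_nz[OF chart[OF cd(1)]] cd(3) by (simp add: chart_image_def)
    then show "u c (snd c x) = u d (snd d x)"
      unfolding u_def
      by (rule dual_norm_transition[OF _ metric_transition[OF g cd]])
        (rule form_1_0_transition[OF _ cd], use \<alpha> in \<open>simp add: delbar_closed_forms_def\<close>)
  qed
  then have u0: "u c z = 0" if "c \<in> A" "z \<in> chart_image c" for c z using nk that by blast
  have "\<alpha> c [i] [] z = 0" if c: "c \<in> A" and z: "z \<in> chart_image c" for c z i
  proof -
    have "(\<chi> i. cnj (\<alpha> c [i] [] z)) = 0"
    proof (rule ccontr)
      assume "(\<chi> i. cnj (\<alpha> c [i] [] z)) \<noteq> 0"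
      from hermitian_inverse_form(2)[OF pos[OF c z] this] have "0 < Re (u c z)" unfolding u_form .
      then show False using u0[OF c z] by simp
    qed
    then show ?thesis by (simp add: vec_eq_iff)
  qed
  then show "form_vanishes A 1 0 \<alpha>"
    unfolding form_vanishes_def vanishes_on_def by (auto simp: length_Suc_conv)
qed

lemma kaehler_or_H_2_0_trivial:
  fixes A :: "('a::t2_space, 2) chart set"
  assumes A: "complex_atlas A" "compact (UNIV :: 'a set)" "connected (UNIV :: 'a set)" and g: "hermitian_metric A g"
    and pc: "pluriclosed A g" and scal: "bismut_scalar_nonneg A g"
  shows "kaehler A g \<or> dolbeault_trivial A 2 0"
proof (subst disj_commute, rule disjCI, rule dolbeault_trivial_if_no_closed_forms)
  fix \<alpha> assume nk: "\<not> kaehler A g" and \<alpha>: "\<alpha> \<in> delbar_closed_forms A 2 0"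
  note chart = hermitian_chart_metric[OF A(1) g]
  have pq: "pq_form A 2 0 \<alpha>" using \<alpha> by (simp add: delbar_closed_forms_def)
  \<comment> \<open>A (2,0)-form on a surface is determined by its component at
    \<open>[1, 2]\<close>, and this is its squared norm.\<close>
  define u where "u c z = \<alpha> c [1, 2] [] z * cnj (\<alpha> c [1, 2] [] z) / det (g c z)" for c z
  have pos: "hermitian_pos_def (g c z)" if "c \<in> A" "z \<in> chart_image c" for c z
    using g that unfolding hermitian_metric_def by blast
  have "kaehler A g \<or> (\<forall>c\<in>A. \<forall>z\<in>chart_image c. u c z = 0)"
  proof (rule kaehler_or_zero[OF A g])
    fix c assume c: "c \<in> A"
    interpret hermitian_chart "chart_image c" "g c" by (rule chart[OF c])
    have pcc: "vanishes_on (chart_image c) 2 2 (del (delbar (fund_form (g c))))"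
      using pc c unfolding pluriclosed_def form_vanishes_def by blast
    note s = closed_form_2_0(1)[OF \<alpha> c] and h = closed_form_2_0(2)[OF \<alpha> c]
    show "smooth_on (chart_image c) (u c)"
      unfolding u_def by (intro smooth_rules smooth_on_divide smooth_det det_nz s open_U)
    fix z assume z: "z \<in> chart_image c"
    have "det (g c z) \<in> \<real>"
      by (subst hermitian_pos_def_det(1)[OF pos[OF c z]]) (rule Reals_of_real)
    then show "u c z \<in> \<real>" unfolding u_def by (simp add: complex_norm_square[symmetric])
    have scz: "0 \<le> bismut_scalar (chart_image c) (g c) z"
      using scal c z unfolding bismut_scalar_nonneg_def by blast
    note lap = laplacian_2_0[where f = "\<alpha> c [1, 2] []", OF pcc scz s _ z]
    show "0 \<le> Re (chern_laplacian (g c) (u c) z)" unfolding u_def by (rule lap(1)) (rule h)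
    show "torsion i k n z = 0" if "Re (chern_laplacian (g c) (u c) z) = 0" "u c z \<noteq> 0" for i k n
      using that unfolding u_def by (intro lap(2) h)
  next
    fix c d x assume cd: "c \<in> A" "d \<in> A" "x \<in> fst c" "x \<in> fst d"
    \<comment> \<open>The Jacobian determinant: the component scales by \<open>t\<close>, the
      determinant of the metric by its squared modulus, so the quotient is invariant.\<close>
    define t where "t = jacobian c d x 1 1 * jacobian c d x 2 2 - jacobian c d x 2 1 * jacobian c d x 1 2"
    have "det (g c (snd c x)) \<noteq> 0"
      using hermitian_chart.det_nz[OF chart[OF cd(1)]] cd(3) by (simp add: chart_image_def)
    moreover have "det (g c (snd c x)) = det (g d (snd d x)) * (t * cnj t)"
      unfolding t_def by (rule det_transition) (rule metric_transition[OF g cd])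
    ultimately show "u c (snd c x) = u d (snd d x)"
      unfolding u_def form_2_0_transition[OF pq cd] t_def[symmetric] by (simp add: field_simps)
  qed
  then have u0: "u c z = 0" if "c \<in> A" "z \<in> chart_image c" for c z using nk that by blast
  have "\<alpha> c [i, j] [] z = 0" if c: "c \<in> A" and z: "z \<in> chart_image c" for c z i j
  proof -
    have "local_form (chart_image c) 2 0 (\<alpha> c)" using pq c unfolding pq_form_def by blast
    note anti = form_2_0_antisym[OF this z]
    have "\<alpha> c [1, 2] [] z = 0"
      using u0[OF c z] hermitian_chart.det_nz[OF chart[OF c] z] by (simp add: u_def)
    moreover from this have "\<alpha> c [2, 1] [] z = 0" unfolding anti[of 2 1] by simp
    moreover have "\<alpha> c [k, k] [] z = 0" for k using anti[of k k] by simp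
    ultimately show ?thesis using exhaust_2[of i] exhaust_2[of j] by auto
  qed
  then show "form_vanishes A 2 0 \<alpha>"
    unfolding form_vanishes_def vanishes_on_def by (auto simp: length_Suc_conv numeral_2_eq_2)
qed

theorem theorem6p2:
  fixes A :: "('a::t2_space, 2) chart set"
    and g :: "('a, 2) metric"
  assumes "complex_atlas A"
    and "compact (UNIV :: 'a set)"
    and "connected (UNIV :: 'a set)"
    and "hermitian_metric A g"
    and "pluriclosed A g"
  shows "(bismut_ricci_nonneg A g \<longrightarrow>
            kaehler A g \<or> (\<forall>p\<in>{1..2}. dolbeault_trivial A p 0)) \<and>
         (bismut_scalar_nonneg A g \<longrightarrow>
            kaehler A g \<or> dolbeault_trivial A 2 0)"
proof -
  \<comment> \<open>Reduces the case p = 2 of the first claim to the second claim.\<close>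
  have "bismut_scalar_nonneg A g" if "bismut_ricci_nonneg A g"
    using that hermitian_chart.bismut_scalar_nonneg_if_ricci_nonneg[OF hermitian_chart_metric[OF assms(1,4)]]
    unfolding bismut_scalar_nonneg_def bismut_ricci_nonneg_def by blast
  moreover have "p = 1 \<or> p = 2" if "p \<in> {1..2}" for p :: nat using that by auto
  ultimately show ?thesis
    using kaehler_or_H_1_0_trivial[OF assms] kaehler_or_H_2_0_trivial[OF assms] by blast
qed

end
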